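(* (In Homotopy Type Theory.) Let $X$ be a $1$-type. The precategory $HX$ has finite coproducts. In particular, it is sifted.
   Context: We work in Homotopy Type Theory (HoTT) with the conventions of the HoTT Book (no excluded middle or choice). "Merely" means up to propositional truncation. $\mathrm{Fin}(n)$ is the standard $n$-element set, and $X^n$ is identified with $\mathrm{Fin}(n)\to X$. For a $1$-type $X$, the precategory $HX$ has type of objects $\sum_{n:\mathbb N}X^n$ and morphisms $$(n,x)\to(m,y)\ :=\ \sum_{f:\mathrm{Fin}(n)\to\mathrm{Fin}(m)} \big(x=_{X^n}y\circ f\big),$$ with the evident identities and composition. A zig-zag of length $n$ from $c$ to $c'$ in a precategory is a path $c=c'$ if $n=0$, or a sequence of morphisms $c\to c_1\leftarrow\cdots\to c_{2n-1}\leftarrow c'$ if $n\ge1$. A precategory is connected if it is merely inhabited and any two objects are merely connected by a zig-zag. A functor $F:\mathcal C'\to\mathcal C$ is final if for every $c:\mathcal C$ the slice precategory $c/F$ (objects: pairs of $c':\mathcal C'$ and a morphism $c\to F(c')$) is connected. A precategory $\mathcal S$ is sifted if it is merely inhabited and the diagonal $\mathcal S\to\mathcal S\times\mathcal S$ is final. *)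

theory Defs
  imports Main
begin

section \<open>Homotopy type theory as a formal system\<close>

text \<open>
  The statement is about derivability in homotopy type theory, so the type theory is
  formalized as an object language. It is the fragment of the theory of the HoTT Book
  generated by a cumulative hierarchy of universes \<open>U 0, U 1, \<dots>\<close>, \<open>\<Pi>\<close>- and \<open>\<Sigma>\<close>-types, the
  empty and the unit type, binary sums, natural numbers, identity types and propositional
  truncations, with function extensionality and univalence as axioms; what is derivable in the
  fragment is derivable in the full theory. Neither excluded middle nor choice is available. As in the first presentation in the appendix of the Book, all
  type formers besides \<open>\<Pi>\<close> and the universes are constants of suitable types, and judgmental
  equality is conversion of terms.
\<close>

datatype cnst =
    CSigma | CPair | CIndSigma
  | CSum | CInl | CInr | CIndSum
  | CEmpty | CIndEmpty
  | CUnit | CStar | CIndUnit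
  | CNat | CZero | CSucc | CIndNat
  | CId | CRefl | CIndId
  | CTrunc | CTr | CSquash | CRecTrunc
  | CFunext
  | CUnivalence

text \<open>Terms with de Bruijn indices; the second argument of \<open>Pi\<close> and \<open>Lam\<close> binds one variable.\<close>

datatype tm = Var nat | U nat | Pi tm tm | Lam tm tm | App tm tm | Cst cnst

primrec shift :: "nat \<Rightarrow> nat \<Rightarrow> tm \<Rightarrow> tm" where
  "shift d k (Var n) = (if n < k then Var n else Var (n + d))"
| "shift d k (U i) = U i"
| "shift d k (Pi A B) = Pi (shift d k A) (shift d (Suc k) B)"
| "shift d k (Lam A b) = Lam (shift d k A) (shift d (Suc k) b)"
| "shift d k (App f a) = App (shift d k f) (shift d k a)"
| "shift d k (Cst c) = Cst c"

text \<open>\<open>subst k s t\<close> replaces the variable \<open>k\<close> of \<open>t\<close> by \<open>s\<close>, which lives outside of the \<open>k\<close>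
  innermost binders, and removes it from the context.\<close>

primrec subst :: "nat \<Rightarrow> tm \<Rightarrow> tm \<Rightarrow> tm" where
  "subst k s (Var n) = (if n < k then Var n else if n = k then shift k 0 s else Var (n - 1))"
| "subst k s (U i) = U i"
| "subst k s (Pi A B) = Pi (subst k s A) (subst (Suc k) s B)"
| "subst k s (Lam A b) = Lam (subst k s A) (subst (Suc k) s b)"
| "subst k s (App f a) = App (subst k s f) (subst k s a)"
| "subst k s (Cst c) = Cst c"


subsection \<open>Named variables\<close>

text \<open>
  To write terms with bound variables of the metalanguage, an expression is a term that
  depends on the number \<open>n\<close> of binders above it: the variable bound at depth \<open>k\<close> has index
  \<open>n - Suc k\<close> at depth \<open>n\<close>. A closed expression denotes the term obtained at depth \<open>0\<close>.
\<close>

type_synonym ex = "nat \<Rightarrow> tm"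

definition bvar :: "nat \<Rightarrow> ex" where
  "bvar k = (\<lambda>n. Var (n - Suc k))"

definition PI :: "ex \<Rightarrow> (ex \<Rightarrow> ex) \<Rightarrow> ex" where
  "PI A B = (\<lambda>n. Pi (A n) (B (bvar n) (Suc n)))"

definition LAM :: "ex \<Rightarrow> (ex \<Rightarrow> ex) \<Rightarrow> ex" where
  "LAM A b = (\<lambda>n. Lam (A n) (b (bvar n) (Suc n)))"

definition APP :: "ex \<Rightarrow> ex \<Rightarrow> ex"  (infixl "\<cdot>" 90) where
  "f \<cdot> a = (\<lambda>n. App (f n) (a n))"

definition CST :: "cnst \<Rightarrow> ex" where
  "CST c = (\<lambda>n. Cst c)"

definition UU :: "nat \<Rightarrow> ex" where
  "UU i = (\<lambda>n. U i)"

definition closed_tm :: "ex \<Rightarrow> tm" where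
  "closed_tm e = e 0"

syntax
  "_PI" :: "pttrn \<Rightarrow> ex \<Rightarrow> ex \<Rightarrow> ex"  ("(3\<Pi> _ : _./ _)" [0, 0, 10] 10)
  "_LAM" :: "pttrn \<Rightarrow> ex \<Rightarrow> ex \<Rightarrow> ex"  ("(3\<^bold>\<lambda> _ : _./ _)" [0, 0, 10] 10)
translations
  "\<Pi> x : A. B" \<rightleftharpoons> "CONST PI A (\<lambda>x. B)"
  "\<^bold>\<lambda> x : A. b" \<rightleftharpoons> "CONST LAM A (\<lambda>x. b)"

definition Arrow :: "ex \<Rightarrow> ex \<Rightarrow> ex"  (infixr "\<rightarrow>" 55) where
  "A \<rightarrow> B = (\<Pi> x : A. B)"

definition SIG :: "ex \<Rightarrow> (ex \<Rightarrow> ex) \<Rightarrow> ex" where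
  "SIG A B = CST CSigma \<cdot> A \<cdot> LAM A B"

syntax
  "_SIG" :: "pttrn \<Rightarrow> ex \<Rightarrow> ex \<Rightarrow> ex"  ("(3\<Sigma> _ : _./ _)" [0, 0, 10] 10)
translations
  "\<Sigma> x : A. B" \<rightleftharpoons> "CONST SIG A (\<lambda>x. B)"

definition PAIR :: "ex \<Rightarrow> (ex \<Rightarrow> ex) \<Rightarrow> ex \<Rightarrow> ex \<Rightarrow> ex" where
  "PAIR A B a b = CST CPair \<cdot> A \<cdot> LAM A B \<cdot> a \<cdot> b"

text \<open>The projections are functions of the type theory on a universe \<open>U i\<close>, so that their
  arguments are not duplicated. The same device is used for the notions below.\<close>

definition proj1 :: "nat \<Rightarrow> ex" where
  "proj1 i = (\<^bold>\<lambda> A : UU i. \<^bold>\<lambda> B : A \<rightarrow> UU i. \<^bold>\<lambda> p : CST CSigma \<cdot> A \<cdot> B.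
     CST CIndSigma \<cdot> A \<cdot> B \<cdot> (\<^bold>\<lambda> q : CST CSigma \<cdot> A \<cdot> B. A)
       \<cdot> (\<^bold>\<lambda> a : A. \<^bold>\<lambda> b : B \<cdot> a. a) \<cdot> p)"

definition proj2 :: "nat \<Rightarrow> ex" where
  "proj2 i = (\<^bold>\<lambda> A : UU i. \<^bold>\<lambda> B : A \<rightarrow> UU i. \<^bold>\<lambda> p : CST CSigma \<cdot> A \<cdot> B.
     CST CIndSigma \<cdot> A \<cdot> B \<cdot> (\<^bold>\<lambda> q : CST CSigma \<cdot> A \<cdot> B. B \<cdot> (proj1 i \<cdot> A \<cdot> B \<cdot> q))
       \<cdot> (\<^bold>\<lambda> a : A. \<^bold>\<lambda> b : B \<cdot> a. b) \<cdot> p)"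

definition pr1 :: "nat \<Rightarrow> ex \<Rightarrow> (ex \<Rightarrow> ex) \<Rightarrow> ex \<Rightarrow> ex" where
  "pr1 i A B p = proj1 i \<cdot> A \<cdot> LAM A B \<cdot> p"

definition pr2 :: "nat \<Rightarrow> ex \<Rightarrow> (ex \<Rightarrow> ex) \<Rightarrow> ex \<Rightarrow> ex" where
  "pr2 i A B p = proj2 i \<cdot> A \<cdot> LAM A B \<cdot> p"

definition Prod :: "ex \<Rightarrow> ex \<Rightarrow> ex"  (infixr "\<otimes>" 65) where
  "A \<otimes> B = (\<Sigma> x : A. B)"

definition Sum :: "ex \<Rightarrow> ex \<Rightarrow> ex"  (infixr "\<oplus>" 60) where
  "A \<oplus> B = CST CSum \<cdot> A \<cdot> B"

definition EQ :: "ex \<Rightarrow> ex \<Rightarrow> ex \<Rightarrow> ex" where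
  "EQ A a b = CST CId \<cdot> A \<cdot> a \<cdot> b"

definition rfl :: "ex \<Rightarrow> ex \<Rightarrow> ex" where
  "rfl A a = CST CRefl \<cdot> A \<cdot> a"

definition Trunc :: "ex \<Rightarrow> ex" where
  "Trunc A = CST CTrunc \<cdot> A"

definition is_prop :: "ex \<Rightarrow> ex" where
  "is_prop A = (\<Pi> x : A. \<Pi> y : A. EQ A x y)"

definition is_set :: "ex \<Rightarrow> ex" where
  "is_set A = (\<Pi> x : A. \<Pi> y : A. \<Pi> p : EQ A x y. \<Pi> q : EQ A x y. EQ (EQ A x y) p q)"

definition is_1type :: "ex \<Rightarrow> ex" where
  "is_1type A = (\<Pi> x : A. \<Pi> y : A. \<Pi> p : EQ A x y. \<Pi> q : EQ A x y.
     \<Pi> r : EQ (EQ A x y) p q. \<Pi> s : EQ (EQ A x y) p q. EQ (EQ (EQ A x y) p q) r s)"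

definition is_contr :: "ex \<Rightarrow> ex" where
  "is_contr A = (\<Sigma> x : A. \<Pi> y : A. EQ A x y)"

definition is_equiv :: "ex \<Rightarrow> ex \<Rightarrow> ex \<Rightarrow> ex" where
  "is_equiv A B f =
     (\<Sigma> g : B \<rightarrow> A. \<Pi> y : B. EQ B (f \<cdot> (g \<cdot> y)) y)
     \<otimes> (\<Sigma> h : B \<rightarrow> A. \<Pi> x : A. EQ A (h \<cdot> (f \<cdot> x)) x)"

definition Equiv :: "ex \<Rightarrow> ex \<Rightarrow> ex" where
  "Equiv A B = (\<Sigma> f : A \<rightarrow> B. is_equiv A B f)"

text \<open>The identity equivalence, needed for the map \<open>idtoeqv\<close> in the univalence axiom.\<close>

definition id_equiv :: "ex \<Rightarrow> ex" where
  "id_equiv A =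
     (let I = (\<^bold>\<lambda> x : A. x); R = (\<^bold>\<lambda> x : A. rfl A x);
          sec = (\<lambda>g. \<Pi> y : A. EQ A (I \<cdot> (g \<cdot> y)) y);
          ret = (\<lambda>h. \<Pi> x : A. EQ A (h \<cdot> (I \<cdot> x)) x)
      in PAIR (A \<rightarrow> A) (\<lambda>f. is_equiv A A f) I
           (PAIR (SIG (A \<rightarrow> A) sec) (\<lambda>_. SIG (A \<rightarrow> A) ret)
             (PAIR (A \<rightarrow> A) sec I R) (PAIR (A \<rightarrow> A) ret I R)))"

definition idtoeqv :: "nat \<Rightarrow> ex \<Rightarrow> ex \<Rightarrow> ex" where
  "idtoeqv i A B = (\<^bold>\<lambda> p : EQ (UU i) A B.
     CST CIndId \<cdot> UU i
       \<cdot> (\<^bold>\<lambda> A : UU i. \<^bold>\<lambda> B : UU i. \<^bold>\<lambda> p : EQ (UU i) A B. Equiv A B)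
       \<cdot> (\<^bold>\<lambda> A : UU i. id_equiv A) \<cdot> A \<cdot> B \<cdot> p)"

definition happly :: "ex \<Rightarrow> (ex \<Rightarrow> ex) \<Rightarrow> ex \<Rightarrow> ex \<Rightarrow> ex" where
  "happly A B f g = (\<^bold>\<lambda> p : EQ (PI A B) f g.
     CST CIndId \<cdot> PI A B
       \<cdot> (\<^bold>\<lambda> f : PI A B. \<^bold>\<lambda> g : PI A B. \<^bold>\<lambda> p : EQ (PI A B) f g.
            \<Pi> x : A. EQ (B x) (f \<cdot> x) (g \<cdot> x))
       \<cdot> (\<^bold>\<lambda> f : PI A B. \<^bold>\<lambda> x : A. rfl (B x) (f \<cdot> x)) \<cdot> f \<cdot> g \<cdot> p)"


subsection \<open>Types of the constants\<close>

text \<open>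
  Constants carry no universe levels. The levels \<open>i\<close> (of the types a constant is applied to)
  and \<open>j\<close> (of the motive of an eliminator) are parameters of the typing rule instead.
\<close>

primrec cnst_type :: "nat \<Rightarrow> nat \<Rightarrow> cnst \<Rightarrow> ex" where
  "cnst_type i j CSigma = (\<Pi> A : UU i. (A \<rightarrow> UU i) \<rightarrow> UU i)"
| "cnst_type i j CPair =
     (\<Pi> A : UU i. \<Pi> B : A \<rightarrow> UU i. \<Pi> a : A. B \<cdot> a \<rightarrow> CST CSigma \<cdot> A \<cdot> B)"
| "cnst_type i j CIndSigma =
     (\<Pi> A : UU i. \<Pi> B : A \<rightarrow> UU i. \<Pi> C : CST CSigma \<cdot> A \<cdot> B \<rightarrow> UU j.
       (\<Pi> a : A. \<Pi> b : B \<cdot> a. C \<cdot> (CST CPair \<cdot> A \<cdot> B \<cdot> a \<cdot> b)) \<rightarrow>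
       (\<Pi> p : CST CSigma \<cdot> A \<cdot> B. C \<cdot> p))"
| "cnst_type i j CSum = UU i \<rightarrow> UU i \<rightarrow> UU i"
| "cnst_type i j CInl = (\<Pi> A : UU i. \<Pi> B : UU i. A \<rightarrow> A \<oplus> B)"
| "cnst_type i j CInr = (\<Pi> A : UU i. \<Pi> B : UU i. B \<rightarrow> A \<oplus> B)"
| "cnst_type i j CIndSum =
     (\<Pi> A : UU i. \<Pi> B : UU i. \<Pi> C : A \<oplus> B \<rightarrow> UU j.
       (\<Pi> a : A. C \<cdot> (CST CInl \<cdot> A \<cdot> B \<cdot> a)) \<rightarrow> (\<Pi> b : B. C \<cdot> (CST CInr \<cdot> A \<cdot> B \<cdot> b)) \<rightarrow>
       (\<Pi> p : A \<oplus> B. C \<cdot> p))"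
| "cnst_type i j CEmpty = UU i"
| "cnst_type i j CIndEmpty = (\<Pi> C : CST CEmpty \<rightarrow> UU j. \<Pi> p : CST CEmpty. C \<cdot> p)"
| "cnst_type i j CUnit = UU i"
| "cnst_type i j CStar = CST CUnit"
| "cnst_type i j CIndUnit =
     (\<Pi> C : CST CUnit \<rightarrow> UU j. C \<cdot> CST CStar \<rightarrow> (\<Pi> p : CST CUnit. C \<cdot> p))"
| "cnst_type i j CNat = UU i"
| "cnst_type i j CZero = CST CNat"
| "cnst_type i j CSucc = CST CNat \<rightarrow> CST CNat"
| "cnst_type i j CIndNat =
     (\<Pi> C : CST CNat \<rightarrow> UU j. C \<cdot> CST CZero \<rightarrow>
       (\<Pi> n : CST CNat. C \<cdot> n \<rightarrow> C \<cdot> (CST CSucc \<cdot> n)) \<rightarrow> (\<Pi> n : CST CNat. C \<cdot> n))"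
| "cnst_type i j CId = (\<Pi> A : UU i. A \<rightarrow> A \<rightarrow> UU i)"
| "cnst_type i j CRefl = (\<Pi> A : UU i. \<Pi> a : A. EQ A a a)"
| "cnst_type i j CIndId =
     (\<Pi> A : UU i. \<Pi> C : (\<Pi> x : A. \<Pi> y : A. EQ A x y \<rightarrow> UU j).
       (\<Pi> x : A. C \<cdot> x \<cdot> x \<cdot> rfl A x) \<rightarrow>
       (\<Pi> x : A. \<Pi> y : A. \<Pi> p : EQ A x y. C \<cdot> x \<cdot> y \<cdot> p))"
| "cnst_type i j CTrunc = UU i \<rightarrow> UU i"
| "cnst_type i j CTr = (\<Pi> A : UU i. A \<rightarrow> Trunc A)"
| "cnst_type i j CSquash = (\<Pi> A : UU i. is_prop (Trunc A))"
| "cnst_type i j CRecTrunc =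
     (\<Pi> A : UU i. \<Pi> B : UU j. is_prop B \<rightarrow> (A \<rightarrow> B) \<rightarrow> Trunc A \<rightarrow> B)"
| "cnst_type i j CFunext =
     (\<Pi> A : UU i. \<Pi> B : A \<rightarrow> UU i. \<Pi> f : (\<Pi> x : A. B \<cdot> x). \<Pi> g : (\<Pi> x : A. B \<cdot> x).
       is_equiv (EQ (\<Pi> x : A. B \<cdot> x) f g) (\<Pi> x : A. EQ (B \<cdot> x) (f \<cdot> x) (g \<cdot> x))
         (happly A (\<lambda>x. B \<cdot> x) f g))"
| "cnst_type i j CUnivalence =
     (\<Pi> A : UU i. \<Pi> B : UU i. is_equiv (EQ (UU i) A B) (Equiv A B) (idtoeqv i A B))"


subsection \<open>Judgments\<close>

primrec apps :: "tm \<Rightarrow> tm list \<Rightarrow> tm" where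
  "apps f [] = f"
| "apps f (a # as) = apps (App f a) as"

inductive conv :: "tm \<Rightarrow> tm \<Rightarrow> bool"  (infix "\<down>" 50) where
  conv_refl: "t \<down> t"
| conv_sym: "s \<down> t \<Longrightarrow> t \<down> s"
| conv_trans: "s \<down> t \<Longrightarrow> t \<down> u \<Longrightarrow> s \<down> u"
| conv_Pi: "A \<down> A' \<Longrightarrow> B \<down> B' \<Longrightarrow> Pi A B \<down> Pi A' B'"
| conv_Lam: "A \<down> A' \<Longrightarrow> b \<down> b' \<Longrightarrow> Lam A b \<down> Lam A' b'"
| conv_App: "f \<down> f' \<Longrightarrow> a \<down> a' \<Longrightarrow> App f a \<down> App f' a'"
| conv_beta: "App (Lam A b) a \<down> subst 0 a b"
| conv_eta: "Lam A (App (shift 1 0 f) (Var 0)) \<down> f"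
| conv_Sigma:
    "apps (Cst CIndSigma) [A, B, C, g, apps (Cst CPair) [A', B', a, b]] \<down> apps g [a, b]"
| conv_Inl: "apps (Cst CIndSum) [A, B, C, f, g, apps (Cst CInl) [A', B', a]] \<down> App f a"
| conv_Inr: "apps (Cst CIndSum) [A, B, C, f, g, apps (Cst CInr) [A', B', b]] \<down> App g b"
| conv_Unit: "apps (Cst CIndUnit) [C, c, Cst CStar] \<down> c"
| conv_Zero: "apps (Cst CIndNat) [C, c, s, Cst CZero] \<down> c"
| conv_Succ:
    "apps (Cst CIndNat) [C, c, s, App (Cst CSucc) n] \<down> apps s [n, apps (Cst CIndNat) [C, c, s, n]]"
| conv_Id: "apps (Cst CIndId) [A, C, c, x, y, apps (Cst CRefl) [A', a]] \<down> App c a"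
| conv_Trunc: "apps (Cst CRecTrunc) [A, B, p, f, apps (Cst CTr) [A', a]] \<down> App f a"

text \<open>The head of a context is its innermost variable.\<close>

inductive ctxt :: "tm list \<Rightarrow> bool"
  and typing :: "tm list \<Rightarrow> tm \<Rightarrow> tm \<Rightarrow> bool"  ("_ \<turnstile> _ : _" [50, 50, 50] 50) where
  ctxt_Nil: "ctxt []"
| ctxt_Cons: "ctxt \<Gamma> \<Longrightarrow> \<Gamma> \<turnstile> A : U i \<Longrightarrow> ctxt (A # \<Gamma>)"
| ty_Var: "ctxt \<Gamma> \<Longrightarrow> k < length \<Gamma> \<Longrightarrow> \<Gamma> \<turnstile> Var k : shift (Suc k) 0 (\<Gamma> ! k)"
| ty_U: "ctxt \<Gamma> \<Longrightarrow> \<Gamma> \<turnstile> U i : U (Suc i)"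
| ty_cumulative: "\<Gamma> \<turnstile> A : U i \<Longrightarrow> \<Gamma> \<turnstile> A : U (Suc i)"
| ty_Pi: "\<Gamma> \<turnstile> A : U i \<Longrightarrow> A # \<Gamma> \<turnstile> B : U i \<Longrightarrow> \<Gamma> \<turnstile> Pi A B : U i"
| ty_Lam: "A # \<Gamma> \<turnstile> b : B \<Longrightarrow> \<Gamma> \<turnstile> Lam A b : Pi A B"
| ty_App: "\<Gamma> \<turnstile> f : Pi A B \<Longrightarrow> \<Gamma> \<turnstile> a : A \<Longrightarrow> \<Gamma> \<turnstile> App f a : subst 0 a B"
| ty_Cst: "ctxt \<Gamma> \<Longrightarrow> \<Gamma> \<turnstile> Cst c : closed_tm (cnst_type i j c)"
| ty_conv: "\<Gamma> \<turnstile> t : A \<Longrightarrow> \<Gamma> \<turnstile> B : U i \<Longrightarrow> A \<down> B \<Longrightarrow> \<Gamma> \<turnstile> t : B"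

text \<open>An assertion of type theory holds if its type is inhabited. Since expressions are not typed in
  the metalanguage, it is also required that the expression is a type.\<close>

definition inhabited :: "ex \<Rightarrow> bool" where
  "inhabited A \<longleftrightarrow> (\<exists>i. [] \<turnstile> closed_tm A : U i) \<and> (\<exists>t. [] \<turnstile> t : closed_tm A)"


section \<open>Precategories\<close>

text \<open>
  The data of a precategory whose type of objects and whose types of morphisms lie in \<open>U i\<close> are
  terms of the types \<open>Ob : U i\<close>, \<open>Hom : Ob \<rightarrow> Ob \<rightarrow> U i\<close>, \<open>Idm : \<Pi> a. Hom a a\<close> and
  \<open>Comp : \<Pi> a b c. Hom b c \<rightarrow> Hom a b \<rightarrow> Hom a c\<close>, where \<open>Comp a b c g f\<close> is the composite
  \<open>g \<circ> f\<close>. The remaining requirements on a precategory form the type \<open>is_precategory\<close>.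
\<close>

record precat =
  Ob :: ex
  Hom :: ex
  Idm :: ex
  Comp :: ex

abbreviation hom :: "precat \<Rightarrow> ex \<Rightarrow> ex \<Rightarrow> ex" where
  "hom C a b \<equiv> Hom C \<cdot> a \<cdot> b"

abbreviation comp :: "precat \<Rightarrow> ex \<Rightarrow> ex \<Rightarrow> ex \<Rightarrow> ex \<Rightarrow> ex \<Rightarrow> ex" where
  "comp C a b c g f \<equiv> Comp C \<cdot> a \<cdot> b \<cdot> c \<cdot> g \<cdot> f"

text \<open>\<open>with_precat i P C\<close> is convertible to \<open>P C\<close>, but contains \<open>C\<close> only once: it is a function of
  the data of a precategory applied to the data of \<open>C\<close>.\<close>

definition with_precat :: "nat \<Rightarrow> (precat \<Rightarrow> ex) \<Rightarrow> precat \<Rightarrow> ex" where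
  "with_precat i P C =
     (\<^bold>\<lambda> Q : UU i. \<^bold>\<lambda> H : Q \<rightarrow> Q \<rightarrow> UU i. \<^bold>\<lambda> I : (\<Pi> a : Q. H \<cdot> a \<cdot> a).
      \<^bold>\<lambda> M : (\<Pi> a : Q. \<Pi> b : Q. \<Pi> c : Q. H \<cdot> b \<cdot> c \<rightarrow> H \<cdot> a \<cdot> b \<rightarrow> H \<cdot> a \<cdot> c).
        P \<lparr> Ob = Q, Hom = H, Idm = I, Comp = M \<rparr>) \<cdot> Ob C \<cdot> Hom C \<cdot> Idm C \<cdot> Comp C"

definition is_precategory :: "nat \<Rightarrow> precat \<Rightarrow> ex" where
  "is_precategory i = with_precat i (\<lambda>C.
     (\<Pi> a : Ob C. \<Pi> b : Ob C. is_set (hom C a b))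
     \<otimes> (\<Pi> a : Ob C. \<Pi> b : Ob C. \<Pi> f : hom C a b. EQ (hom C a b) f (comp C a a b f (Idm C \<cdot> a)))
     \<otimes> (\<Pi> a : Ob C. \<Pi> b : Ob C. \<Pi> f : hom C a b. EQ (hom C a b) f (comp C a b b (Idm C \<cdot> b) f))
     \<otimes> (\<Pi> a : Ob C. \<Pi> b : Ob C. \<Pi> c : Ob C. \<Pi> d : Ob C.
          \<Pi> f : hom C a b. \<Pi> g : hom C b c. \<Pi> h : hom C c d.
            EQ (hom C a d) (comp C a c d h (comp C a b c g f)) (comp C a b d (comp C b c d h g) f)))"

definition has_initial :: "precat \<Rightarrow> ex" where
  "has_initial C = (\<Sigma> z : Ob C. \<Pi> a : Ob C. is_contr (hom C z a))"

definition has_binary_coproducts :: "precat \<Rightarrow> ex" where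
  "has_binary_coproducts C =
     (\<Pi> a : Ob C. \<Pi> b : Ob C. \<Sigma> s : Ob C. \<Sigma> k : hom C a s. \<Sigma> l : hom C b s.
       \<Pi> d : Ob C. \<Pi> f : hom C a d. \<Pi> g : hom C b d.
         is_contr (\<Sigma> h : hom C s d.
           EQ (hom C a d) (comp C a s d h k) f \<otimes> EQ (hom C b d) (comp C b s d h l) g))"

definition has_finite_coproducts :: "nat \<Rightarrow> precat \<Rightarrow> ex" where
  "has_finite_coproducts i = with_precat i (\<lambda>C. has_initial C \<otimes> has_binary_coproducts C)"

definition prod_precat :: "nat \<Rightarrow> precat \<Rightarrow> precat \<Rightarrow> precat" where
  "prod_precat i C D =
     (let Q = Ob C \<otimes> Ob D;
          p = pr1 i (Ob C) (\<lambda>_. Ob D); q = pr2 i (Ob C) (\<lambda>_. Ob D);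
          H = (\<lambda>x y. hom C (p x) (p y)); K = (\<lambda>x y. hom D (q x) (q y))
      in \<lparr> Ob = Q,
           Hom = (\<^bold>\<lambda> x : Q. \<^bold>\<lambda> y : Q. H x y \<otimes> K x y),
           Idm = (\<^bold>\<lambda> x : Q. PAIR (H x x) (\<lambda>_. K x x) (Idm C \<cdot> p x) (Idm D \<cdot> q x)),
           Comp = (\<^bold>\<lambda> x : Q. \<^bold>\<lambda> y : Q. \<^bold>\<lambda> z : Q. \<^bold>\<lambda> g : H y z \<otimes> K y z. \<^bold>\<lambda> f : H x y \<otimes> K x y.
             PAIR (H x z) (\<lambda>_. K x z)
               (comp C (p x) (p y) (p z)
                 (pr1 i (H y z) (\<lambda>_. K y z) g) (pr1 i (H x y) (\<lambda>_. K x y) f))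
               (comp D (q x) (q y) (q z)
                 (pr2 i (H y z) (\<lambda>_. K y z) g) (pr2 i (H x y) (\<lambda>_. K x y) f))) \<rparr>)"

text \<open>Finality of a functor depends only on its actions \<open>Fob a\<close> on objects and \<open>Fmor a b f\<close> on
  morphisms.\<close>

record functr =
  Fob :: ex
  Fmor :: ex

definition diagonal :: "precat \<Rightarrow> functr" where
  "diagonal C =
     \<lparr> Fob = (\<^bold>\<lambda> a : Ob C. PAIR (Ob C) (\<lambda>_. Ob C) a a),
       Fmor = (\<^bold>\<lambda> a : Ob C. \<^bold>\<lambda> b : Ob C. \<^bold>\<lambda> f : hom C a b. PAIR (hom C a b) (\<lambda>_. hom C a b) f f) \<rparr>"

text \<open>
  Zig-zags and connectedness involve only a type \<open>Q\<close> of objects and a family \<open>H\<close> of types of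
  morphisms. The type \<open>zigzag_pos i Q H n \<cdot> c \<cdot> c'\<close> consists of the zig-zags of length \<open>n + 1\<close>.
\<close>

definition zigzag_pos :: "nat \<Rightarrow> ex \<Rightarrow> ex \<Rightarrow> ex \<Rightarrow> ex" where
  "zigzag_pos i Q H n = CST CIndNat \<cdot> (\<^bold>\<lambda> n : CST CNat. Q \<rightarrow> Q \<rightarrow> UU i)
     \<cdot> (\<^bold>\<lambda> c : Q. \<^bold>\<lambda> c' : Q. \<Sigma> d : Q. H \<cdot> c \<cdot> d \<otimes> H \<cdot> c' \<cdot> d)
     \<cdot> (\<^bold>\<lambda> n : CST CNat. \<^bold>\<lambda> Z : Q \<rightarrow> Q \<rightarrow> UU i. \<^bold>\<lambda> c : Q. \<^bold>\<lambda> c' : Q.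
          \<Sigma> d : Q. \<Sigma> e : Q. H \<cdot> c \<cdot> d \<otimes> H \<cdot> e \<cdot> d \<otimes> Z \<cdot> e \<cdot> c')
     \<cdot> n"

definition zigzag :: "nat \<Rightarrow> ex \<Rightarrow> ex \<Rightarrow> ex \<Rightarrow> ex" where
  "zigzag i Q H n = CST CIndNat \<cdot> (\<^bold>\<lambda> n : CST CNat. Q \<rightarrow> Q \<rightarrow> UU i)
     \<cdot> (\<^bold>\<lambda> c : Q. \<^bold>\<lambda> c' : Q. EQ Q c c')
     \<cdot> (\<^bold>\<lambda> n : CST CNat. \<^bold>\<lambda> Z : Q \<rightarrow> Q \<rightarrow> UU i. zigzag_pos i Q H n)
     \<cdot> n"

definition is_connected :: "nat \<Rightarrow> ex \<Rightarrow> ex \<Rightarrow> ex" where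
  "is_connected i Q H = (\<^bold>\<lambda> Q : UU i. \<^bold>\<lambda> H : Q \<rightarrow> Q \<rightarrow> UU i.
     Trunc Q \<otimes> (\<Pi> c : Q. \<Pi> c' : Q. Trunc (\<Sigma> n : CST CNat. zigzag i Q H n \<cdot> c \<cdot> c'))) \<cdot> Q \<cdot> H"

text \<open>Objects and morphisms of the slice precategory of a functor \<open>F\<close> from \<open>C'\<close> to \<open>C\<close> under an
  object \<open>c\<close> of \<open>C\<close>.\<close>

definition slice_ob :: "precat \<Rightarrow> precat \<Rightarrow> functr \<Rightarrow> ex \<Rightarrow> ex" where
  "slice_ob C' C F c = (\<Sigma> a : Ob C'. hom C c (Fob F \<cdot> a))"

definition slice_hom :: "nat \<Rightarrow> precat \<Rightarrow> precat \<Rightarrow> functr \<Rightarrow> ex \<Rightarrow> ex" where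
  "slice_hom i C' C F c =
     (let p = pr1 i (Ob C') (\<lambda>a. hom C c (Fob F \<cdot> a)); q = pr2 i (Ob C') (\<lambda>a. hom C c (Fob F \<cdot> a))
      in \<^bold>\<lambda> x : slice_ob C' C F c. \<^bold>\<lambda> y : slice_ob C' C F c. \<Sigma> f : hom C' (p x) (p y).
           EQ (hom C c (Fob F \<cdot> p y))
             (comp C c (Fob F \<cdot> p x) (Fob F \<cdot> p y) (Fmor F \<cdot> p x \<cdot> p y \<cdot> f) (q x)) (q y))"

definition is_final :: "nat \<Rightarrow> precat \<Rightarrow> precat \<Rightarrow> functr \<Rightarrow> ex" where
  "is_final i C' C F =
     (\<Pi> c : Ob C. is_connected i (slice_ob C' C F c) (slice_hom i C' C F c))"

definition is_sifted :: "nat \<Rightarrow> precat \<Rightarrow> ex" where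
  "is_sifted i =
     with_precat i (\<lambda>C. Trunc (Ob C) \<otimes> is_final i C (prod_precat i C C) (diagonal C))"


section \<open>The precategory \<open>HX\<close>\<close>

definition Fin :: "nat \<Rightarrow> ex \<Rightarrow> ex" where
  "Fin i n = CST CIndNat \<cdot> (\<^bold>\<lambda> n : CST CNat. UU i) \<cdot> CST CEmpty
     \<cdot> (\<^bold>\<lambda> n : CST CNat. \<^bold>\<lambda> F : UU i. F \<oplus> CST CUnit) \<cdot> n"

definition concat_path :: "nat \<Rightarrow> ex" where
  "concat_path i = (\<^bold>\<lambda> A : UU i. \<^bold>\<lambda> x : A. \<^bold>\<lambda> y : A. \<^bold>\<lambda> z : A. \<^bold>\<lambda> p : EQ A x y. \<^bold>\<lambda> q : EQ A y z.
     CST CIndId \<cdot> A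
       \<cdot> (\<^bold>\<lambda> x : A. \<^bold>\<lambda> y : A. \<^bold>\<lambda> p : EQ A x y. \<Pi> z : A. EQ A y z \<rightarrow> EQ A x z)
       \<cdot> (\<^bold>\<lambda> x : A. \<^bold>\<lambda> z : A. \<^bold>\<lambda> q : EQ A x z. q) \<cdot> x \<cdot> y \<cdot> p \<cdot> z \<cdot> q)"

definition ap_path :: "nat \<Rightarrow> ex" where
  "ap_path i = (\<^bold>\<lambda> A : UU i. \<^bold>\<lambda> B : UU i. \<^bold>\<lambda> f : A \<rightarrow> B. \<^bold>\<lambda> x : A. \<^bold>\<lambda> y : A. \<^bold>\<lambda> p : EQ A x y.
     CST CIndId \<cdot> A
       \<cdot> (\<^bold>\<lambda> x : A. \<^bold>\<lambda> y : A. \<^bold>\<lambda> p : EQ A x y. EQ B (f \<cdot> x) (f \<cdot> y))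
       \<cdot> (\<^bold>\<lambda> x : A. rfl B (f \<cdot> x)) \<cdot> x \<cdot> y \<cdot> p)"

text \<open>
  An object is a pair \<open>(n, x)\<close> with \<open>x : Fin n \<rightarrow> X\<close>, and a morphism from \<open>(n, x)\<close> to \<open>(m, y)\<close> is a
  pair of a function \<open>f\<close> and a path from \<open>x\<close> to \<open>y \<circ> f\<close>. The composite of \<open>(f, p)\<close> and \<open>(g, q)\<close>
  carries the concatenation of \<open>p\<close> with the image of \<open>q\<close> under precomposition by \<open>f\<close>.
\<close>

definition HX :: "nat \<Rightarrow> ex \<Rightarrow> precat" where
  "HX i X =
     (let P = (\<lambda>n. Fin i n \<rightarrow> X);
          Q = SIG (CST CNat) P;
          num = pr1 i (CST CNat) P;
          fam = pr2 i (CST CNat) P;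
          fn = (\<lambda>a b. Fin i (num a) \<rightarrow> Fin i (num b));
          pull = (\<lambda>a b y f. \<^bold>\<lambda> k : Fin i (num a). y \<cdot> (f \<cdot> k));
          pth = (\<lambda>a b f. EQ (P (num a)) (fam a) (pull a b (fam b) f));
          H = (\<lambda>a b. SIG (fn a b) (pth a b))
      in \<lparr> Ob = Q,
           Hom = (\<^bold>\<lambda> a : Q. \<^bold>\<lambda> b : Q. H a b),
           Idm = (\<^bold>\<lambda> a : Q. PAIR (fn a a) (pth a a) (\<^bold>\<lambda> k : Fin i (num a). k)
             (rfl (P (num a)) (fam a))),
           Comp = (\<^bold>\<lambda> a : Q. \<^bold>\<lambda> b : Q. \<^bold>\<lambda> c : Q. \<^bold>\<lambda> g : H b c. \<^bold>\<lambda> f : H a b.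
             let f1 = pr1 i (fn a b) (pth a b) f; f2 = pr2 i (fn a b) (pth a b) f;
                 g1 = pr1 i (fn b c) (pth b c) g; g2 = pr2 i (fn b c) (pth b c) g
             in PAIR (fn a c) (pth a c) (\<^bold>\<lambda> k : Fin i (num a). g1 \<cdot> (f1 \<cdot> k))
                  (concat_path i \<cdot> P (num a)
                    \<cdot> fam a \<cdot> pull a b (fam b) f1 \<cdot> pull a b (pull b c (fam c) g1) f1
                    \<cdot> f2
                    \<cdot> (ap_path i \<cdot> P (num b) \<cdot> P (num a) \<cdot> (\<^bold>\<lambda> y : P (num b). pull a b y f1)
                        \<cdot> fam b \<cdot> pull b c (fam c) g1 \<cdot> g2))) \<rparr>)"

end

theory Submission
  imports Defs
begin

text \<open>
  By function extensionality a morphism \<open>(n, x) \<rightarrow> (m, y)\<close> of \<open>HX\<close> is the same as a family of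
  elements of \<open>\<Sigma> j. x u = y j\<close>, one for each \<open>u : Fin n\<close>; these types are sets because \<open>X\<close> is a
  \<open>1\<close>-type. Induction on \<open>m\<close> yields a finite type \<open>Fin N\<close> with maps from \<open>Fin n\<close> and \<open>Fin m\<close> such
  that dependent functions on \<open>Fin N\<close> can be defined by their restrictions along the two maps.
  Applied to the constant family \<open>X\<close> this gives the object that underlies the coproduct; applied to
  the families above it gives the mediating morphisms, and applied to identity types the uniqueness
  of these. An object \<open>x\<close> of a slice under \<open>(a, b)\<close> receives a morphism from the cocone \<open>s\<close> of the
  coproduct, so \<open>x \<rightarrow> x \<leftarrow> s \<rightarrow> y \<leftarrow> y\<close> is a zig-zag between any two of its objects.

  The derivations in homotopy type theory are given by explicit terms. They are checked by a type
  checker for the formal system, which is proved sound and evaluated by the simplifier.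
\<close>

section \<open>Simultaneous substitution\<close>

text \<open>The statement asserts derivability, so a term has to be exhibited and its typing derived
  in the formal system. Levels in the checker are relative to a base, hence one evaluation covers
  every universe \<open>U i\<close>. Two features of the type theory shape the terms. The second
  component of a morphism is a path in a function type, and function extensionality does not
  compute; such a path is traded for a family of paths only up to the inverse laws of the axiom. And
  a function on \<open>Fin N\<close> defined by its restrictions to two parts is required to agree
  with the prescribed ones only up to paths. The inclusions into a coproduct therefore carry paths
  that need not be reflexivity; the universal property is first proved where they are reflexivity
  and then extended by path induction. The statement writes out all components of \<open>HX\<close>,
  whereas the proof refers to them by names; the two forms are compared component by component at
  the end.\<close>

definition upr :: "(nat \<Rightarrow> nat) \<Rightarrow> nat \<Rightarrow> nat" where
  "upr r = case_nat 0 (\<lambda>n. Suc (r n))"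

primrec ren :: "(nat \<Rightarrow> nat) \<Rightarrow> tm \<Rightarrow> tm" where
  "ren r (Var n) = Var (r n)"
| "ren r (U i) = U i"
| "ren r (Pi A B) = Pi (ren r A) (ren (upr r) B)"
| "ren r (Lam A b) = Lam (ren r A) (ren (upr r) b)"
| "ren r (App f a) = App (ren r f) (ren r a)"
| "ren r (Cst c) = Cst c"

definition up :: "(nat \<Rightarrow> tm) \<Rightarrow> nat \<Rightarrow> tm" where
  "up s = case_nat (Var 0) (\<lambda>n. ren Suc (s n))"

primrec sub :: "(nat \<Rightarrow> tm) \<Rightarrow> tm \<Rightarrow> tm" where
  "sub s (Var n) = s n"
| "sub s (U i) = U i"
| "sub s (Pi A B) = Pi (sub s A) (sub (up s) B)"
| "sub s (Lam A b) = Lam (sub s A) (sub (up s) b)"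
| "sub s (App f a) = App (sub s f) (sub s a)"
| "sub s (Cst c) = Cst c"

lemma upr_simps [simp]: "upr r 0 = 0" "upr r (Suc n) = Suc (r n)"
  by (simp_all add: upr_def)

lemma up_simps [simp]: "up s 0 = Var 0" "up s (Suc n) = ren Suc (s n)"
  by (simp_all add: up_def)

lemma upr_comp: "upr r \<circ> upr r' = upr (r \<circ> r')"
  by (rule ext, rename_tac n, case_tac n) auto

lemma up_comp_upr: "up s \<circ> upr r = up (s \<circ> r)"
  by (rule ext, rename_tac n, case_tac n) auto

lemma ren_ren: "ren r (ren r' t) = ren (r \<circ> r') t"
  by (induction t arbitrary: r r') (auto simp: upr_comp)

lemma sub_ren: "sub s (ren r t) = sub (s \<circ> r) t"
  by (induction t arbitrary: r s) (auto simp: up_comp_upr)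

lemma ren_comp_up: "ren (upr r) \<circ> up s = up (ren r \<circ> s)"
proof
  show "(ren (upr r) \<circ> up s) n = up (ren r \<circ> s) n" for n
    by (cases n) (auto simp: ren_ren intro!: arg_cong2[where f = ren])
qed

lemma ren_sub: "ren r (sub s t) = sub (ren r \<circ> s) t"
  by (induction t arbitrary: r s) (auto simp: ren_comp_up)

lemma sub_comp_up: "sub (up s) \<circ> up s' = up (sub s \<circ> s')"
proof
  show "(sub (up s) \<circ> up s') n = up (sub s \<circ> s') n" for n
    by (cases n) (auto simp: ren_sub sub_ren intro!: arg_cong2[where f = sub])
qed

lemma sub_sub: "sub s (sub s' t) = sub (sub s \<circ> s') t"
  by (induction t arbitrary: s s') (auto simp: sub_comp_up)

lemma up_Var: "up Var = Var"
proof
  show "up Var n = Var n" for n by (cases n) auto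
qed

lemma sub_Var [simp]: "sub Var t = t"
  by (induction t) (auto simp: up_Var)

lemma up_Var_comp: "up (Var \<circ> r) = Var \<circ> upr r"
proof
  show "up (Var \<circ> r) n = (Var \<circ> upr r) n" for n by (cases n) auto
qed

lemma ren_eq_sub: "ren r t = sub (Var \<circ> r) t"
  by (induction t arbitrary: r) (auto simp: up_Var_comp[unfolded comp_def] comp_def)

text \<open>Renaming and parallel substitution compose without side conditions on cut-offs, unlike
  \<open>shift\<close> and \<open>subst\<close>. This lemma and \<open>subst_eq_sub\<close> move the
  laws about the latter there.\<close>

lemma shift_eq_ren: "shift d k t = ren (\<lambda>n. if n < k then n else n + d) t"
proof (induction t arbitrary: k)
  have "upr (\<lambda>n. if n < k then n else n + d) = (\<lambda>n. if n < Suc k then n else n + d)" for k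
  proof
    show "upr (\<lambda>n. if n < k then n else n + d) n = (if n < Suc k then n else n + d)" for n
      by (cases n) auto
  qed
  note up = this
  { case Pi then show ?case by (simp add: up) }
  { case Lam then show ?case by (simp add: up) }
qed auto

lemma shift_0_eq_ren: "shift d 0 t = ren (\<lambda>n. n + d) t"
  by (simp add: shift_eq_ren)

lemma shift_1_eq_ren: "shift (Suc 0) 0 t = ren Suc t"
  by (simp add: shift_eq_ren)

definition single :: "tm \<Rightarrow> nat \<Rightarrow> tm" where
  "single a = case_nat a Var"

lemma single_simps [simp]: "single a 0 = a" "single a (Suc n) = Var n"
  by (simp_all add: single_def)

lemma subst_eq_sub:
  "subst k a t = sub (\<lambda>n. if n < k then Var n else if n = k then shift k 0 a else Var (n - 1)) t"
proof (induction t arbitrary: k)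
  have "up (\<lambda>n. if n < k then Var n else if n = k then shift k 0 a else Var (n - 1)) =
        (\<lambda>n. if n < Suc k then Var n else if n = Suc k then shift (Suc k) 0 a else Var (n - 1))" for k
  proof
    show "up (\<lambda>n. if n < k then Var n else if n = k then shift k 0 a else Var (n - 1)) n =
        (if n < Suc k then Var n else if n = Suc k then shift (Suc k) 0 a else Var (n - 1))" for n
      by (cases n) (auto simp: shift_0_eq_ren ren_ren comp_def)
  qed
  note up = this
  { case Pi then show ?case by (simp add: up) }
  { case Lam then show ?case by (simp add: up) }
qed auto

lemma subst_0_eq_sub: "subst 0 a t = sub (single a) t"
proof -
  have "(\<lambda>n. if n < 0 then Var n else if n = 0 then shift 0 0 a else Var (n - 1)) = single a"
  proof
    show "(if n < 0 then Var n else if n = 0 then shift 0 0 a else Var (n - 1)) = single a n" for n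
      by (cases n) (auto simp: shift_0_eq_ren ren_eq_sub comp_def)
  qed
  then show ?thesis by (simp only: subst_eq_sub)
qed

lemma sub_single_comp: "sub (single a) \<circ> up s = (\<lambda>n. case n of 0 \<Rightarrow> a | Suc m \<Rightarrow> s m)"
proof
  show "(sub (single a) \<circ> up s) n = (case n of 0 \<Rightarrow> a | Suc m \<Rightarrow> s m)" for n
    by (cases n) (auto simp: sub_ren comp_def)
qed

lemma sub_comp_single: "sub s \<circ> single a = (\<lambda>n. case n of 0 \<Rightarrow> sub s a | Suc m \<Rightarrow> s m)"
proof
  show "(sub s \<circ> single a) n = (case n of 0 \<Rightarrow> sub s a | Suc m \<Rightarrow> s m)" for n
    by (cases n) auto
qed

text \<open>The exchange law behind both \<open>conv_beta\<close> and the application rule: in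
  either order variable 0 becomes \<open>sub s a\<close> and variable \<open>Suc n\<close> becomes
  \<open>s n\<close>.\<close>

lemma sub_subst_0: "sub s (subst 0 a b) = subst 0 (sub s a) (sub (up s) b)"
  by (simp add: subst_0_eq_sub sub_sub sub_single_comp sub_comp_single)

lemma sub_up_shift: "sub (up s) (shift (Suc 0) 0 t) = shift (Suc 0) 0 (sub s t)"
  by (simp add: shift_1_eq_ren sub_ren ren_sub comp_def)

lemma sub_apps [simp]: "sub s (apps f as) = apps (sub s f) (map (sub s) as)"
  by (induction as arbitrary: f) auto

lemma conv_sub: "t \<down> u \<Longrightarrow> sub s t \<down> sub s u"
proof (induction arbitrary: s rule: conv.induct)
  case (conv_beta A b a)
  then show ?case using conv.conv_beta[of "sub s A" "sub (up s) b" "sub s a"]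
    by (simp add: sub_subst_0)
next
  case (conv_eta A f)
  then show ?case using conv.conv_eta[of "sub s A" "sub s f"]
    by (simp add: sub_up_shift)
qed (auto intro: conv.intros simp del: apps.simps simp: sub_apps conv_Sigma conv_Inl conv_Inr conv_Unit conv_Zero conv_Succ conv_Id conv_Trunc)

lemma conv_apps: "f \<down> f' \<Longrightarrow> list_all2 (\<down>) as as' \<Longrightarrow> apps f as \<down> apps f' as'"
proof (induction as arbitrary: f f' as')
  case (Cons a as)
  then obtain b bs where "as' = b # bs" "a \<down> b" "list_all2 (\<down>) as bs"
    by (auto simp: list_all2_Cons1)
  with Cons show ?case by (simp add: conv_App)
qed simp

lemma list_all2_conv_refl: "list_all2 (\<down>) as as"
  by (simp add: list_all2_refl conv_refl)

text \<open>Domains of abstractions are irrelevant for conversion, because of the \<open>\<eta>\<close>-rule.\<close>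

lemma conv_Lam_domain: "b \<down> b' \<Longrightarrow> Lam A b \<down> Lam A' b'"
proof -
  \<comment> \<open>Making room above the bound variable and then substituting the variable for
    itself cancel out.\<close>
  have "subst 0 (Var 0) (shift (Suc 0) (Suc 0) b') = b'"
  proof -
    have "single (Var 0) \<circ> (\<lambda>n. if n = 0 then n else n + Suc 0) = Var"
      by (rule ext, rename_tac n, case_tac n) auto
    then show ?thesis
      by (simp add: subst_0_eq_sub shift_eq_ren sub_ren del: One_nat_def cong: if_cong)
  qed
  then have "App (Lam (shift (Suc 0) 0 A') (shift (Suc 0) (Suc 0) b')) (Var 0) \<down> b'"
    by (metis conv_beta)
  \<comment> \<open>One eta-expansion with domain \<open>A\<close> is contracted in two ways: beta
    under the binder yields \<open>Lam A b'\<close>, eta yields \<open>Lam A' b'\<close>.\<close>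
  then have "Lam A (App (shift (Suc 0) 0 (Lam A' b')) (Var 0)) \<down> Lam A b'"
    by (simp add: conv_Lam conv_refl)
  moreover have "Lam A (App (shift (Suc 0) 0 (Lam A' b')) (Var 0)) \<down> Lam A' b'"
    using conv_eta[of A "Lam A' b'"] by (simp del: shift.simps)
  ultimately have "Lam A b' \<down> Lam A' b'"
    by (blast intro: conv_sym conv_trans)
  moreover assume "b \<down> b'"
  ultimately show ?thesis
    by (meson conv_Lam conv_refl conv_trans)
qed

lemma conv_eta': "b \<down> App (shift (Suc 0) 0 f) (Var 0) \<Longrightarrow> Lam A b \<down> f"
  by (metis One_nat_def conv_Lam conv_eta conv_refl conv_trans)

section \<open>Structural properties of typing\<close>

text \<open>Makes the rule \<open>ty_Cst\<close> stable under substitution. After unfolding, all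
  indices are concrete and lie below the binders around them.\<close>

lemma cnst_type_closed: "sub s (closed_tm (cnst_type i j c)) = closed_tm (cnst_type i j c)"
  by (cases c)
    (simp_all add: closed_tm_def PI_def LAM_def APP_def CST_def UU_def bvar_def Arrow_def SIG_def
      PAIR_def Prod_def Sum_def EQ_def rfl_def Trunc_def is_prop_def is_equiv_def happly_def
      idtoeqv_def Equiv_def id_equiv_def Let_def numeral_eq_Suc)

text \<open>The predicate \<open>P\<close> is stored with each entry over the tail on which the
  entry depends; this supplies the hypothesis for domains in \<open>typing_induct\<close>.\<close>

definition ctxt_entries :: "(tm list \<Rightarrow> tm \<Rightarrow> tm \<Rightarrow> bool) \<Rightarrow> tm list \<Rightarrow> bool" where
  "ctxt_entries P \<Gamma> \<longleftrightarrow> (\<forall>k < length \<Gamma>. \<exists>i. drop (Suc k) \<Gamma> \<turnstile> \<Gamma> ! k : U i \<and> P (drop (Suc k) \<Gamma>) (\<Gamma> ! k) (U i))"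

lemma ctxt_entries_Cons:
  "ctxt_entries P (A # \<Gamma>) \<longleftrightarrow> (\<exists>i. \<Gamma> \<turnstile> A : U i \<and> P \<Gamma> A (U i)) \<and> ctxt_entries P \<Gamma>"
  unfolding ctxt_entries_def by (simp add: All_less_Suc2)

lemma ctxt_typed: "ctxt \<Gamma> \<Longrightarrow> ctxt_entries (\<lambda>_ _ _. True) \<Gamma>"
proof (induction rule: ctxt_typing.inducts(1)[where ?P2.0 = "\<lambda>_ _ _. True"])
  case ctxt_Nil
  then show ?case by (simp add: ctxt_entries_def)
qed (auto simp: ctxt_entries_Cons)

lemma ctxt_tl: "ctxt \<Gamma> \<Longrightarrow> ctxt (tl \<Gamma>)"
  by (erule ctxt.cases) (auto intro: ctxt_Nil)

lemma typing_ctxt: "\<Gamma> \<turnstile> t : A \<Longrightarrow> ctxt \<Gamma>"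
  by (induction rule: ctxt_typing.inducts(2)[where ?P1.0 = "\<lambda>_. True"]) (auto dest: ctxt_tl)

text \<open>In the case of an abstraction the induction hypothesis is needed for the domain as well,
  which is part of the context of the premise only.\<close>

lemma typing_induct [consumes 1, case_names Var U cumulative Pi Lam App Cst conv]:
  assumes "\<Gamma> \<turnstile> t : A"
    and "\<And>\<Gamma> k. ctxt \<Gamma> \<Longrightarrow> k < length \<Gamma> \<Longrightarrow> P \<Gamma> (Var k) (shift (Suc k) 0 (\<Gamma> ! k))"
    and "\<And>\<Gamma> i. ctxt \<Gamma> \<Longrightarrow> P \<Gamma> (U i) (U (Suc i))"
    and "\<And>\<Gamma> A i. \<Gamma> \<turnstile> A : U i \<Longrightarrow> P \<Gamma> A (U i) \<Longrightarrow> P \<Gamma> A (U (Suc i))"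
    and "\<And>\<Gamma> A B i. \<Gamma> \<turnstile> A : U i \<Longrightarrow> P \<Gamma> A (U i) \<Longrightarrow> A # \<Gamma> \<turnstile> B : U i \<Longrightarrow> P (A # \<Gamma>) B (U i) \<Longrightarrow>
      P \<Gamma> (Pi A B) (U i)"
    and "\<And>\<Gamma> A B b i. \<Gamma> \<turnstile> A : U i \<Longrightarrow> P \<Gamma> A (U i) \<Longrightarrow> A # \<Gamma> \<turnstile> b : B \<Longrightarrow> P (A # \<Gamma>) b B \<Longrightarrow>
      P \<Gamma> (Lam A b) (Pi A B)"
    and "\<And>\<Gamma> f a A B. \<Gamma> \<turnstile> f : Pi A B \<Longrightarrow> P \<Gamma> f (Pi A B) \<Longrightarrow> \<Gamma> \<turnstile> a : A \<Longrightarrow> P \<Gamma> a A \<Longrightarrow>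
      P \<Gamma> (App f a) (subst 0 a B)"
    and "\<And>\<Gamma> c i j. ctxt \<Gamma> \<Longrightarrow> P \<Gamma> (Cst c) (closed_tm (cnst_type i j c))"
    and "\<And>\<Gamma> t A B i. \<Gamma> \<turnstile> t : A \<Longrightarrow> P \<Gamma> t A \<Longrightarrow> \<Gamma> \<turnstile> B : U i \<Longrightarrow> P \<Gamma> B (U i) \<Longrightarrow> A \<down> B \<Longrightarrow> P \<Gamma> t B"
  shows "P \<Gamma> t A"
proof -
  from assms(1) have "P \<Gamma> t A \<and> ctxt_entries P \<Gamma>"
  proof (induction rule: ctxt_typing.inducts(2)[where ?P1.0 = "ctxt_entries P"])
    case ctxt_Nil
    then show ?case by (simp add: ctxt_entries_def)
  next
    case ctxt_Cons
    then show ?case by (auto simp: ctxt_entries_Cons)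
  next
    case (ty_Lam A \<Gamma> b B)
    then show ?case using assms(6) by (auto simp: ctxt_entries_Cons)
  qed (auto intro: assms(2-5,7-9))
  then show ?thesis ..
qed

text \<open>Typing bounds the free variables of a term by the length of the context. For the empty
  context this makes substitution the identity, which later justifies not traversing named
  terms.\<close>

lemma sub_cong:
  "\<Gamma> \<turnstile> t : A \<Longrightarrow> (\<And>n. n < length \<Gamma> \<Longrightarrow> s n = s' n) \<Longrightarrow> sub s t = sub s' t"
proof (induction arbitrary: s s' rule: typing_induct)
  case (Pi \<Gamma> A B i)
  have "sub (up s) B = sub (up s') B"
    by (rule Pi.IH(2), rename_tac n, case_tac n) (auto simp: Pi.prems)
  moreover have "sub s A = sub s' A"
    using Pi by blast
  ultimately show ?case by simp
next
  case (Lam \<Gamma> A B b i)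
  have "sub (up s) b = sub (up s') b"
    by (rule Lam.IH(2), rename_tac n, case_tac n) (auto simp: Lam.prems)
  moreover have "sub s A = sub s' A"
    using Lam by blast
  ultimately show ?case by simp
next
  case (App \<Gamma> f a A B)
  have "sub s f = sub s' f" "sub s a = sub s' a"
    using App by blast+
  then show ?case by simp
next
  case (cumulative \<Gamma> A i)
  show ?case by (rule cumulative.IH) (rule cumulative.prems)
next
  case (conv \<Gamma> t A B i)
  show ?case by (rule conv.IH(1)) (rule conv.prems)
qed simp_all

lemma closed_sub: "[] \<turnstile> t : A \<Longrightarrow> sub s t = t"
  using sub_cong[of "[]" t A s Var] by simp

text \<open>\<open>W s \<Gamma> \<Delta>\<close> means that \<open>s\<close> is a substitution for \<open>\<Gamma>\<close> by terms over \<open>\<Delta>\<close>. The lemma is applied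
  to renamings first, because they are needed to extend arbitrary substitutions under binders.\<close>

lemma typing_sub_aux:
  assumes W_ctxt: "\<And>s \<Gamma> \<Delta>. W s \<Gamma> \<Delta> \<Longrightarrow> ctxt \<Delta>"
    and W_Var: "\<And>s \<Gamma> \<Delta> k. W s \<Gamma> \<Delta> \<Longrightarrow> k < length \<Gamma> \<Longrightarrow> \<Delta> \<turnstile> s k : sub s (shift (Suc k) 0 (\<Gamma> ! k))"
    and W_up: "\<And>s \<Gamma> \<Delta> A i. W s \<Gamma> \<Delta> \<Longrightarrow> \<Delta> \<turnstile> sub s A : U i \<Longrightarrow> W (up s) (A # \<Gamma>) (sub s A # \<Delta>)"
  shows "\<Gamma> \<turnstile> t : A \<Longrightarrow> W s \<Gamma> \<Delta> \<Longrightarrow> \<Delta> \<turnstile> sub s t : sub s A"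
proof (induction arbitrary: s \<Delta> rule: typing_induct)
  case (Var \<Gamma> k)
  then show ?case by (simp add: W_Var)
next
  case (U \<Gamma> i)
  then show ?case by (auto intro: ty_U W_ctxt)
next
  case (cumulative \<Gamma> A i)
  then show ?case by (auto intro: ty_cumulative)
next
  case (Pi \<Gamma> A B i)
  then have A: "\<Delta> \<turnstile> sub s A : U i" by (metis sub.simps(2))
  then have "sub s A # \<Delta> \<turnstile> sub (up s) B : U i"
    using Pi W_up by (metis sub.simps(2))
  with A show ?case by (auto intro: ty_Pi)
next
  case (Lam \<Gamma> A B b i)
  then have A: "\<Delta> \<turnstile> sub s A : U i" by (metis sub.simps(2))
  then have "sub s A # \<Delta> \<turnstile> sub (up s) b : sub (up s) B"
    using Lam W_up by metis
  then show ?case by (auto intro: ty_Lam)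
next
  case (App \<Gamma> f a A B)
  then have "\<Delta> \<turnstile> sub s f : Pi (sub s A) (sub (up s) B)" "\<Delta> \<turnstile> sub s a : sub s A" by auto
  then show ?case by (auto simp: sub_subst_0 intro: ty_App)
next
  case (Cst \<Gamma> c i j)
  then show ?case by (auto simp: cnst_type_closed intro: ty_Cst W_ctxt)
next
  case (conv \<Gamma> t A B i)
  then show ?case by (metis conv_sub sub.simps(2) ty_conv)
qed

text \<open>Entry \<open>k\<close> lives over the tail behind it, so entries are compared after both
  have been weakened to their full contexts.\<close>

definition renaming :: "(nat \<Rightarrow> tm) \<Rightarrow> tm list \<Rightarrow> tm list \<Rightarrow> bool" where
  "renaming s \<Gamma> \<Delta> \<longleftrightarrow> ctxt \<Delta> \<and> (\<exists>r. s = Var \<circ> r \<and> (\<forall>k < length \<Gamma>. r k < length \<Delta> \<and>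
     shift (Suc (r k)) 0 (\<Delta> ! r k) = ren r (shift (Suc k) 0 (\<Gamma> ! k))))"

lemma typing_renaming: "\<Gamma> \<turnstile> t : A \<Longrightarrow> renaming s \<Gamma> \<Delta> \<Longrightarrow> \<Delta> \<turnstile> sub s t : sub s A"
proof (rule typing_sub_aux[where W = renaming])
  fix s \<Gamma> \<Delta> k assume "renaming s \<Gamma> \<Delta>" "k < length \<Gamma>"
  then show "\<Delta> \<turnstile> s k : sub s (shift (Suc k) 0 (\<Gamma> ! k))"
    unfolding renaming_def by (metis comp_apply ren_eq_sub ty_Var)
next
  fix s \<Gamma> \<Delta> A i assume "renaming s \<Gamma> \<Delta>" and A: "\<Delta> \<turnstile> sub s A : U i"
  then obtain r where r: "ctxt \<Delta>" "s = Var \<circ> r" "\<And>k. k < length \<Gamma> \<Longrightarrow> r k < length \<Delta> \<and>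
     shift (Suc (r k)) 0 (\<Delta> ! r k) = ren r (shift (Suc k) 0 (\<Gamma> ! k))"
    unfolding renaming_def by auto
  have "upr r k < Suc (length \<Delta>) \<and> shift (Suc (upr r k)) 0 ((sub s A # \<Delta>) ! upr r k) =
    ren (upr r) (shift (Suc k) 0 ((A # \<Gamma>) ! k))" if "k < Suc (length \<Gamma>)" for k
  proof (cases k)
    case 0
    then show ?thesis
      using ren_eq_sub[of r A] by (simp add: r(2) shift_0_eq_ren ren_ren comp_def ren_sub ren_eq_sub sub_sub)
  next
    case (Suc m)
    then have "ren Suc (shift (Suc (r m)) 0 (\<Delta> ! r m)) = ren Suc (ren r (shift (Suc m) 0 (\<Gamma> ! m)))"
      using r(3)[of m] that by simp
    then show ?thesis
      using r(3)[of m] that Suc by (simp add: shift_0_eq_ren ren_ren comp_def)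
  qed
  then show "renaming (up s) (A # \<Gamma>) (sub s A # \<Delta>)"
    unfolding renaming_def using A r(1,2)
    by (auto intro!: ctxt_Cons exI[of _ "upr r"] simp: up_Var_comp)
qed (auto simp: renaming_def)

lemma typing_weaken:
  assumes "\<Gamma> \<turnstile> t : A" "\<Gamma> \<turnstile> B : U i"
  shows "B # \<Gamma> \<turnstile> ren Suc t : ren Suc A"
proof -
  have "renaming (Var \<circ> Suc) \<Gamma> (B # \<Gamma>)"
    unfolding renaming_def using assms
    by (auto intro!: ctxt_Cons exI[of _ Suc] intro: typing_ctxt simp: shift_0_eq_ren ren_ren comp_def)
  from typing_renaming[OF assms(1) this] show ?thesis by (simp add: ren_eq_sub)
qed

definition substitution :: "(nat \<Rightarrow> tm) \<Rightarrow> tm list \<Rightarrow> tm list \<Rightarrow> bool" where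
  "substitution s \<Gamma> \<Delta> \<longleftrightarrow> ctxt \<Delta> \<and> (\<forall>k < length \<Gamma>. \<Delta> \<turnstile> s k : sub s (shift (Suc k) 0 (\<Gamma> ! k)))"

lemma typing_sub: "\<Gamma> \<turnstile> t : A \<Longrightarrow> substitution s \<Gamma> \<Delta> \<Longrightarrow> \<Delta> \<turnstile> sub s t : sub s A"
proof (rule typing_sub_aux[where W = substitution])
  fix s \<Gamma> \<Delta> A i assume s: "substitution s \<Gamma> \<Delta>" and A: "\<Delta> \<turnstile> sub s A : U i"
  have ctxt: "ctxt (sub s A # \<Delta>)"
    using s A by (auto intro: ctxt_Cons simp: substitution_def)
  have "sub s A # \<Delta> \<turnstile> up s k : sub (up s) (shift (Suc k) 0 ((A # \<Gamma>) ! k))" if "k < Suc (length \<Gamma>)" for k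
  proof (cases k)
    case 0
    then show ?thesis
      using ty_Var[OF ctxt, of 0] by (simp add: sub_ren ren_sub shift_1_eq_ren comp_def)
  next
    case (Suc m)
    then have "\<Delta> \<turnstile> s m : sub s (shift (Suc m) 0 (\<Gamma> ! m))"
      using s that by (auto simp: substitution_def)
    from typing_weaken[OF this A] show ?thesis
      using Suc by (simp add: shift_0_eq_ren sub_ren ren_sub comp_def)
  qed
  with ctxt show "substitution (up s) (A # \<Gamma>) (sub s A # \<Delta>)"
    by (auto simp: substitution_def)
qed (auto simp: substitution_def)

lemma typing_subst:
  assumes "A # \<Gamma> \<turnstile> b : B" "\<Gamma> \<turnstile> a : A"
  shows "\<Gamma> \<turnstile> subst 0 a b : subst 0 a B"
proof -
  have "substitution (single a) (A # \<Gamma>) \<Gamma>"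
    unfolding substitution_def
  proof (intro conjI allI impI)
    show ctxt: "ctxt \<Gamma>" using assms(2) by (rule typing_ctxt)
    fix k assume "k < length (A # \<Gamma>)"
    then show "\<Gamma> \<turnstile> single a k : sub (single a) (shift (Suc k) 0 ((A # \<Gamma>) ! k))"
      using assms(2) ty_Var[OF ctxt]
      by (cases k) (auto simp: shift_0_eq_ren sub_ren comp_def, auto simp: ren_eq_sub comp_def)
  qed
  from typing_sub[OF assms(1) this] show ?thesis by (simp add: subst_0_eq_sub)
qed

lemma typing_closed:
  assumes "[] \<turnstile> t : A" "ctxt \<Gamma>"
  shows "\<Gamma> \<turnstile> t : sub Var A"
  using typing_sub[OF assms(1), of Var \<Gamma>] assms(2) by (simp add: substitution_def)

text \<open>Cumulativity and conversion change only the type of a term, so the premises for the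
  subject \<open>Pi A B\<close> survive along the derivation.\<close>

lemma typing_Pi_inv: "\<Gamma> \<turnstile> Pi A B : T \<Longrightarrow> \<exists>i. \<Gamma> \<turnstile> A : U i \<and> A # \<Gamma> \<turnstile> B : U i"
  by (induction \<Gamma> "Pi A B" T rule: typing_induct) auto

definition is_type :: "tm list \<Rightarrow> tm \<Rightarrow> bool" where
  "is_type \<Gamma> A \<longleftrightarrow> (\<exists>i. \<Gamma> \<turnstile> A : U i)"

lemma ctxt_nth:
  assumes "ctxt \<Gamma>" "k < length \<Gamma>"
  shows "is_type \<Gamma> (shift (Suc k) 0 (\<Gamma> ! k))"
proof -
  from assms have "ctxt_entries (\<lambda>_ _ _. True) \<Gamma>" by (simp add: ctxt_typed)
  with assms show ?thesis
  proof (induction \<Gamma> arbitrary: k rule: list.induct)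
    case (Cons A \<Gamma>)
    then obtain i where A: "\<Gamma> \<turnstile> A : U i" "ctxt \<Gamma>"
      by (auto simp: ctxt_entries_Cons intro: typing_ctxt)
    have "\<exists>B j. \<Gamma> \<turnstile> B : U j \<and> shift (Suc k) 0 ((A # \<Gamma>) ! k) = ren Suc B"
    proof (cases k)
      case 0
      then show ?thesis using A by (auto simp: shift_1_eq_ren)
    next
      case (Suc m)
      then show ?thesis
        using Cons A by (auto simp: is_type_def ctxt_entries_Cons shift_0_eq_ren ren_ren comp_def
            intro!: exI[of _ "shift (Suc m) 0 (\<Gamma> ! m)"])
    qed
    then show ?case
      using typing_weaken[OF _ A(1)] by (fastforce simp: is_type_def)
  qed simp
qed

section \<open>A type checker\<close>

text \<open>
  The checker works on terms in which every constant carries the levels \<open>i\<close> and \<open>j\<close> of its typing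
  rule and in which closed terms can be named: \<open>Gl r b A\<close> stands for the closed term \<open>b\<close> of type
  \<open>A\<close>, which is unfolded only if conversion requires it. The rank \<open>r\<close> decides which one of two
  names is unfolded first. All levels are relative to the base level \<open>i\<close> of the erasure \<open>er i\<close>.
\<close>

datatype raw = Va nat | Ty nat | Pr raw raw | La raw raw | Ap raw raw | Co cnst nat nat | Gl nat raw raw

primrec er :: "nat \<Rightarrow> raw \<Rightarrow> tm" where
  "er i (Va n) = Var n"
| "er i (Ty k) = U (i + k)"
| "er i (Pr A B) = Pi (er i A) (er i B)"
| "er i (La A b) = Lam (er i A) (er i b)"
| "er i (Ap f a) = App (er i f) (er i a)"
| "er i (Co c k l) = Cst c"
| "er i (Gl r b A) = er i b"

text \<open>The part of the index beyond the list is returned because \<open>inst\<close> lowers the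
  variables that it does not replace by the length of the list.\<close>

primrec lookup :: "'a list \<Rightarrow> nat \<Rightarrow> 'a + nat" where
  "lookup [] n = Inr n"
| "lookup (a # s) n = (case n of 0 \<Rightarrow> Inl a | Suc m \<Rightarrow> lookup s m)"

text \<open>Comparison and truncated difference in a single recursion on unary numerals, suited to
  evaluation by rewriting.\<close>

primrec minus_opt :: "nat \<Rightarrow> nat \<Rightarrow> nat option" where
  "minus_opt n 0 = Some n"
| "minus_opt n (Suc k) = (case n of 0 \<Rightarrow> None | Suc m \<Rightarrow> minus_opt m k)"

primrec rshift :: "nat \<Rightarrow> nat \<Rightarrow> raw \<Rightarrow> raw" where
  "rshift d k (Va n) = (case minus_opt n k of None \<Rightarrow> Va n | Some m \<Rightarrow> Va (n + d))"
| "rshift d k (Ty i) = Ty i"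
| "rshift d k (Pr A B) = Pr (rshift d k A) (rshift d (Suc k) B)"
| "rshift d k (La A b) = La (rshift d k A) (rshift d (Suc k) b)"
| "rshift d k (Ap f a) = Ap (rshift d k f) (rshift d k a)"
| "rshift d k (Co c i j) = Co c i j"
| "rshift d k (Gl r b A) = Gl r b A"

definition rshift_0 :: "nat \<Rightarrow> raw \<Rightarrow> raw" where
  "rshift_0 d t = (case d of 0 \<Rightarrow> t | Suc _ \<Rightarrow> rshift d 0 t)"

primrec inst :: "raw list \<Rightarrow> nat \<Rightarrow> raw \<Rightarrow> raw" where
  "inst s k (Va n) = (case minus_opt n k of None \<Rightarrow> Va n | Some m \<Rightarrow>
     (case lookup s m of Inl a \<Rightarrow> rshift_0 k a | Inr m \<Rightarrow> Va (m + k)))"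
| "inst s k (Ty i) = Ty i"
| "inst s k (Pr A B) = Pr (inst s k A) (inst s (Suc k) B)"
| "inst s k (La A b) = La (inst s k A) (inst s (Suc k) b)"
| "inst s k (Ap f a) = Ap (inst s k f) (inst s k a)"
| "inst s k (Co c i j) = Co c i j"
| "inst s k (Gl r b A) = Gl r b A"

definition inst_0 :: "raw list \<Rightarrow> raw \<Rightarrow> raw" where
  "inst_0 s t = (case s of [] \<Rightarrow> t | _ # _ \<Rightarrow> inst s 0 t)"

primrec aps :: "raw \<Rightarrow> raw list \<Rightarrow> raw" where
  "aps f [] = f"
| "aps f (a # s) = aps (Ap f a) s"

subsection \<open>Weak head normal forms\<close>

text \<open>The number of arguments of an eliminator before its scrutinee, and \<open>0\<close> for other constants.\<close>

fun elim_arity :: "cnst \<Rightarrow> nat" where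
  "elim_arity CIndSigma = Suc (Suc (Suc (Suc 0)))"
| "elim_arity CIndSum = Suc (Suc (Suc (Suc (Suc 0))))"
| "elim_arity CIndUnit = Suc (Suc 0)"
| "elim_arity CIndNat = Suc (Suc (Suc 0))"
| "elim_arity CIndId = Suc (Suc (Suc (Suc (Suc 0))))"
| "elim_arity CRecTrunc = Suc (Suc (Suc (Suc 0)))"
| "elim_arity _ = 0"

primrec split_at :: "nat \<Rightarrow> raw list \<Rightarrow> (raw list \<times> raw \<times> raw list) option" where
  "split_at 0 s = (case s of [] \<Rightarrow> None | p # s' \<Rightarrow> Some ([], p, s'))"
| "split_at (Suc n) s = (case s of [] \<Rightarrow> None | a # s' \<Rightarrow>
     (case split_at n s' of None \<Rightarrow> None | Some (pre, p, post) \<Rightarrow> Some (a # pre, p, post)))"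

text \<open>The parameters of the constructor are not compared with those of the eliminator, in
  accordance with the rules of \<open>conv\<close>. The eliminator \<open>e\<close> itself is an
  argument because the recursive call for \<open>CSucc\<close> must repeat it with its
  levels.\<close>

definition contract :: "raw \<Rightarrow> cnst \<Rightarrow> cnst \<Rightarrow> raw list \<Rightarrow> raw list \<Rightarrow> (raw \<times> raw list) option" where
  "contract e c c' pre u = (case c' of
     CPair \<Rightarrow> (if c = CIndSigma then (case (pre, u) of
       ([A, B, C, g], [A', B', a, b]) \<Rightarrow> Some (g, [a, b]) | _ \<Rightarrow> None) else None)
   | CInl \<Rightarrow> (if c = CIndSum then (case (pre, u) of
       ([A, B, C, f, g], [A', B', a]) \<Rightarrow> Some (f, [a]) | _ \<Rightarrow> None) else None)
   | CInr \<Rightarrow> (if c = CIndSum then (case (pre, u) of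
       ([A, B, C, f, g], [A', B', a]) \<Rightarrow> Some (g, [a]) | _ \<Rightarrow> None) else None)
   | CStar \<Rightarrow> (if c = CIndUnit then (case (pre, u) of
       ([C, d], []) \<Rightarrow> Some (d, []) | _ \<Rightarrow> None) else None)
   | CZero \<Rightarrow> (if c = CIndNat then (case (pre, u) of
       ([C, d, g], []) \<Rightarrow> Some (d, []) | _ \<Rightarrow> None) else None)
   | CSucc \<Rightarrow> (if c = CIndNat then (case (pre, u) of
       ([C, d, g], [n]) \<Rightarrow> Some (g, [n, Ap (Ap (Ap (Ap e C) d) g) n]) | _ \<Rightarrow> None) else None)
   | CRefl \<Rightarrow> (if c = CIndId then (case (pre, u) of
       ([A, C, d, x, y], [A', a]) \<Rightarrow> Some (d, [a]) | _ \<Rightarrow> None) else None)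
   | CTr \<Rightarrow> (if c = CRecTrunc then (case (pre, u) of
       ([A, B, p, f], [A', a]) \<Rightarrow> Some (f, [a]) | _ \<Rightarrow> None) else None)
   | _ \<Rightarrow> None)"

definition iota :: "raw \<Rightarrow> cnst \<Rightarrow> raw list \<Rightarrow> raw \<times> raw list \<Rightarrow> (raw \<times> raw list) option" where
  "iota e c pre x = (case x of (h, u) \<Rightarrow> (case h of Co c' k l \<Rightarrow> contract e c c' pre u | _ \<Rightarrow> None))"

text \<open>Successive \<open>\<beta>\<close>-redexes are contracted by one substitution.\<close>

fun beta :: "raw list \<Rightarrow> raw \<Rightarrow> raw list \<Rightarrow> raw \<times> raw list" where
  "beta \<sigma> (La A b) (a # s) = beta (a # \<sigma>) b s"
| "beta \<sigma> t s = (inst \<sigma> 0 t, s)"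

text \<open>The flag decides whether a name in head position is unfolded.\<close>

partial_function (option) wh :: "bool \<Rightarrow> raw \<Rightarrow> raw list \<Rightarrow> (raw \<times> raw list) option" where
  "wh d t s = (case t of
     Ap f a \<Rightarrow> wh d f (a # s)
   | La A b \<Rightarrow> (case s of [] \<Rightarrow> Some (t, s) | a # s' \<Rightarrow> (case beta [a] b s' of (u, v) \<Rightarrow> wh d u v))
   | Gl r b A \<Rightarrow> (if d then wh d b s else Some (t, s))
   | Co c k l \<Rightarrow> (case elim_arity c of 0 \<Rightarrow> Some (t, s) | Suc n \<Rightarrow>
       (case split_at (Suc n) s of None \<Rightarrow> Some (t, s) | Some (pre, p, post) \<Rightarrow>
         Option.bind (wh True p []) (\<lambda>x. case iota t c pre x of None \<Rightarrow> Some (t, s)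
           | Some (f, v) \<Rightarrow> wh d f (v @ post))))
   | _ \<Rightarrow> Some (t, s))"

subsection \<open>Conversion\<close>

definition same :: "raw \<Rightarrow> raw \<Rightarrow> bool" where
  "same t u \<longleftrightarrow> t = u"

primrec zip_opt :: "raw list \<Rightarrow> raw list \<Rightarrow> (raw \<times> raw) list option" where
  "zip_opt [] s' = (case s' of [] \<Rightarrow> Some [] | _ # _ \<Rightarrow> None)"
| "zip_opt (a # s) s' = (case s' of [] \<Rightarrow> None | a' # s'' \<Rightarrow>
     (case zip_opt s s'' of None \<Rightarrow> None | Some w \<Rightarrow> Some ((a, a') # w)))"

text \<open>For \<open>Reduce\<close> all listed comparisons have to succeed. \<open>Try\<close>
  offers a list that is attempted first and a single comparison as a fallback.\<close>

datatype comparison = Fail | Reduce "(raw \<times> raw) list" | Try "(raw \<times> raw) list" "raw \<times> raw"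

definition compare_args :: "bool \<Rightarrow> raw list \<Rightarrow> raw list \<Rightarrow> comparison" where
  "compare_args b s s' = (if b then (case zip_opt s s' of None \<Rightarrow> Fail | Some w \<Rightarrow> Reduce w) else Fail)"

text \<open>Applications of the same name are compared argument by argument before anything is
  unfolded. Otherwise the name of higher rank is unfolded: ranks grow along the declarations, so its
  body may lead to the other name. At equal ranks both are unfolded.\<close>

definition compare_Gl :: "nat \<Rightarrow> raw \<Rightarrow> raw \<Rightarrow> raw list \<Rightarrow> nat \<Rightarrow> raw \<Rightarrow> raw \<Rightarrow> raw list \<Rightarrow> comparison" where
  "compare_Gl r b A s r' b' A' s' =
     (if r = r' then (if same b b' then (case zip_opt s s' of None \<Rightarrow> Reduce [(aps b s, aps b' s')]
         | Some w \<Rightarrow> Try w (aps b s, aps b' s')) else Reduce [(aps b s, aps b' s')])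
      else if r < r' then Reduce [(aps (Gl r b A) s, aps b' s')]
      else Reduce [(aps b s, aps (Gl r' b' A') s')])"

text \<open>An abstraction against another head is compared by eta-expanding the latter. The domains
  of two abstractions are ignored, which \<open>conv_Lam_domain\<close> justifies.\<close>

definition compare :: "raw \<times> raw list \<Rightarrow> raw \<times> raw list \<Rightarrow> comparison" where
  "compare x y = (case x of (h, s) \<Rightarrow> (case y of (h', s') \<Rightarrow> (case h of
     Gl r b A \<Rightarrow> (case h' of Gl r' b' A' \<Rightarrow> compare_Gl r b A s r' b' A' s'
       | _ \<Rightarrow> Reduce [(aps b s, aps h' s')])
   | La A b \<Rightarrow> (case s of _ # _ \<Rightarrow> Fail | [] \<Rightarrow> (case h' of
         Gl r' b' A' \<Rightarrow> Reduce [(La A b, aps b' s')]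
       | La A' b' \<Rightarrow> (case s' of _ # _ \<Rightarrow> Fail | [] \<Rightarrow> Reduce [(b, b')])
       | _ \<Rightarrow> Reduce [(b, Ap (rshift (Suc 0) 0 (aps h' s')) (Va 0))]))
   | _ \<Rightarrow> (case h' of
         Gl r' b' A' \<Rightarrow> Reduce [(aps h s, aps b' s')]
       | La A' b' \<Rightarrow> (case s' of _ # _ \<Rightarrow> Fail | [] \<Rightarrow> Reduce [(Ap (rshift (Suc 0) 0 (aps h s)) (Va 0), b')])
       | Va n' \<Rightarrow> (case h of Va n \<Rightarrow> compare_args (n = n') s s' | _ \<Rightarrow> Fail)
       | Ty k' \<Rightarrow> (case h of Ty k \<Rightarrow> compare_args (k = k') s s' | _ \<Rightarrow> Fail)
       | Co c' k' l' \<Rightarrow> (case h of Co c k l \<Rightarrow> compare_args (c = c') s s' | _ \<Rightarrow> Fail)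
       | Pr A' B' \<Rightarrow> (case h of Pr A B \<Rightarrow> (case s of _ # _ \<Rightarrow> Fail | [] \<Rightarrow> (case s' of _ # _ \<Rightarrow> Fail
           | [] \<Rightarrow> Reduce [(A, A'), (B, B')])) | _ \<Rightarrow> Fail)
       | _ \<Rightarrow> Fail))))"

text \<open>The list is a conjunction of pending comparisons. The answer \<open>Some False\<close>
  only says that this strategy failed.\<close>

partial_function (option) cv :: "(raw \<times> raw) list \<Rightarrow> bool option" where
  "cv w = (case w of [] \<Rightarrow> Some True | p # w' \<Rightarrow> (case p of (t, u) \<Rightarrow>
     if same t u then cv w' else
       Option.bind (wh False t []) (\<lambda>x. Option.bind (wh False u []) (\<lambda>y.
         (case compare x y of Fail \<Rightarrow> Some False
          | Reduce v \<Rightarrow> cv (v @ w')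
          | Try v q \<Rightarrow> Option.bind (cv v) (\<lambda>b. if b then cv w' else cv (q # w')))))))"

subsection \<open>Type inference\<close>

definition sort_of :: "raw \<Rightarrow> nat option" where
  "sort_of S = (case S of Ty k \<Rightarrow> Some k | _ \<Rightarrow>
     Option.bind (wh True S []) (\<lambda>x. case x of (h, s) \<Rightarrow> (case s of [] \<Rightarrow> (case h of Ty k \<Rightarrow> Some k | _ \<Rightarrow> None) | _ # _ \<Rightarrow> None)))"

text \<open>Like \<open>ty_cumulative\<close>, this raises the level of a universe only at the top
  of a type, not in the codomain of a function type.\<close>

definition subtype :: "raw \<Rightarrow> raw \<Rightarrow> bool option" where
  "subtype A B = (case A of Ty k \<Rightarrow> (case B of Ty l \<Rightarrow> Some (k \<le> l) | _ \<Rightarrow> cv [(A, B)]) | _ \<Rightarrow> cv [(A, B)])"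

type_synonym rex = "nat \<Rightarrow> raw"

definition rvar :: "nat \<Rightarrow> rex" where
  "rvar k = (\<lambda>n. Va (n - Suc k))"

definition rPI :: "rex \<Rightarrow> (rex \<Rightarrow> rex) \<Rightarrow> rex" where
  "rPI A B = (\<lambda>n. Pr (A n) (B (rvar n) (Suc n)))"

definition rLAM :: "rex \<Rightarrow> (rex \<Rightarrow> rex) \<Rightarrow> rex" where
  "rLAM A b = (\<lambda>n. La (A n) (b (rvar n) (Suc n)))"

definition rAPP :: "rex \<Rightarrow> rex \<Rightarrow> rex"  (infixl "$" 90) where
  "f $ a = (\<lambda>n. Ap (f n) (a n))"

definition rCST :: "nat \<Rightarrow> nat \<Rightarrow> cnst \<Rightarrow> rex" where
  "rCST k l c = (\<lambda>n. Co c k l)"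

definition rTY :: "nat \<Rightarrow> rex" where
  "rTY k = (\<lambda>n. Ty k)"

definition gl :: "nat \<Rightarrow> raw \<Rightarrow> raw \<Rightarrow> rex" where
  "gl r b A = (\<lambda>n. Gl r b A)"

definition rclosed :: "rex \<Rightarrow> raw" where
  "rclosed e = e 0"

syntax
  "_rPI" :: "pttrn \<Rightarrow> rex \<Rightarrow> rex \<Rightarrow> rex"  ("(3\<^bold>\<Pi> _ : _./ _)" [0, 0, 10] 10)
  "_rLAM" :: "pttrn \<Rightarrow> rex \<Rightarrow> rex \<Rightarrow> rex"  ("(3\<Lambda> _ : _./ _)" [0, 0, 10] 10)
translations
  "\<^bold>\<Pi> x : A. B" \<rightleftharpoons> "CONST rPI A (\<lambda>x. B)"
  "\<Lambda> x : A. b" \<rightleftharpoons> "CONST rLAM A (\<lambda>x. b)"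

definition rArr :: "rex \<Rightarrow> rex \<Rightarrow> rex"  (infixr "\<Rrightarrow>" 55) where
  "A \<Rrightarrow> B = (\<^bold>\<Pi> x : A. B)"

text \<open>The types of the constants, with \<open>rTY 0\<close> as a dummy for those that are not needed.\<close>

primrec cty :: "cnst \<Rightarrow> nat \<Rightarrow> nat \<Rightarrow> raw" where
  "cty CSigma i j = rclosed ((\<^bold>\<Pi> A : rTY i. (A \<Rrightarrow> rTY i) \<Rrightarrow> rTY i))"
| "cty CPair i j = rclosed ((\<^bold>\<Pi> A : rTY i. \<^bold>\<Pi> B : A \<Rrightarrow> rTY i. \<^bold>\<Pi> a : A. B $ a \<Rrightarrow> rCST i 0 CSigma $ A $ B))"
| "cty CIndSigma i j = rclosed (
     (\<^bold>\<Pi> A : rTY i. \<^bold>\<Pi> B : A \<Rrightarrow> rTY i. \<^bold>\<Pi> C : rCST i 0 CSigma $ A $ B \<Rrightarrow> rTY j.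
       (\<^bold>\<Pi> a : A. \<^bold>\<Pi> b : B $ a. C $ (rCST i 0 CPair $ A $ B $ a $ b)) \<Rrightarrow>
       (\<^bold>\<Pi> p : rCST i 0 CSigma $ A $ B. C $ p)))"
| "cty CSum i j = rclosed (rTY i \<Rrightarrow> rTY i \<Rrightarrow> rTY i)"
| "cty CInl i j = rclosed ((\<^bold>\<Pi> A : rTY i. \<^bold>\<Pi> B : rTY i. A \<Rrightarrow> rCST i 0 CSum $ A $ B))"
| "cty CInr i j = rclosed ((\<^bold>\<Pi> A : rTY i. \<^bold>\<Pi> B : rTY i. B \<Rrightarrow> rCST i 0 CSum $ A $ B))"
| "cty CIndSum i j = rclosed (
     (\<^bold>\<Pi> A : rTY i. \<^bold>\<Pi> B : rTY i. \<^bold>\<Pi> C : rCST i 0 CSum $ A $ B \<Rrightarrow> rTY j.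
       (\<^bold>\<Pi> a : A. C $ (rCST i 0 CInl $ A $ B $ a)) \<Rrightarrow>
       (\<^bold>\<Pi> b : B. C $ (rCST i 0 CInr $ A $ B $ b)) \<Rrightarrow>
       (\<^bold>\<Pi> p : rCST i 0 CSum $ A $ B. C $ p)))"
| "cty CEmpty i j = rclosed (rTY i)"
| "cty CIndEmpty i j = rclosed ((\<^bold>\<Pi> C : rCST 0 0 CEmpty \<Rrightarrow> rTY j. \<^bold>\<Pi> p : rCST 0 0 CEmpty. C $ p))"
| "cty CUnit i j = rclosed (rTY i)"
| "cty CStar i j = rclosed (rCST 0 0 CUnit)"
| "cty CIndUnit i j = rclosed ((\<^bold>\<Pi> C : rCST 0 0 CUnit \<Rrightarrow> rTY j. C $ rCST 0 0 CStar \<Rrightarrow> (\<^bold>\<Pi> p : rCST 0 0 CUnit. C $ p)))"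
| "cty CNat i j = rclosed (rTY i)"
| "cty CZero i j = rclosed (rCST 0 0 CNat)"
| "cty CSucc i j = rclosed (rCST 0 0 CNat \<Rrightarrow> rCST 0 0 CNat)"
| "cty CIndNat i j = rclosed (
     (\<^bold>\<Pi> C : rCST 0 0 CNat \<Rrightarrow> rTY j. C $ rCST 0 0 CZero \<Rrightarrow>
       (\<^bold>\<Pi> n : rCST 0 0 CNat. C $ n \<Rrightarrow> C $ (rCST 0 0 CSucc $ n)) \<Rrightarrow>
       (\<^bold>\<Pi> n : rCST 0 0 CNat. C $ n)))"
| "cty CId i j = rclosed ((\<^bold>\<Pi> A : rTY i. A \<Rrightarrow> A \<Rrightarrow> rTY i))"
| "cty CRefl i j = rclosed ((\<^bold>\<Pi> A : rTY i. \<^bold>\<Pi> a : A. rCST i 0 CId $ A $ a $ a))"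
| "cty CIndId i j = rclosed (
     (\<^bold>\<Pi> A : rTY i. \<^bold>\<Pi> C : (\<^bold>\<Pi> x : A. \<^bold>\<Pi> y : A. rCST i 0 CId $ A $ x $ y \<Rrightarrow> rTY j).
       (\<^bold>\<Pi> x : A. C $ x $ x $ (rCST i 0 CRefl $ A $ x)) \<Rrightarrow>
       (\<^bold>\<Pi> x : A. \<^bold>\<Pi> y : A. \<^bold>\<Pi> p : rCST i 0 CId $ A $ x $ y. C $ x $ y $ p)))"
| "cty CTrunc i j = rclosed (rTY i \<Rrightarrow> rTY i)"
| "cty CTr i j = rclosed ((\<^bold>\<Pi> A : rTY i. A \<Rrightarrow> rCST i 0 CTrunc $ A))"
| "cty CSquash i j = rclosed (rTY 0)"
| "cty CRecTrunc i j = rclosed (rTY 0)"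
| "cty CFunext i j = rclosed (
     (\<^bold>\<Pi> A : rTY i. \<^bold>\<Pi> B : A \<Rrightarrow> rTY i. \<^bold>\<Pi> f : (\<^bold>\<Pi> x : A. B $ x). \<^bold>\<Pi> g : (\<^bold>\<Pi> x : A. B $ x).
       let P = (\<^bold>\<Pi> x : A. B $ x);
           E = rCST i 0 CId $ P $ f $ g;
           F = (\<^bold>\<Pi> x : A. rCST i 0 CId $ (B $ x) $ (f $ x) $ (g $ x));
           H = (\<Lambda> p : E. rCST i i CIndId $ P
             $ (\<Lambda> f : P. \<Lambda> g : P. \<Lambda> p : rCST i 0 CId $ P $ f $ g.
                  \<^bold>\<Pi> x : A. rCST i 0 CId $ (B $ x) $ (f $ x) $ (g $ x))
             $ (\<Lambda> f : P. \<Lambda> x : A. rCST i 0 CRefl $ (B $ x) $ (f $ x)) $ f $ g $ p)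
       in rCST i 0 CSigma
            $ (rCST i 0 CSigma $ (F \<Rrightarrow> E) $ (\<Lambda> h : F \<Rrightarrow> E. \<^bold>\<Pi> y : F. rCST i 0 CId $ F $ (H $ (h $ y)) $ y))
            $ (\<Lambda> x : (rCST i 0 CSigma $ (F \<Rrightarrow> E) $ (\<Lambda> h : F \<Rrightarrow> E. \<^bold>\<Pi> y : F. rCST i 0 CId $ F $ (H $ (h $ y)) $ y)).
                 rCST i 0 CSigma $ (F \<Rrightarrow> E) $ (\<Lambda> h : F \<Rrightarrow> E. \<^bold>\<Pi> x : E. rCST i 0 CId $ E $ (h $ (H $ x)) $ x))))"
| "cty CUnivalence i j = rclosed (rTY 0)"

datatype task = Infer "raw list" raw "raw list" | Spine "raw list" raw "raw list" "raw list"

text \<open>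
  \<open>Infer \<Gamma> t s\<close> asks for the type of \<open>t\<close> applied to the arguments \<open>s\<close>, and \<open>Spine \<Gamma> T \<sigma> s\<close> for the
  type of the application to \<open>s\<close> of a function of type \<open>inst \<sigma> 0 T\<close>. Subject reduction is not
  available for the untyped conversion; so a type that has to be reduced in order to become a
  \<open>\<Pi>\<close>-type is checked again afterwards.
\<close>

partial_function (option) tc :: "task \<Rightarrow> raw option" where
  "tc k = (case k of
     Infer \<Gamma> t s \<Rightarrow> (case t of
       Ap f a \<Rightarrow> tc (Infer \<Gamma> f (a # s))
     | Va n \<Rightarrow> (case lookup \<Gamma> n of Inl A \<Rightarrow> tc (Spine \<Gamma> (rshift (Suc n) 0 A) [] s) | Inr _ \<Rightarrow> None)
     | Ty i \<Rightarrow> (case s of [] \<Rightarrow> Some (Ty (Suc i)) | _ # _ \<Rightarrow> None)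
     | Pr A B \<Rightarrow> (case s of [] \<Rightarrow>
         Option.bind (tc (Infer \<Gamma> A [])) (\<lambda>S. Option.bind (sort_of S) (\<lambda>i.
         Option.bind (tc (Infer (A # \<Gamma>) B [])) (\<lambda>S'. Option.bind (sort_of S') (\<lambda>j.
           Some (Ty (max i j)))))) | _ # _ \<Rightarrow> None)
     | La A b \<Rightarrow>
         Option.bind (tc (Infer \<Gamma> A [])) (\<lambda>S. Option.bind (sort_of S) (\<lambda>i.
         Option.bind (tc (Infer (A # \<Gamma>) b [])) (\<lambda>B. tc (Spine \<Gamma> (Pr A B) [] s))))
     | Co c i j \<Rightarrow> tc (Spine \<Gamma> (cty c i j) [] s)
     | Gl r b A \<Rightarrow> tc (Spine \<Gamma> A [] s))
   | Spine \<Gamma> T \<sigma> s \<Rightarrow> (case s of [] \<Rightarrow> Some (inst_0 \<sigma> T) | a # s' \<Rightarrow> (case T of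
       Pr A B \<Rightarrow> Option.bind (tc (Infer \<Gamma> a [])) (\<lambda>A'. Option.bind (subtype A' (inst_0 \<sigma> A)) (\<lambda>b.
         if b then tc (Spine \<Gamma> B (a # \<sigma>) s') else None))
     | _ \<Rightarrow> Option.bind (wh True (inst_0 \<sigma> T) []) (\<lambda>x. case x of (h, u) \<Rightarrow> (case u of _ # _ \<Rightarrow> None | [] \<Rightarrow>
         (case h of Pr A B \<Rightarrow> Option.bind (tc (Infer \<Gamma> h [])) (\<lambda>S. Option.bind (sort_of S) (\<lambda>_. tc (Spine \<Gamma> h [] s))) | _ \<Rightarrow> None))))))"

definition check :: "raw list \<Rightarrow> raw \<Rightarrow> raw \<Rightarrow> bool option" where
  "check \<Gamma> b A = Option.bind (tc (Infer \<Gamma> A [])) (\<lambda>S. Option.bind (sort_of S) (\<lambda>i.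
     Option.bind (tc (Infer \<Gamma> b [])) (\<lambda>A'. cv [(A', A)])))"

subsection \<open>Soundness\<close>

text \<open>\<open>ok i t\<close> means that the constants in \<open>t\<close> have valid types, and the names the types they claim.\<close>

inductive ok :: "nat \<Rightarrow> raw \<Rightarrow> bool" for i where
  ok_Va: "ok i (Va n)"
| ok_Ty: "ok i (Ty k)"
| ok_Pr: "ok i A \<Longrightarrow> ok i B \<Longrightarrow> ok i (Pr A B)"
| ok_La: "ok i A \<Longrightarrow> ok i b \<Longrightarrow> ok i (La A b)"
| ok_Ap: "ok i f \<Longrightarrow> ok i a \<Longrightarrow> ok i (Ap f a)"
| ok_Co: "er i (cty c k l) = closed_tm (cnst_type (i + k) (i + l) c) \<Longrightarrow> is_type [] (er i (cty c k l)) \<Longrightarrow>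
    ok i (cty c k l) \<Longrightarrow> ok i (Co c k l)"
| ok_Gl: "[] \<turnstile> er i b : er i A \<Longrightarrow> is_type [] (er i A) \<Longrightarrow> ok i b \<Longrightarrow> ok i A \<Longrightarrow> ok i (Gl r b A)"

inductive_simps ok_simps [simp]:
  "ok i (Va n)" "ok i (Ty k)" "ok i (Pr A B)" "ok i (La A b)" "ok i (Ap f a)"

inductive_cases ok_CoE: "ok i (Co c k l)"
inductive_cases ok_GlE: "ok i (Gl r b A)"

abbreviation oks :: "nat \<Rightarrow> raw list \<Rightarrow> bool" where
  "oks i s \<equiv> list_all (ok i) s"

definition env :: "tm list \<Rightarrow> nat \<Rightarrow> tm" where
  "env s n = (if n < length s then s ! n else Var (n - length s))"

lemma env_Nil [simp]: "env [] = Var"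
  by (rule ext) (simp add: env_def)

lemma up_iter: "(up ^^ k) s n = (if n < k then Var n else shift k 0 (s (n - k)))"
proof (induction k arbitrary: n)
  case 0
  show ?case by (simp add: shift_0_eq_ren ren_eq_sub comp_def)
next
  case (Suc k)
  then show ?case
    by (cases n) (auto simp: shift_0_eq_ren ren_ren comp_def)
qed

text \<open>A single beta step is absorbed by extending the environment. Hence the simultaneous
  substitution in \<open>beta\<close>, and the delayed one in \<open>Spine\<close>, agree with
  successive single steps.\<close>

lemma sub_env_Cons: "subst 0 a (sub (up (env s)) t) = sub (env (a # s)) t"
proof -
  have "(\<lambda>n. case n of 0 \<Rightarrow> a | Suc m \<Rightarrow> env s m) = env (a # s)"
    by (rule ext) (simp add: env_def split: nat.split)
  then show ?thesis by (simp add: subst_0_eq_sub sub_sub sub_single_comp)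
qed

lemma minus_opt: "minus_opt n k = (if n < k then None else Some (n - k))"
  by (induction k arbitrary: n) (auto split: nat.split)

lemma lookup: "lookup s n = (if n < length s then Inl (s ! n) else Inr (n - length s))"
  by (induction s arbitrary: n) (auto split: nat.split)

lemma ok_rshift [simp]: "ok i t \<Longrightarrow> ok i (rshift d k t)"
  by (induction t arbitrary: k) (auto split: option.split)

text \<open>Names are left untouched by shifting. This is correct because \<open>ok\<close> requires
  them to be typable in the empty context, so their erasures are closed.\<close>

lemma er_rshift: "ok i t \<Longrightarrow> er i (rshift d k t) = shift d k (er i t)"
proof (induction t arbitrary: k)
  case (Gl r b A)
  then show ?case
    by (auto elim!: ok_GlE simp: shift_eq_ren ren_eq_sub closed_sub)
qed (auto simp: minus_opt)

lemma rshift_0: "rshift_0 d t = (if d = 0 then t else rshift d 0 t)"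
  by (simp add: rshift_0_def split: nat.split)

lemma shift_0_0: "shift 0 0 t = t"
  by (simp add: shift_0_eq_ren ren_eq_sub comp_def)

lemma ok_inst [simp]: "ok i t \<Longrightarrow> oks i s \<Longrightarrow> ok i (inst s k t)"
  by (induction t arbitrary: k) (auto simp: minus_opt lookup rshift_0 list_all_length)

lemma er_inst: "ok i t \<Longrightarrow> oks i s \<Longrightarrow> er i (inst s k t) = sub ((up ^^ k) (env (map (er i) s))) (er i t)"
proof (induction t arbitrary: k)
  case (Va n)
  then show ?case
    by (auto simp: minus_opt lookup rshift_0 list_all_length up_iter env_def er_rshift shift_0_0)
next
  case (Gl r b A)
  then show ?case by (auto elim!: ok_GlE simp: closed_sub)
qed auto

lemma inst_0: "ok i t \<Longrightarrow> oks i s \<Longrightarrow> ok i (inst_0 s t) \<and> er i (inst_0 s t) = sub (env (map (er i) s)) (er i t)"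
  using er_inst[of i t s 0] by (auto simp: inst_0_def split: list.split)

lemma er_aps [simp]: "er i (aps f s) = apps (er i f) (map (er i) s)"
  by (induction s arbitrary: f) auto

lemma ok_aps [simp]: "ok i (aps f s) \<longleftrightarrow> ok i f \<and> oks i s"
  by (induction s arbitrary: f) auto

lemma apps_append: "apps f (s @ s') = apps (apps f s) s'"
  by (induction s arbitrary: f) auto

lemma split_at: "split_at n s = Some (pre, p, post) \<Longrightarrow> s = pre @ p # post"
  by (induction n arbitrary: s pre) (auto split: list.splits option.splits)

lemma contract:
  assumes "contract e c c' pre u = Some (f, v)" "er i e = Cst c" "ok i e" "oks i pre" "oks i u"
  shows "apps (Cst c) (map (er i) pre @ [apps (Cst c') (map (er i) u)]) \<down> apps (er i f) (map (er i) v) \<and> ok i f \<and> oks i v"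
  using assms unfolding contract_def
  by (auto split: cnst.splits if_splits list.splits)
    (use conv_Sigma conv_Inl conv_Inr conv_Unit conv_Zero conv_Succ conv_Id conv_Trunc in force)+

definition wh_sound :: "nat \<Rightarrow> raw \<Rightarrow> raw list \<Rightarrow> raw \<times> raw list \<Rightarrow> bool" where
  "wh_sound i t s x \<longleftrightarrow> (ok i t \<longrightarrow> oks i s \<longrightarrow> ok i (fst x) \<and> oks i (snd x) \<and>
     er i (aps t s) \<down> er i (aps (fst x) (snd x)))"

lemma conv_apps_left: "f \<down> f' \<Longrightarrow> apps f s \<down> apps f' s"
  by (rule conv_apps) (simp_all add: list_all2_conv_refl)

lemma beta:
  "beta \<sigma> t s = (u, v) \<Longrightarrow> ok i t \<Longrightarrow> oks i \<sigma> \<Longrightarrow> oks i s \<Longrightarrow>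
    ok i u \<and> oks i v \<and> apps (er i (inst \<sigma> 0 t)) (map (er i) s) \<down> apps (er i u) (map (er i) v)"
proof (induction \<sigma> t s rule: beta.induct)
  case (1 \<sigma> A b a s)
  then have IH: "ok i u \<and> oks i v \<and> apps (er i (inst (a # \<sigma>) 0 b)) (map (er i) s) \<down> apps (er i u) (map (er i) v)"
    by simp
  have "App (Lam (sub (env (map (er i) \<sigma>)) (er i A)) (sub (up (env (map (er i) \<sigma>))) (er i b))) (er i a) \<down>
      er i (inst (a # \<sigma>) 0 b)"
    using 1 conv_beta[of "sub (env (map (er i) \<sigma>)) (er i A)" "sub (up (env (map (er i) \<sigma>))) (er i b)" "er i a"]
    by (simp add: er_inst sub_env_Cons)
  with IH show ?case using 1 by (auto simp: er_inst intro: conv_trans conv_apps_left)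
qed (auto simp: conv_refl simp del: inst.simps)

lemma wh_sound: "wh d t s = Some x \<Longrightarrow> wh_sound i t s x"
\<comment> \<open>Fixed-point induction: \<open>wh\<close> now stands for an arbitrary function with
  the claimed property, so nothing is said about termination. The soundness proofs of
  \<open>cv\<close> and \<open>tc\<close> proceed in the same way.\<close>
proof (rule wh.raw_induct[where P = "\<lambda>_. wh_sound i"])
  fix wh d t s x
  assume IH: "\<And>d t s x. wh d t s = Some x \<Longrightarrow> wh_sound i t s x"
    and eq: "(case t of
       Ap f a \<Rightarrow> wh d f (a # s)
     | La A b \<Rightarrow> (case s of [] \<Rightarrow> Some (t, s) | a # s' \<Rightarrow> (case beta [a] b s' of (u, v) \<Rightarrow> wh d u v))
     | Gl r b A \<Rightarrow> (if d then wh d b s else Some (t, s))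
     | Co c k l \<Rightarrow> (case elim_arity c of 0 \<Rightarrow> Some (t, s) | Suc n \<Rightarrow>
         (case split_at (Suc n) s of None \<Rightarrow> Some (t, s) | Some (pre, p, post) \<Rightarrow>
           Option.bind (wh True p []) (\<lambda>x. case iota t c pre x of None \<Rightarrow> Some (t, s)
             | Some (f, v) \<Rightarrow> wh d f (v @ post))))
     | _ \<Rightarrow> Some (t, s)) = Some x"
  show "wh_sound i t s x"
  proof (cases t)
    case (La A b)
    show ?thesis
    proof (cases s)
      case Nil
      then show ?thesis using eq La by (auto simp: wh_sound_def conv_refl)
    next
      case (Cons a s')
      obtain u v where uv: "beta [a] b s' = (u, v)" by fastforce
      then have "wh_sound i u v x" using eq La Cons by (auto intro: IH)
      moreover have "App (Lam (er i A) (er i b)) (er i a) \<down> er i (inst [a] 0 b)" if "ok i b" "ok i a"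
        using that conv_beta[of "er i A" "er i b" "er i a"] sub_env_Cons[of "er i a" "[]" "er i b"]
        by (simp add: er_inst up_Var)
      ultimately show ?thesis
        using La Cons beta[OF uv] by (auto simp: wh_sound_def intro: conv_trans conv_apps_left)
    qed
  next
    case (Ap f a)
    then have "wh_sound i f (a # s) x" using eq by (auto intro: IH)
    then show ?thesis using Ap by (auto simp: wh_sound_def)
  next
    case (Gl r b A)
    show ?thesis
    proof (cases d)
      case True
      then have "wh_sound i b s x" using eq Gl by (auto intro: IH)
      then show ?thesis using Gl by (auto simp: wh_sound_def elim: ok_GlE)
    next
      case False
      then show ?thesis using eq Gl by (auto simp: wh_sound_def conv_refl)
    qed
  next
    case (Co c k l)
    show ?thesis
    proof (cases "x = (t, s)")
      case True
      then show ?thesis by (simp add: wh_sound_def conv_refl)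
    next
      case False
      with eq Co obtain n pre p post h u f v where
        *: "split_at (Suc n) s = Some (pre, p, post)" "wh True p [] = Some (h, u)"
          "iota t c pre (h, u) = Some (f, v)" "wh d f (v @ post) = Some x"
        by (auto split: nat.splits option.splits simp: bind_eq_Some_conv)
      then obtain c' k' l' where h: "h = Co c' k' l'" "contract t c c' pre u = Some (f, v)"
        by (auto simp: iota_def split: raw.splits)
      have s: "s = pre @ p # post" using *(1) by (rule split_at)
      have p: "wh_sound i p [] (h, u)" and f: "wh_sound i f (v @ post) x"
        using * by (auto intro: IH)
      show ?thesis
        unfolding wh_sound_def
      proof (intro impI)
        assume t: "ok i t" "oks i s"
        then have u: "oks i u" "er i p \<down> apps (Cst c') (map (er i) u)"
          using p h s by (auto simp: wh_sound_def)
        from contract[OF h(2)] t s u Co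
        have c: "apps (Cst c) (map (er i) pre @ [apps (Cst c') (map (er i) u)]) \<down> apps (er i f) (map (er i) v)"
          and f': "ok i f" "oks i v" by auto
        \<comment> \<open>Congruence puts the weak head normal form of the scrutinee in its place
          before the computation rule applies; the further arguments \<open>post\<close> are added
          afterwards.\<close>
        have "apps (Cst c) (map (er i) pre @ [er i p]) \<down> apps (Cst c) (map (er i) pre @ [apps (Cst c') (map (er i) u)])"
          using u(2) by (auto intro!: conv_apps conv_refl list_all2_appendI list_all2_conv_refl)
        then have "apps (Cst c) (map (er i) pre @ [er i p]) \<down> apps (er i f) (map (er i) v)"
          using c by (rule conv_trans)
        then have "apps (apps (Cst c) (map (er i) pre @ [er i p])) (map (er i) post) \<down>
            apps (apps (er i f) (map (er i) v)) (map (er i) post)"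
          by (rule conv_apps_left)
        then have "er i (aps t s) \<down> er i (aps f (v @ post))"
          using Co s by (simp flip: apps_append)
        moreover have "ok i (fst x) \<and> oks i (snd x) \<and> er i (aps f (v @ post)) \<down> er i (aps (fst x) (snd x))"
          using f f' t s by (auto simp: wh_sound_def)
        ultimately show "ok i (fst x) \<and> oks i (snd x) \<and> er i (aps t s) \<down> er i (aps (fst x) (snd x))"
          by (blast intro: conv_trans)
      qed
    qed
  qed (use eq in \<open>auto simp: wh_sound_def conv_refl\<close>)
qed assumption

definition convs :: "nat \<Rightarrow> (raw \<times> raw) list \<Rightarrow> bool" where
  "convs i w \<longleftrightarrow> (\<forall>(t, u) \<in> set w. er i t \<down> er i u)"

definition okps :: "nat \<Rightarrow> (raw \<times> raw) list \<Rightarrow> bool" where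
  "okps i w \<longleftrightarrow> (\<forall>(t, u) \<in> set w. ok i t \<and> ok i u)"

lemma convs_simps [simp]:
  "convs i []" "convs i ((t, u) # w) \<longleftrightarrow> er i t \<down> er i u \<and> convs i w"
  "convs i (v @ w) \<longleftrightarrow> convs i v \<and> convs i w"
  by (auto simp: convs_def)

lemma okps_simps [simp]:
  "okps i []" "okps i ((t, u) # w) \<longleftrightarrow> (ok i t \<and> ok i u) \<and> okps i w"
  "okps i (v @ w) \<longleftrightarrow> okps i v \<and> okps i w"
  by (auto simp: okps_def)

lemma zip_opt:
  "zip_opt s s' = Some w \<Longrightarrow> oks i s \<Longrightarrow> oks i s' \<Longrightarrow>
    okps i w \<and> (convs i w \<longrightarrow> list_all2 (\<down>) (map (er i) s) (map (er i) s'))"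
  by (induction s arbitrary: s' w) (auto split: list.splits option.splits)

definition comparison_sound :: "nat \<Rightarrow> tm \<Rightarrow> tm \<Rightarrow> comparison \<Rightarrow> bool" where
  "comparison_sound i t u r \<longleftrightarrow> (case r of Fail \<Rightarrow> True | Reduce w \<Rightarrow> okps i w \<and> (convs i w \<longrightarrow> t \<down> u)
     | Try w q \<Rightarrow> okps i w \<and> okps i [q] \<and> (convs i w \<longrightarrow> t \<down> u) \<and> (convs i [q] \<longrightarrow> t \<down> u))"

lemma compare_args:
  assumes "oks i s" "oks i s'" "b \<Longrightarrow> h = h'"
  shows "comparison_sound i (apps h (map (er i) s)) (apps h' (map (er i) s')) (compare_args b s s')"
  using assms zip_opt[of s s'] conv_apps[OF conv_refl]
  by (fastforce simp: compare_args_def comparison_sound_def split: option.split)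

lemma compare_Gl:
  assumes "ok i (Gl r b A)" "ok i (Gl r' b' A')" "oks i s" "oks i s'"
  shows "comparison_sound i (apps (er i b) (map (er i) s)) (apps (er i b') (map (er i) s')) (compare_Gl r b A s r' b' A' s')"
  using assms zip_opt[of s s'] conv_apps[OF conv_refl]
  by (fastforce simp: compare_Gl_def comparison_sound_def same_def elim: ok_GlE split: option.split)

lemma conv_eta_Lam:
  "ok i u \<Longrightarrow> er i b \<down> App (er i (rshift (Suc 0) 0 u)) (Var 0) \<Longrightarrow> Lam A (er i b) \<down> er i u"
  by (simp add: er_rshift conv_eta')

lemma er_aps_Gl: "er i (aps (Gl r b A) s) = er i (aps b s)"
  by simp

lemma compare:
  assumes "ok i h" "oks i s" "ok i h'" "oks i s'"
  shows "comparison_sound i (er i (aps h s)) (er i (aps h' s')) (compare (h, s) (h', s'))"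
proof (cases "\<exists>r b A r' b' A'. h = Gl r b A \<and> h' = Gl r' b' A'")
  case True
  then show ?thesis using assms compare_Gl by (auto simp: compare_def)
next
  case no_Gl: False
  show ?thesis
  proof (cases "\<exists>c. (\<exists>n. h = Va n \<and> h' = Va c) \<or> (\<exists>n. h = Ty n \<and> h' = Ty c)")
    case True
    then show ?thesis using assms by (auto simp: compare_def intro!: compare_args[where h = "Var _", simplified] compare_args[where h = "U _", simplified])
  next
    case False
    show ?thesis
    proof (cases "\<exists>c k l c' k' l'. h = Co c k l \<and> h' = Co c' k' l'")
      case True
      then show ?thesis using assms by (auto simp: compare_def intro!: compare_args)
    next
      case no_Co: False
      show ?thesis
        using assms False no_Gl no_Co
        by (cases h; cases h')
          (auto simp: compare_def comparison_sound_def er_aps_Gl simp del: er_aps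
            elim: ok_GlE intro: conv_Pi conv_Lam_domain conv_eta_Lam conv_sym[OF conv_eta_Lam] conv_sym split: list.split)
    qed
  qed
qed

lemma cv_sound: "cv w = Some b \<Longrightarrow> b \<longrightarrow> okps i w \<longrightarrow> convs i w"
proof (rule cv.raw_induct[where P = "\<lambda>w b. b \<longrightarrow> okps i w \<longrightarrow> convs i w"])
  fix cv w b
  assume IH: "\<And>w b. cv w = Some b \<Longrightarrow> b \<longrightarrow> okps i w \<longrightarrow> convs i w"
    and eq: "(case w of [] \<Rightarrow> Some True | p # w' \<Rightarrow> (case p of (t, u) \<Rightarrow>
     if same t u then cv w' else
       Option.bind (wh False t []) (\<lambda>x. Option.bind (wh False u []) (\<lambda>y.
         (case compare x y of Fail \<Rightarrow> Some False
          | Reduce v \<Rightarrow> cv (v @ w')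
          | Try v q \<Rightarrow> Option.bind (cv v) (\<lambda>b. if b then cv w' else cv (q # w'))))))) = Some b"
  show "b \<longrightarrow> okps i w \<longrightarrow> convs i w"
  proof (intro impI)
    assume b: b and w: "okps i w"
    show "convs i w"
    proof (cases w)
      case (Cons p w')
      obtain t u where p: "p = (t, u)" by (cases p)
      show ?thesis
      proof (cases "t = u")
        case True
        then show ?thesis using eq IH[of w' b] b w Cons p by (auto simp: same_def conv_refl)
      next
        case False
        with eq Cons p obtain h s h' s' where
          wh: "wh False t [] = Some (h, s)" "wh False u [] = Some (h', s')" and
          eq: "(case compare (h, s) (h', s') of Fail \<Rightarrow> Some False
            | Reduce v \<Rightarrow> cv (v @ w')
            | Try v q \<Rightarrow> Option.bind (cv v) (\<lambda>b. if b then cv w' else cv (q # w'))) = Some b"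
          by (auto simp: same_def bind_eq_Some_conv)
        from wh_sound[OF wh(1), of i] wh_sound[OF wh(2), of i] w Cons p
        have s: "ok i h" "oks i s" "ok i h'" "oks i s'" "okps i w'" and
          conv: "er i t \<down> er i (aps h s)" "er i u \<down> er i (aps h' s')"
          by (auto simp: wh_sound_def)
        have "er i (aps h s) \<down> er i (aps h' s') \<and> convs i w'"
        proof (cases "compare (h, s) (h', s')")
          case Fail
          then show ?thesis using eq b by simp
        next
          case (Reduce v)
          then show ?thesis
            using eq b IH[of "v @ w'" b] compare[OF s(1-4)] s(5) by (auto simp: comparison_sound_def)
        next
          case (Try v q)
          then obtain b' where b': "cv v = Some b'" "(if b' then cv w' else cv (q # w')) = Some b"
            using eq by (auto simp: bind_eq_Some_conv)
          then show ?thesis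
            using b IH[of v b'] IH[of w' b] IH[of "q # w'" b] compare[OF s(1-4)] s(5) Try
            by (cases q; cases b') (auto simp: comparison_sound_def)
        qed
        then show ?thesis
          using conv Cons p by (auto intro: conv_trans conv_sym)
      qed
    qed simp
  qed
qed assumption

lemma neq_Cons_conv: "(\<forall>x xs. s \<noteq> x # xs) \<longleftrightarrow> s = []"
  by (cases s) auto

lemma sort_of_sound:
  assumes "sort_of S = Some k" "ok i S"
  shows "er i S \<down> U (i + k)"
proof (cases "\<exists>j. S = Ty j")
  case True
  with assms show ?thesis by (auto simp: sort_of_def conv_refl)
next
  case False
  with assms have "wh True S [] = Some (Ty k, [])"
    by (cases S) (auto simp: sort_of_def bind_eq_Some_conv neq_Cons_conv split: list.splits raw.splits)
  from wh_sound[OF this, of i] assms show ?thesis by (simp add: wh_sound_def)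
qed

lemma ty_sort_of:
  assumes "sort_of S = Some k" "ok i S" "\<Gamma> \<turnstile> A : er i S"
  shows "\<Gamma> \<turnstile> A : U (i + k)"
  using sort_of_sound[OF assms(1,2)] assms(3) ty_U[OF typing_ctxt[OF assms(3)]] ty_conv by blast

lemma ty_cumulative_le: "\<Gamma> \<turnstile> A : U i \<Longrightarrow> i \<le> j \<Longrightarrow> \<Gamma> \<turnstile> A : U j"
  by (induction j) (auto simp: le_Suc_eq intro: ty_cumulative)

lemma subtype_sound:
  assumes "subtype A B = Some True" "ok i A" "ok i B" "\<Gamma> \<turnstile> t : er i A" "is_type \<Gamma> (er i B)"
  shows "\<Gamma> \<turnstile> t : er i B"
proof (cases "\<exists>k l. A = Ty k \<and> B = Ty l")
  case True
  then show ?thesis using assms by (auto simp: subtype_def elim!: ty_cumulative_le)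
next
  case False
  then have "cv [(A, B)] = Some True"
    using assms(1) by (auto simp: subtype_def split: raw.splits)
  from cv_sound[OF this, of i] show ?thesis
    using assms by (auto simp: is_type_def intro: ty_conv)
qed

abbreviation ers :: "nat \<Rightarrow> raw list \<Rightarrow> tm list" where
  "ers i s \<equiv> map (er i) s"

text \<open>That the inferred type is a type belongs to the invariant: the conversion rule and the
  inversion of function types both ask for it. A \<open>Spine\<close> task records only the type of
  its head, hence the quantification over \<open>f\<close>.\<close>

definition sound :: "nat \<Rightarrow> task \<Rightarrow> raw \<Rightarrow> bool" where
  "sound i k A \<longleftrightarrow> (case k of
     Infer \<Gamma> t s \<Rightarrow> ctxt (ers i \<Gamma>) \<longrightarrow> oks i \<Gamma> \<longrightarrow> ok i t \<longrightarrow> oks i s \<longrightarrow>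
       ok i A \<and> ers i \<Gamma> \<turnstile> apps (er i t) (ers i s) : er i A \<and> is_type (ers i \<Gamma>) (er i A)
   | Spine \<Gamma> T \<sigma> s \<Rightarrow> (\<forall>f. oks i \<Gamma> \<longrightarrow> ok i T \<longrightarrow> oks i \<sigma> \<longrightarrow> oks i s \<longrightarrow>
       ers i \<Gamma> \<turnstile> f : sub (env (ers i \<sigma>)) (er i T) \<longrightarrow> is_type (ers i \<Gamma>) (sub (env (ers i \<sigma>)) (er i T)) \<longrightarrow>
       ok i A \<and> ers i \<Gamma> \<turnstile> apps f (ers i s) : er i A \<and> is_type (ers i \<Gamma>) (er i A)))"

lemma is_type_closed: "is_type [] A \<Longrightarrow> ctxt \<Gamma> \<Longrightarrow> is_type \<Gamma> A"
  unfolding is_type_def by (metis closed_sub sub.simps(2) sub_Var typing_closed)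

lemma typing_closed': "[] \<turnstile> t : A \<Longrightarrow> ctxt \<Gamma> \<Longrightarrow> \<Gamma> \<turnstile> t : A"
  using typing_closed[of t A \<Gamma>] by simp

lemma is_type_U: "ctxt \<Gamma> \<Longrightarrow> is_type \<Gamma> (U i)"
  unfolding is_type_def by (blast intro: ty_U)

lemma ty_Pi_max:
  assumes "\<Gamma> \<turnstile> A : U (i + k)" "A # \<Gamma> \<turnstile> B : U (i + l)"
  shows "\<Gamma> \<turnstile> Pi A B : U (i + max k l)"
  using assms by (auto intro!: ty_Pi intro: ty_cumulative_le)

lemma tc_sound: "tc k = Some A \<Longrightarrow> sound i k A"
proof (rule tc.raw_induct[where P = "sound i"])
  fix tc k A
  assume IH: "\<And>k A. tc k = Some A \<Longrightarrow> sound i k A"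
    and eq: "(case k of
     Infer \<Gamma> t s \<Rightarrow> (case t of
       Ap f a \<Rightarrow> tc (Infer \<Gamma> f (a # s))
     | Va n \<Rightarrow> (case lookup \<Gamma> n of Inl A \<Rightarrow> tc (Spine \<Gamma> (rshift (Suc n) 0 A) [] s) | Inr _ \<Rightarrow> None)
     | Ty i \<Rightarrow> (case s of [] \<Rightarrow> Some (Ty (Suc i)) | _ # _ \<Rightarrow> None)
     | Pr A B \<Rightarrow> (case s of [] \<Rightarrow>
         Option.bind (tc (Infer \<Gamma> A [])) (\<lambda>S. Option.bind (sort_of S) (\<lambda>i.
         Option.bind (tc (Infer (A # \<Gamma>) B [])) (\<lambda>S'. Option.bind (sort_of S') (\<lambda>j.
           Some (Ty (max i j)))))) | _ # _ \<Rightarrow> None)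
     | La A b \<Rightarrow>
         Option.bind (tc (Infer \<Gamma> A [])) (\<lambda>S. Option.bind (sort_of S) (\<lambda>i.
         Option.bind (tc (Infer (A # \<Gamma>) b [])) (\<lambda>B. tc (Spine \<Gamma> (Pr A B) [] s))))
     | Co c i j \<Rightarrow> tc (Spine \<Gamma> (cty c i j) [] s)
     | Gl r b A \<Rightarrow> tc (Spine \<Gamma> A [] s))
   | Spine \<Gamma> T \<sigma> s \<Rightarrow> (case s of [] \<Rightarrow> Some (inst_0 \<sigma> T) | a # s' \<Rightarrow> (case T of
       Pr A B \<Rightarrow> Option.bind (tc (Infer \<Gamma> a [])) (\<lambda>A'. Option.bind (subtype A' (inst_0 \<sigma> A)) (\<lambda>b.
         if b then tc (Spine \<Gamma> B (a # \<sigma>) s') else None))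
     | _ \<Rightarrow> Option.bind (wh True (inst_0 \<sigma> T) []) (\<lambda>x. case x of (h, u) \<Rightarrow> (case u of _ # _ \<Rightarrow> None | [] \<Rightarrow>
         (case h of Pr A B \<Rightarrow> Option.bind (tc (Infer \<Gamma> h [])) (\<lambda>S. Option.bind (sort_of S) (\<lambda>_. tc (Spine \<Gamma> h [] s))) | _ \<Rightarrow> None)))))) = Some A"
  have infer: "ok i B \<and> ers i \<Gamma> \<turnstile> er i t : er i B \<and> is_type (ers i \<Gamma>) (er i B)"
    if "tc (Infer \<Gamma> t []) = Some B" "ctxt (ers i \<Gamma>)" "oks i \<Gamma>" "ok i t" for \<Gamma> t B
    using IH[OF that(1)] that(2-) by (simp add: sound_def)
  have sort: "ers i \<Gamma> \<turnstile> er i t : U (i + j)"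
    if "tc (Infer \<Gamma> t []) = Some S" "sort_of S = Some j" "ctxt (ers i \<Gamma>)" "oks i \<Gamma>" "ok i t" for \<Gamma> t S j
    using infer[OF that(1,3-)] that(2) by (auto intro: ty_sort_of)
  have spine: "ok i A \<and> ers i \<Gamma> \<turnstile> apps f (ers i s) : er i A \<and> is_type (ers i \<Gamma>) (er i A)"
    if "tc (Spine \<Gamma> T [] s) = Some A" "oks i \<Gamma>" "ok i T" "oks i s"
      "ers i \<Gamma> \<turnstile> f : er i T" "is_type (ers i \<Gamma>) (er i T)" for \<Gamma> T s f
    using IH[OF that(1)] that(2-) by (simp add: sound_def)
  show "sound i k A"
  proof (cases k)
    case k: (Infer \<Gamma> t s)
    have "ok i A \<and> ers i \<Gamma> \<turnstile> apps (er i t) (ers i s) : er i A \<and> is_type (ers i \<Gamma>) (er i A)"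
      if \<Gamma>: "ctxt (ers i \<Gamma>)" "oks i \<Gamma>" and t: "ok i t" and s: "oks i s"
    proof (cases t)
      case (Va n)
      with eq k obtain B where B: "n < length \<Gamma>" "B = \<Gamma> ! n" "tc (Spine \<Gamma> (rshift (Suc n) 0 B) [] s) = Some A"
        by (auto simp: lookup split: if_splits)
      then have B': "ok i B" using \<Gamma>(2) by (simp add: list_all_length)
      show ?thesis
        unfolding Va er.simps
      proof (rule spine[OF B(3)])
        have "shift (Suc n) 0 (ers i \<Gamma> ! n) = er i (rshift (Suc n) 0 B)"
          using B B' by (simp add: er_rshift)
        then show "ers i \<Gamma> \<turnstile> Var n : er i (rshift (Suc n) 0 B)" "is_type (ers i \<Gamma>) (er i (rshift (Suc n) 0 B))"
          using ty_Var[OF \<Gamma>(1), of n] ctxt_nth[OF \<Gamma>(1), of n] B by simp_all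
      qed (use B' \<Gamma> s in simp_all)
    next
      case (Ty j)
      then show ?thesis
        using eq k ty_U[OF \<Gamma>(1), of "i + j"] is_type_U[OF \<Gamma>(1), of "Suc (i + j)"] by (auto split: list.splits)
    next
      case (Pr B C)
      with eq k obtain S S' j l where *: "s = []" "A = Ty (max j l)"
        "tc (Infer \<Gamma> B []) = Some S" "sort_of S = Some j" "tc (Infer (B # \<Gamma>) C []) = Some S'" "sort_of S' = Some l"
        by (auto simp: bind_eq_Some_conv split: list.splits)
      have B: "ers i \<Gamma> \<turnstile> er i B : U (i + j)"
        using * \<Gamma> t Pr by (intro sort) auto
      moreover have "ers i (B # \<Gamma>) \<turnstile> er i C : U (i + l)"
        using * \<Gamma> t Pr B by (intro sort) (auto intro: ctxt_Cons)
      ultimately show ?thesis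
        using * Pr ty_Pi_max is_type_U[OF \<Gamma>(1), of "i + max j l"] by auto
    next
      case (La B b)
      with eq k obtain S C j where *: "tc (Infer \<Gamma> B []) = Some S" "sort_of S = Some j"
        "tc (Infer (B # \<Gamma>) b []) = Some C" "tc (Spine \<Gamma> (Pr B C) [] s) = Some A"
        by (auto simp: bind_eq_Some_conv)
      have B: "ers i \<Gamma> \<turnstile> er i B : U (i + j)"
        using * \<Gamma> t La by (intro sort) auto
      have C: "ok i C \<and> ers i (B # \<Gamma>) \<turnstile> er i b : er i C \<and> is_type (ers i (B # \<Gamma>)) (er i C)"
        using * \<Gamma> t La B by (intro infer) (auto intro: ctxt_Cons)
      then obtain l where l: "ers i (B # \<Gamma>) \<turnstile> er i C : U l" by (auto simp: is_type_def)
      then have "ers i \<Gamma> \<turnstile> Pi (er i B) (er i C) : U (max (i + j) l)"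
        using B by (auto intro!: ty_Pi intro: ty_cumulative_le)
      then show ?thesis
        unfolding La using * \<Gamma> t s La C by (intro spine[OF *(4)]) (auto simp: is_type_def intro: ty_Lam)
    next
      case (Ap f a)
      then have "sound i (Infer \<Gamma> f (a # s)) A" using eq k by (auto intro: IH)
      then show ?thesis using \<Gamma> t s Ap by (simp add: sound_def)
    next
      case (Co c j l)
      with eq k have *: "tc (Spine \<Gamma> (cty c j l) [] s) = Some A" by simp
      then show ?thesis
        unfolding Co using t s \<Gamma> ty_Cst[OF \<Gamma>(1), of c "i + j" "i + l"]
        by (intro spine[OF *]) (auto simp: Co elim!: ok_CoE intro: is_type_closed)
    next
      case (Gl r b B)
      with eq k have *: "tc (Spine \<Gamma> B [] s) = Some A" by simp
      then show ?thesis
        unfolding Gl using t s \<Gamma>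
        by (intro spine[OF *]) (auto simp: Gl elim!: ok_GlE intro: is_type_closed typing_closed')
    qed
    then show ?thesis by (simp add: sound_def k)
  next
    case k: (Spine \<Gamma> T \<sigma> s)
    have "ok i A \<and> ers i \<Gamma> \<turnstile> apps f (ers i s) : er i A \<and> is_type (ers i \<Gamma>) (er i A)"
      if ok: "oks i \<Gamma>" "ok i T" "oks i \<sigma>" "oks i s"
        and f: "ers i \<Gamma> \<turnstile> f : sub (env (ers i \<sigma>)) (er i T)" "is_type (ers i \<Gamma>) (sub (env (ers i \<sigma>)) (er i T))" for f
    proof (cases s)
      case Nil
      then show ?thesis using eq k ok f by (auto simp: inst_0)
    next
      case s: (Cons a s')
      have \<Gamma>: "ctxt (ers i \<Gamma>)" using f(1) by (rule typing_ctxt)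
      show ?thesis
      proof (cases "\<exists>B C. T = Pr B C")
        case True
        then obtain B C where T: "T = Pr B C" by blast
        with eq k s obtain A' where *: "tc (Infer \<Gamma> a []) = Some A'" "subtype A' (inst_0 \<sigma> B) = Some True"
          "tc (Spine \<Gamma> C (a # \<sigma>) s') = Some A"
          by (auto simp: bind_eq_Some_conv split: if_splits)
        let ?B = "sub (env (ers i \<sigma>)) (er i B)" and ?C = "sub (up (env (ers i \<sigma>))) (er i C)"
        have B: "ok i (inst_0 \<sigma> B)" "er i (inst_0 \<sigma> B) = ?B" using ok T by (simp_all add: inst_0)
        \<comment> \<open>Inverting the well-formed function type provides the sort of the domain,
          for the subtype test, and that of the codomain, which makes the instantiated codomain a
          type again.\<close>
        from f(2) T obtain l where l: "ers i \<Gamma> \<turnstile> ?B : U l" "?B # ers i \<Gamma> \<turnstile> ?C : U l"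
          by (auto simp: is_type_def dest: typing_Pi_inv)
        have a: "ers i \<Gamma> \<turnstile> er i a : ?B"
          using subtype_sound[OF *(2), of i "ers i \<Gamma>" "er i a"] infer[OF *(1) \<Gamma>] B ok s l by (auto simp: is_type_def)
        have "ers i \<Gamma> \<turnstile> App f (er i a) : subst 0 (er i a) ?C"
          using f(1) a T by (auto intro: ty_App)
        moreover have "is_type (ers i \<Gamma>) (subst 0 (er i a) ?C)"
          using typing_subst[OF l(2) a] by (auto simp: is_type_def)
        ultimately show ?thesis
          using IH[OF *(3)] ok s T by (simp add: sound_def sub_env_Cons)
      next
        case False
        with eq k s obtain B C D l where *: "wh True (inst_0 \<sigma> T) [] = Some (Pr B C, [])"
          "tc (Infer \<Gamma> (Pr B C) []) = Some D" "sort_of D = Some l" "tc (Spine \<Gamma> (Pr B C) [] s) = Some A"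
          by (cases T) (auto simp: bind_eq_Some_conv neq_Cons_conv split: list.splits raw.splits)
        have T: "ok i (inst_0 \<sigma> T)" "er i (inst_0 \<sigma> T) = sub (env (ers i \<sigma>)) (er i T)" using ok by (simp_all add: inst_0)
        then have BC: "ok i (Pr B C)" and conv: "sub (env (ers i \<sigma>)) (er i T) \<down> er i (Pr B C)"
          using wh_sound[OF *(1), of i] by (simp_all add: wh_sound_def)
        have "is_type (ers i \<Gamma>) (er i (Pr B C))"
          using sort[OF *(2,3) \<Gamma>] ok BC by (auto simp: is_type_def)
        moreover from this conv f have "ers i \<Gamma> \<turnstile> f : er i (Pr B C)"
          by (auto simp: is_type_def intro: ty_conv)
        ultimately show ?thesis
          using ok BC by (intro spine[OF *(4)]) auto
      qed
    qed
    then show ?thesis by (simp add: sound_def k)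
  qed
qed assumption

theorem check_sound:
  assumes "check \<Gamma> b A = Some True" "ctxt (ers i \<Gamma>)" "oks i \<Gamma>" "ok i b" "ok i A"
  shows "ers i \<Gamma> \<turnstile> er i b : er i A" "is_type (ers i \<Gamma>) (er i A)"
proof -
  from assms(1) obtain S k A' where *: "tc (Infer \<Gamma> A []) = Some S" "sort_of S = Some k"
    "tc (Infer \<Gamma> b []) = Some A'" "cv [(A', A)] = Some True"
    by (auto simp: check_def bind_eq_Some_conv)
  have A: "ers i \<Gamma> \<turnstile> er i A : U (i + k)"
    using tc_sound[OF *(1), of i] *(2) assms(2-) by (auto simp: sound_def intro: ty_sort_of)
  then show "is_type (ers i \<Gamma>) (er i A)" by (auto simp: is_type_def)
  have "ok i A' \<and> ers i \<Gamma> \<turnstile> er i b : er i A'"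
    using tc_sound[OF *(3), of i] assms(2-) by (auto simp: sound_def)
  with cv_sound[OF *(4), of i] assms(5) A show "ers i \<Gamma> \<turnstile> er i b : er i A"
    by (auto intro: ty_conv)
qed

text \<open>The evaluation of \<open>check\<close> does not mention the base level, so it validates
  a declaration for every \<open>i\<close>.\<close>

lemma ok_GlI: "check [] b A = Some True \<Longrightarrow> ok i b \<Longrightarrow> ok i A \<Longrightarrow> ok i (Gl r b A)"
  using check_sound[of "[]" b A i] ctxt_Nil by (auto intro: ok_Gl)

lemma substitution_Nil: "ctxt \<Delta> \<Longrightarrow> substitution (env []) [] \<Delta>"
  by (simp add: substitution_def)

text \<open>Instantiates a telescope entry by entry; the final theorem applies it to the four
  components of a precategory.\<close>

lemma substitution_Cons:
  assumes "substitution (env s) \<Gamma> \<Delta>" "\<Delta> \<turnstile> a : sub (env s) A" "length s = length \<Gamma>"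
  shows "substitution (env (a # s)) (A # \<Gamma>) \<Delta>"
proof -
  have s: "env (a # s) \<circ> Suc = env s" by (rule ext) (simp add: env_def)
  have "\<Delta> \<turnstile> env (a # s) k : sub (env (a # s)) (shift (Suc k) 0 ((A # \<Gamma>) ! k))" if "k < Suc (length \<Gamma>)" for k
  proof (cases k)
    case 0
    then show ?thesis using assms(2) s by (simp add: env_def[of "a # s"] shift_1_eq_ren sub_ren)
  next
    case (Suc m)
    have "env (a # s) \<circ> (\<lambda>n. n + Suc k) = env s \<circ> (\<lambda>n. n + Suc m)"
      using Suc by (simp add: s[symmetric] comp_def)
    then show ?thesis
      using assms(1) that Suc by (auto simp: substitution_def shift_0_eq_ren sub_ren env_def[of "a # s"] env_def[of s])
  qed
  with assms(1) show ?thesis by (simp add: substitution_def)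
qed

text \<open>Lets a claim about variable components be compared at two tuples of convertible
  components without unfolding the claim.\<close>

lemma conv_sub_pointwise: "(\<And>n. s n \<down> s' n) \<Longrightarrow> sub s t \<down> sub s' t"
proof (induction t arbitrary: s s')
  have up: "up s n \<down> up s' n" if "\<And>n. s n \<down> s' n" for s s' n
    using that conv_sub[where s = "Var \<circ> Suc"] by (cases n) (auto simp: conv_refl ren_eq_sub)
  { case (Pi A B) show ?case by (simp, intro conv_Pi Pi.IH up Pi.prems) }
  { case (Lam A b) show ?case by (simp, intro conv_Lam Lam.IH up Lam.prems) }
qed (auto intro: conv.intros)

lemma env_conv: "list_all2 (\<down>) s s' \<Longrightarrow> env s n \<down> env s' n"
  by (auto simp: env_def list_all2_conv_all_nth conv_refl)

text \<open>The type of a constant is itself validated by the checker, which presupposes the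
  constants occurring in it. Type formers therefore come first, then constructors, eliminators and
  function extensionality.\<close>

lemma ok_CoI:
  assumes "er i (cty c k l) = closed_tm (cnst_type (i + k) (i + l) c)" "ok i (cty c k l)"
    "Option.bind (tc (Infer [] (cty c k l) [])) sort_of = Some m"
  shows "ok i (Co c k l)"
proof -
  from assms(3) obtain S where *: "tc (Infer [] (cty c k l) []) = Some S" "sort_of S = Some m"
    by (auto simp: bind_eq_Some_conv)
  have "[] \<turnstile> er i (cty c k l) : U (i + m)"
    using tc_sound[OF *(1), of i] *(2) assms(2) ctxt_Nil by (auto simp: sound_def intro: ty_sort_of)
  with assms(1,2) show ?thesis by (intro ok_Co) (auto simp: is_type_def)
qed

section \<open>Evaluation of the checker\<close>

text \<open>
  The checker is run by the simplifier. Values are excluded from simplification by congruence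
  rules that are instances of reflexivity, so terms that have been computed are not traversed
  again. Right-hand sides that still have to be computed are therefore built from copies of the
  constructors, which turn into constructors when their arguments are values.
\<close>

definition mVa where "mVa = Va"
definition mTy where "mTy = Ty"
definition mPr where "mPr = Pr"
definition mLa where "mLa = La"
definition mAp where "mAp = Ap"
definition mSome where "mSome = Some"
definition mCons where "mCons = (#)"
definition mPair where "mPair x y = (x, y)"
definition mReduce :: "raw \<Rightarrow> raw \<Rightarrow> comparison" where "mReduce t u = Reduce [(t, u)]"
definition mTry where "mTry w t u = Try w (t, u)"

lemmas builders = mVa_def mTy_def mPr_def mLa_def mAp_def mSome_def mCons_def mPair_def mReduce_def mTry_def

lemma build:
  "mVa n = Va n" "mTy k = Ty k" "mPr A B = Pr A B" "mLa A B = La A B" "mAp A B = Ap A B"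
  "mSome x = Some x" "mCons x xs = x # xs" "mPair x y = (x, y)"
  "mReduce t u = Reduce [(t, u)]" "mTry w t u = Try w (t, u)"
  by (simp_all add: builders)

lemma value_congs:
  "Va n = Va n" "Ty k = Ty k" "Pr A B = Pr A B" "La A B = La A B" "Ap A B = Ap A B" "Co c i j = Co c i j" "Gl r A B = Gl r A B"
  "Some x = Some x" "x # xs = x # xs" "(x, y) = (x, y)" "Reduce w = Reduce w" "Try w p = Try w p" "same t u = same t u"
  by (rule refl)+

text \<open>As a congruence rule this freezes the continuation until the first computation has
  returned; the weak rules for conditionals and case distinctions do the same for branches.\<close>

lemma bind_weak: "x = y \<Longrightarrow> Option.bind x f = Option.bind y f" by simp

lemmas congs = value_congs bind_weak if_weak_cong option.case_cong_weak sum.case_cong_weak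

lemma nat_ev:
  "0 + n = (n :: nat)" "Suc m + n = Suc (m + n)" "max 0 n = (n :: nat)" "max n 0 = (n :: nat)" "max (Suc m) (Suc n) = Suc (max m n)"
  "(0 \<le> (n :: nat)) = True" "(Suc m \<le> 0) = False" "(Suc m \<le> Suc n) = (m \<le> n)"
  "(Suc m = Suc n) = (m = n)" "(Suc m = 0) = False" "(0 = Suc m) = False" "(x = x) = True"
  by simp_all

lemma bool_ev: "(if True then a else b) = a" "(if False then a else b) = b" by simp_all

lemma append_ev: "[] @ s = s" "(a # v) @ s = mCons a (v @ s)" by (simp_all add: builders)

lemma rshift_ev:
  "rshift d k (Va n) = (case minus_opt n k of None \<Rightarrow> Va n | Some m \<Rightarrow> mVa (n + d))"
  "rshift d k (Ty i) = Ty i"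
  "rshift d k (Pr A B) = mPr (rshift d k A) (rshift d (Suc k) B)"
  "rshift d k (La A b) = mLa (rshift d k A) (rshift d (Suc k) b)"
  "rshift d k (Ap f a) = mAp (rshift d k f) (rshift d k a)"
  "rshift d k (Co c i j) = Co c i j"
  "rshift d k (Gl r b A) = Gl r b A"
  by (simp_all add: builders split: option.split sum.split)

lemma inst_ev:
  "inst s k (Va n) = (case minus_opt n k of None \<Rightarrow> Va n | Some m \<Rightarrow>
     (case lookup s m of Inl a \<Rightarrow> rshift_0 k a | Inr m \<Rightarrow> mVa (m + k)))"
  "inst s k (Ty i) = Ty i"
  "inst s k (Pr A B) = mPr (inst s k A) (inst s (Suc k) B)"
  "inst s k (La A b) = mLa (inst s k A) (inst s (Suc k) b)"
  "inst s k (Ap f a) = mAp (inst s k f) (inst s k a)"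
  "inst s k (Co c i j) = Co c i j"
  "inst s k (Gl r b A) = Gl r b A"
  by (simp_all add: builders split: option.split sum.split)

text \<open>Here and below, auxiliary functions with pattern equations replace case distinctions on
  structured results: the argument is evaluated first and matched afterwards.\<close>

definition split_Cons where
  "split_Cons a x = (case x of None \<Rightarrow> None | Some (pre, y) \<Rightarrow> Some (a # pre, y))"

definition zip_Cons where
  "zip_Cons a b x = (case x of None \<Rightarrow> None | Some w \<Rightarrow> Some ((a, b) # w))"

lemma nat_list_ev:
  "minus_opt n 0 = Some n" "minus_opt 0 (Suc k) = None" "minus_opt (Suc n) (Suc k) = minus_opt n k"
  "lookup [] n = Inr n" "lookup (a # s) 0 = Inl a" "lookup (a # s) (Suc n) = lookup s n"
  "rshift_0 0 t = t" "rshift_0 (Suc d) t = rshift (Suc d) 0 t" "inst_0 [] t = t" "inst_0 (a # s) t = inst (a # s) 0 t"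
  "split_at 0 [] = None" "split_at 0 (p # s) = Some ([], p, s)" "split_at (Suc n) [] = None"
  "split_at (Suc n) (a # s) = split_Cons a (split_at n s)" "split_Cons a None = None" "split_Cons a (Some (pre, x)) = Some (a # pre, x)"
  "zip_opt [] [] = Some []" "zip_opt (a # s) [] = None" "zip_opt [] (a # s) = None"
  "zip_opt (a # s) (b # s') = zip_Cons a b (zip_opt s s')" "zip_Cons a b None = None" "zip_Cons a b (Some w) = Some ((a, b) # w)"
  by (simp_all add: rshift_0_def inst_0_def split_Cons_def zip_Cons_def split: option.split)

lemma contract_ev:
  "contract e CIndSigma CPair [A, B, C, g] [A', B', a, b] = Some (g, [a, b])"
  "contract e CIndSum CInl [A, B, C, f, g] [A', B', a] = Some (f, [a])"
  "contract e CIndSum CInr [A, B, C, f, g] [A', B', a] = Some (g, [a])"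
  "contract e CIndUnit CStar [C, d] [] = Some (d, [])"
  "contract e CIndNat CZero [C, d, g] [] = Some (d, [])"
  "contract e CIndNat CSucc [C, d, g] [a] = Some (g, [a, Ap (Ap (Ap (Ap e C) d) g) a])"
  "contract e CIndId CRefl [A, C, d, x, y] [A', a] = Some (d, [a])"
  "contract e c CSigma pre u = None" "contract e c CIndSigma pre u = None" "contract e c CSum pre u = None"
  "contract e c CIndSum pre u = None" "contract e c CEmpty pre u = None" "contract e c CIndEmpty pre u = None"
  "contract e c CUnit pre u = None" "contract e c CIndUnit pre u = None" "contract e c CNat pre u = None"
  "contract e c CIndNat pre u = None" "contract e c CId pre u = None" "contract e c CIndId pre u = None"
  "contract e c CTrunc pre u = None" "contract e c CFunext pre u = None"
  "iota e c pre (Co c' k l, u) = contract e c c' pre u"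
  "iota e c pre (Va n, u) = None" "iota e c pre (Ty k, u) = None" "iota e c pre (Pr A B, u) = None"
  "iota e c pre (La A B, u) = None" "iota e c pre (Gl r b A, u) = None"
  by (simp_all add: contract_def iota_def)

definition wh_app :: "bool \<Rightarrow> raw \<times> raw list \<Rightarrow> raw list \<Rightarrow> (raw \<times> raw list) option" where
  "wh_app d y post = (case y of (f, v) \<Rightarrow> wh d f (v @ post))"

definition wh_Co_iota where
  "wh_Co_iota d c k l s pre y = (case y of (p, post) \<Rightarrow>
     Option.bind (wh True p []) (\<lambda>x. case iota (Co c k l) c pre x of None \<Rightarrow> Some (Co c k l, s) | Some y \<Rightarrow> wh_app d y post))"

definition wh_Co_split where
  "wh_Co_split d c k l s x = (case x of (pre, y) \<Rightarrow> wh_Co_iota d c k l s pre y)"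

definition wh_Co where
  "wh_Co d n c k l s = (case n of 0 \<Rightarrow> Some (Co c k l, s) | Suc n \<Rightarrow>
     (case split_at (Suc n) s of None \<Rightarrow> Some (Co c k l, s) | Some x \<Rightarrow> wh_Co_split d c k l s x))"

definition wh_pair :: "bool \<Rightarrow> raw \<times> raw list \<Rightarrow> (raw \<times> raw list) option" where
  "wh_pair d x = (case x of (u, v) \<Rightarrow> wh d u v)"

lemma beta_ev:
  "beta \<sigma> (La A b) (a # s) = beta (a # \<sigma>) b s"
  "beta \<sigma> (La A b) [] = mPair (inst \<sigma> 0 (La A b)) []"
  "beta \<sigma> (Va n) s = mPair (inst \<sigma> 0 (Va n)) s"
  "beta \<sigma> (Ty n) s = mPair (inst \<sigma> 0 (Ty n)) s"
  "beta \<sigma> (Pr A b) s = mPair (inst \<sigma> 0 (Pr A b)) s"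
  "beta \<sigma> (Ap A b) s = mPair (inst \<sigma> 0 (Ap A b)) s"
  "beta \<sigma> (Co c i j) s = (Co c i j, s)"
  "beta \<sigma> (Gl r b A) s = (Gl r b A, s)"
  by (simp_all add: mPair_def)

lemma wh_ev:
  "wh d (Va n) s = Some (Va n, s)" "wh d (Ty k) s = Some (Ty k, s)" "wh d (Pr A B) s = Some (Pr A B, s)"
  "wh d (Ap f a) s = wh d f (a # s)"
  "wh d (La A b) [] = Some (La A b, [])"
  "wh d (La A b) (a # s) = wh_pair d (beta [a] b s)"
  "wh_pair d (u, v) = wh d u v"
  "wh True (Gl r b A) s = wh True b s"
  "wh False (Gl r b A) s = Some (Gl r b A, s)"
  by ((subst wh.simps)?, simp add: wh_pair_def)+

lemma wh_Co_ev:
  "wh d (Co c k l) s = wh_Co d (elim_arity c) c k l s"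
  "wh_Co d 0 c k l s = Some (Co c k l, s)"
  "wh_Co d (Suc n) c k l s = (case split_at (Suc n) s of None \<Rightarrow> Some (Co c k l, s) | Some x \<Rightarrow> wh_Co_split d c k l s x)"
  "wh_Co_split d c k l s (pre, y) = wh_Co_iota d c k l s pre y"
  "wh_Co_iota d c k l s pre (p, post) = Option.bind (wh True p []) (\<lambda>x. case iota (Co c k l) c pre x of None \<Rightarrow> Some (Co c k l, s)
           | Some y \<Rightarrow> wh_app d y post)"
  "wh_app d (f, v) post = wh d f (v @ post)"
  unfolding wh_Co_def wh_Co_split_def wh_Co_iota_def wh_app_def by (subst wh.simps, simp) simp_all

lemma same_neqI: "t \<noteq> u \<Longrightarrow> same t u = False" by (simp add: same_def)

lemma same_ev:
  "same (Va n) (Va n') = (n = n')"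
  "same (Ty n) (Ty n') = (n = n')"
  "same (Pr A B) (Pr A' B') = (if same A A' then same B B' else False)"
  "same (La A B) (La A' B') = (if same A A' then same B B' else False)"
  "same (Ap A B) (Ap A' B') = (if same A A' then same B B' else False)"
  "same (Co c i j) (Co c' i' j') = (if c = c' then (if i = i' then j = j' else False) else False)"
  "same (Gl r A B) (Gl r' A' B') = (if r = r' then (if same A A' then same B B' else False) else False)"
  by (auto simp: same_def)

lemmas same_neq = raw.distinct[THEN same_neqI]
lemma same_refl: "same t t = True" by (simp add: same_def)

lemma compare_args_ev: "compare_args b s s' = (if b then (case zip_opt s s' of None \<Rightarrow> Fail | Some w \<Rightarrow> Reduce w) else Fail)"
  by (simp add: compare_args_def)

lemma compare_Gl_ev:
  "compare_Gl r b A s r' b' A' s' =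
     (if r = r' then (if same b b' then (case zip_opt s s' of None \<Rightarrow> mReduce (aps b s) (aps b' s')
         | Some w \<Rightarrow> mTry w (aps b s) (aps b' s')) else mReduce (aps b s) (aps b' s'))
      else if r < r' then mReduce (aps (Gl r b A) s) (aps b' s')
      else mReduce (aps b s) (aps (Gl r' b' A') s'))"
  by (simp add: compare_Gl_def builders split: option.split)

lemma compare_ev:
  "compare (Va n, s) (Va n', s') = compare_args (n = n') s s'"
  "compare (Va n, s) (Ty k', s') = Fail"
  "compare (Va n, s) (Pr A' B', s') = Fail"
  "compare (Va n, s) (La A' b', []) = mReduce (mAp (rshift (Suc 0) 0 (aps (Va n) s)) (Va 0)) b'"
  "compare (Va n, s) (Co c' k' l', s') = Fail"
  "compare (Va n, s) (Gl r' b' A', s') = mReduce (aps (Va n) s) (aps b' s')"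
  "compare (Ty k, s) (Va n', s') = Fail"
  "compare (Ty k, s) (Ty k', s') = compare_args (k = k') s s'"
  "compare (Ty k, s) (Pr A' B', s') = Fail"
  "compare (Ty k, s) (La A' b', []) = mReduce (mAp (rshift (Suc 0) 0 (aps (Ty k) s)) (Va 0)) b'"
  "compare (Ty k, s) (Co c' k' l', s') = Fail"
  "compare (Ty k, s) (Gl r' b' A', s') = mReduce (aps (Ty k) s) (aps b' s')"
  "compare (Pr A B, s) (Va n', s') = Fail"
  "compare (Pr A B, s) (Ty k', s') = Fail"
  "compare (Pr A B, []) (Pr A' B', []) = Reduce [(A, A'), (B, B')]"
  "compare (Pr A B, s) (La A' b', []) = mReduce (mAp (rshift (Suc 0) 0 (aps (Pr A B) s)) (Va 0)) b'"
  "compare (Pr A B, s) (Co c' k' l', s') = Fail"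
  "compare (Pr A B, s) (Gl r' b' A', s') = mReduce (aps (Pr A B) s) (aps b' s')"
  "compare (La A b, []) (Va n', s') = mReduce b (mAp (rshift (Suc 0) 0 (aps (Va n') s')) (Va 0))"
  "compare (La A b, []) (Ty k', s') = mReduce b (mAp (rshift (Suc 0) 0 (aps (Ty k') s')) (Va 0))"
  "compare (La A b, []) (Pr A' B', s') = mReduce b (mAp (rshift (Suc 0) 0 (aps (Pr A' B') s')) (Va 0))"
  "compare (La A b, []) (La A' b', []) = Reduce [(b, b')]"
  "compare (La A b, []) (Co c' k' l', s') = mReduce b (mAp (rshift (Suc 0) 0 (aps (Co c' k' l') s')) (Va 0))"
  "compare (La A b, []) (Gl r' b' A', s') = mReduce (La A b) (aps b' s')"
  "compare (Co c k l, s) (Va n', s') = Fail"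
  "compare (Co c k l, s) (Ty k', s') = Fail"
  "compare (Co c k l, s) (Pr A' B', s') = Fail"
  "compare (Co c k l, s) (La A' b', []) = mReduce (mAp (rshift (Suc 0) 0 (aps (Co c k l) s)) (Va 0)) b'"
  "compare (Co c k l, s) (Co c' k' l', s') = compare_args (c = c') s s'"
  "compare (Co c k l, s) (Gl r' b' A', s') = mReduce (aps (Co c k l) s) (aps b' s')"
  "compare (Gl r b A, s) (Va n', s') = mReduce (aps b s) (aps (Va n') s')"
  "compare (Gl r b A, s) (Ty k', s') = mReduce (aps b s) (aps (Ty k') s')"
  "compare (Gl r b A, s) (Pr A' B', s') = mReduce (aps b s) (aps (Pr A' B') s')"
  "compare (Gl r b A, s) (La A' b', s') = mReduce (aps b s) (aps (La A' b') s')"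
  "compare (Gl r b A, s) (Co c' k' l', s') = mReduce (aps b s) (aps (Co c' k' l') s')"
  "compare (Gl r b A, s) (Gl r' b' A', s') = compare_Gl r b A s r' b' A' s'"
  by (simp_all add: compare_def builders)

definition cv_step :: "comparison \<Rightarrow> raw \<times> raw \<Rightarrow> (raw \<times> raw) list \<Rightarrow> bool option" where
  "cv_step c p w = (case c of Fail \<Rightarrow> Some False | Reduce v \<Rightarrow> cv (v @ w)
     | Try v q \<Rightarrow> Option.bind (cv v) (\<lambda>b. if b then cv w else cv (q # w)))"

lemma cv_ev:
  "cv [] = Some True"
  "cv ((t, u) # w) = (if same t u then cv w else
     Option.bind (wh False t []) (\<lambda>x. Option.bind (wh False u []) (\<lambda>y. cv_step (compare x y) (t, u) w)))"
  "cv_step Fail p w = Some False"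
  "cv_step (Reduce v) p w = cv (v @ w)"
  "cv_step (Try v q) p w = Option.bind (cv v) (\<lambda>b. if b then cv w else cv (q # w))"
  by ((subst cv.simps)?, simp add: cv_step_def)+

lemma aps_ev: "aps f [] = f" "aps f (a # s) = aps (Ap f a) s" by simp_all

definition tc_fun :: "raw list \<Rightarrow> raw \<times> raw list \<Rightarrow> raw list \<Rightarrow> raw option" where
  "tc_fun \<Gamma> x s = (case x of (h, u) \<Rightarrow> (case u of _ # _ \<Rightarrow> None | [] \<Rightarrow>
         (case h of Pr A B \<Rightarrow> Option.bind (tc (Infer \<Gamma> h [])) (\<lambda>S. Option.bind (sort_of S) (\<lambda>_. tc (Spine \<Gamma> h [] s))) | _ \<Rightarrow> None)))"

lemma tc_ev:
  "tc (Infer \<Gamma> (Ap f a) s) = tc (Infer \<Gamma> f (a # s))"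
  "tc (Infer \<Gamma> (Va n) s) = (case lookup \<Gamma> n of Inl A \<Rightarrow> tc (Spine \<Gamma> (rshift (Suc n) 0 A) [] s) | Inr _ \<Rightarrow> None)"
  "tc (Infer \<Gamma> (Ty i) []) = mSome (mTy (Suc i))"
  "tc (Infer \<Gamma> (Pr A B) []) =
         Option.bind (tc (Infer \<Gamma> A [])) (\<lambda>S. Option.bind (sort_of S) (\<lambda>i.
         Option.bind (tc (Infer (A # \<Gamma>) B [])) (\<lambda>S'. Option.bind (sort_of S') (\<lambda>j.
           mSome (mTy (max i j))))))"
  "tc (Infer \<Gamma> (La A b) s) =
         Option.bind (tc (Infer \<Gamma> A [])) (\<lambda>S. Option.bind (sort_of S) (\<lambda>i.
         Option.bind (tc (Infer (A # \<Gamma>) b [])) (\<lambda>B. tc (Spine \<Gamma> (Pr A B) [] s))))"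
  "tc (Infer \<Gamma> (Co c i j) s) = tc (Spine \<Gamma> (cty c i j) [] s)"
  "tc (Infer \<Gamma> (Gl r b A) s) = tc (Spine \<Gamma> A [] s)"
  "tc (Spine \<Gamma> T \<sigma> []) = mSome (inst_0 \<sigma> T)"
  "tc (Spine \<Gamma> (Pr A B) \<sigma> (a # s)) = Option.bind (tc (Infer \<Gamma> a [])) (\<lambda>A'. Option.bind (subtype A' (inst_0 \<sigma> A)) (\<lambda>b.
         if b then tc (Spine \<Gamma> B (a # \<sigma>) s) else None))"
  "tc (Spine \<Gamma> (Va n) \<sigma> (a # s)) = Option.bind (wh True (inst_0 \<sigma> (Va n)) []) (\<lambda>x. tc_fun \<Gamma> x (a # s))"
  "tc (Spine \<Gamma> (Ap f b) \<sigma> (a # s)) = Option.bind (wh True (inst_0 \<sigma> (Ap f b)) []) (\<lambda>x. tc_fun \<Gamma> x (a # s))"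
  "tc (Spine \<Gamma> (Gl r b A) \<sigma> (a # s)) = Option.bind (wh True (inst_0 \<sigma> (Gl r b A)) []) (\<lambda>x. tc_fun \<Gamma> x (a # s))"
  "tc_fun \<Gamma> (Pr A B, []) s = Option.bind (tc (Infer \<Gamma> (Pr A B) [])) (\<lambda>S. Option.bind (sort_of S) (\<lambda>_. tc (Spine \<Gamma> (Pr A B) [] s)))"
  unfolding builders by ((subst tc.simps)?, simp add: tc_fun_def cong: list.case_cong)+

lemma Let_ev: "Let a f = f a" by simp

lemmas hoas = rvar_def rPI_def rLAM_def rAPP_def rCST_def rTY_def rArr_def gl_def rclosed_def diff_Suc_Suc minus_nat.diff_0 Let_ev
lemmas cty_ev = cty.simps[unfolded hoas]

lemmas num_ev = numeral_eq_iff numeral_less_iff num.distinct num.inject less_num_simps le_num_simps simp_thms(6) not_True_eq_False not_False_eq_True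

definition sort_nf where
  "sort_nf x = (case x of (h, s) \<Rightarrow> (case s of [] \<Rightarrow> (case h of Ty k \<Rightarrow> Some k | _ \<Rightarrow> None) | _ # _ \<Rightarrow> None))"

lemma sort_ev:
  "sort_of (Ty k) = Some k"
  "sort_of (Ap f a) = Option.bind (wh True (Ap f a) []) sort_nf"
  "sort_of (Gl r b A) = Option.bind (wh True (Gl r b A) []) sort_nf"
  "sort_nf (Ty k, []) = Some k"
  "subtype (Ty k) (Ty l) = mSome (k \<le> l)"
  "subtype (Ty k) (Ap f a) = cv [(Ty k, Ap f a)]"
  "subtype (Ty k) (Gl r b B) = cv [(Ty k, Gl r b B)]"
  "subtype (Va n) B = cv [(Va n, B)]"
  "subtype (Ap f a) B = cv [(Ap f a, B)]"
  "subtype (Pr f a) B = cv [(Pr f a, B)]"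
  "subtype (Co c k l) B = cv [(Co c k l, B)]"
  "subtype (Gl r b A) B = cv [(Gl r b A, B)]"
  by (simp_all add: sort_of_def subtype_def sort_nf_def[abs_def] builders)

lemma check_ev: "check \<Gamma> b A = Option.bind (tc (Infer \<Gamma> A [])) (\<lambda>S. Option.bind (sort_of S) (\<lambda>i.
     Option.bind (tc (Infer \<Gamma> b [])) (\<lambda>A'. cv [(A', A)])))"
  by (simp add: check_def)

lemma bind_ev: "Option.bind None f = None" "Option.bind (Some x) f = f x" by simp_all

named_theorems ev
lemmas [ev] = build nat_ev bool_ev append_ev rshift_ev inst_ev nat_list_ev contract_ev wh_ev beta_ev wh_Co_ev elim_arity.simps same_ev same_neq compare_args_ev compare_Gl_ev compare_ev
  cv_ev aps_ev tc_ev sort_ev cty_ev num_ev bind_ev option.case sum.case same_refl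
  check_ev ok_simps simp_thms(21)

lemmas ok_ev = ok_simps simp_thms(21)

lemmas tm_defs = closed_tm_def PI_def LAM_def APP_def CST_def UU_def bvar_def Arrow_def SIG_def
      PAIR_def Prod_def Sum_def EQ_def rfl_def Trunc_def is_prop_def is_equiv_def happly_def Let_def

named_theorems oks

text \<open>Level 0 is the universe of \<open>X\<close>. Level \<open>Suc 0\<close> is needed for
  types that quantify over families, such as \<open>fin_sum\<close>, and for motives whose values
  are types, as in the recursion that defines \<open>fin\<close>.\<close>

lemma type_formers_ok [oks]:
  "ok i (Co CSigma 0 0)" "ok i (Co CSigma (Suc 0) 0)" "ok i (Co CSum 0 0)" "ok i (Co CEmpty 0 0)" "ok i (Co CUnit 0 0)"
  "ok i (Co CNat 0 0)" "ok i (Co CId 0 0)" "ok i (Co CTrunc 0 0)"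
  by (rule ok_CoI, simp add: hoas tm_defs, simp only: cty_ev ok_ev oks cong: congs, simp only: ev cong: congs)+

lemma constructors_ok [oks]:
  "ok i (Co CPair 0 0)" "ok i (Co CPair (Suc 0) 0)" "ok i (Co CInl 0 0)" "ok i (Co CInr 0 0)" "ok i (Co CStar 0 0)"
  "ok i (Co CZero 0 0)" "ok i (Co CSucc 0 0)" "ok i (Co CRefl 0 0)" "ok i (Co CTr 0 0)"
  by (rule ok_CoI, simp add: hoas tm_defs, simp only: cty_ev ok_ev oks cong: congs, simp only: ev cong: congs)+

lemma eliminators_ok [oks]:
  "ok i (Co CIndSigma 0 0)" "ok i (Co CIndSigma (Suc 0) 0)" "ok i (Co CIndSigma (Suc 0) (Suc 0))"
  "ok i (Co CIndSum 0 0)" "ok i (Co CIndSum 0 (Suc 0))" "ok i (Co CIndEmpty 0 0)" "ok i (Co CIndUnit 0 0)"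
  "ok i (Co CIndNat 0 0)" "ok i (Co CIndNat 0 (Suc 0))" "ok i (Co CIndId 0 0)" "ok i (Co CIndId 0 (Suc 0))"
  by (rule ok_CoI, simp add: hoas tm_defs, simp only: cty_ev ok_ev oks cong: congs, simp only: ev cong: congs)+

lemma funext_constant_ok [oks]: "ok i (Co CFunext 0 0)"
  by (rule ok_CoI, simp add: hoas tm_defs, simp only: cty_ev ok_ev oks cong: congs, simp only: ev cong: congs)

section \<open>Declarations\<close>

text \<open>
  A declaration is a pair of a type and a term, both closed. The parameters bound by \<open>\<Xi>\<close> are
  abstracted in the term and quantified in the type. \<open>glob r d\<close> is the name of rank \<open>r\<close> of the
  declared term.
\<close>

definition bind :: "rex \<Rightarrow> (rex \<Rightarrow> rex \<times> rex) \<Rightarrow> rex \<times> rex" where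
  "bind A f = (rPI A (\<lambda>x. fst (f x)), rLAM A (\<lambda>x. snd (f x)))"

definition has :: "rex \<Rightarrow> rex \<Rightarrow> rex \<times> rex" where
  "has A a = (A, a)"

syntax
  "_bind" :: "pttrn \<Rightarrow> rex \<Rightarrow> rex \<times> rex \<Rightarrow> rex \<times> rex"  ("(3\<Xi> _ : _./ _)" [0, 0, 10] 10)
translations
  "\<Xi> x : A. B" \<rightleftharpoons> "CONST bind A (\<lambda>x. B)"

notation has ("(_ \<ni>:/ _)" [12, 10] 10)

definition tyof :: "rex \<times> rex \<Rightarrow> raw" where "tyof d = rclosed (fst d)"
definition tmof :: "rex \<times> rex \<Rightarrow> raw" where "tmof d = rclosed (snd d)"

lemma declared: "d = D \<Longrightarrow> tyof d = rclosed (fst D) \<and> tmof d = rclosed (snd D)"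
  by (simp add: tyof_def tmof_def)

lemma fst_bind: "fst (bind A f) = rPI A (\<lambda>x. fst (f x))" by (simp add: bind_def)
lemma snd_bind: "snd (bind A f) = rLAM A (\<lambda>x. snd (f x))" by (simp add: bind_def)
lemma fst_has: "fst (has A a) = A" by (simp add: has_def)
lemma snd_has: "snd (has A a) = a" by (simp add: has_def)

lemmas defn = fst_bind snd_bind fst_has snd_has hoas

abbreviation (input) glob :: "nat \<Rightarrow> rex \<times> rex \<Rightarrow> rex" where
  "glob r d \<equiv> gl r (tmof d) (tyof d)"

abbreviation (input) ok_glob :: "nat \<Rightarrow> nat \<Rightarrow> rex \<times> rex \<Rightarrow> bool" where
  "ok_glob i r d \<equiv> ok i (Gl r (tmof d) (tyof d))"

section \<open>Paths and sets\<close>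

abbreviation (input) "TY \<equiv> rTY 0"
abbreviation (input) "TY1 \<equiv> rTY (Suc 0)"
abbreviation (input) "kon \<equiv> rCST 0 0"

abbreviation (input) idt :: "rex \<Rightarrow> rex \<Rightarrow> rex \<Rightarrow> rex"  ("(_ \<sim>\<^bsub>_\<^esub> _)" [70, 0, 70] 57) where
  "x \<sim>\<^bsub>A\<^esub> y \<equiv> kon CId $ A $ x $ y"
abbreviation (input) "rf A x \<equiv> kon CRefl $ A $ x"
abbreviation (input) "J A C c x y p \<equiv> kon CIndId $ A $ C $ c $ x $ y $ p"
abbreviation (input) "J1 A C c x y p \<equiv> rCST 0 (Suc 0) CIndId $ A $ C $ c $ x $ y $ p"

abbreviation (input) sg :: "rex \<Rightarrow> (rex \<Rightarrow> rex) \<Rightarrow> rex" where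
  "sg A B \<equiv> kon CSigma $ A $ rLAM A B"
syntax
  "_sg" :: "pttrn \<Rightarrow> rex \<Rightarrow> rex \<Rightarrow> rex"  ("(3\<^bold>\<Sigma> _ : _./ _)" [0, 0, 10] 10)
translations
  "\<^bold>\<Sigma> x : A. B" \<rightharpoonup> "CONST sg A (\<lambda>x. B)"
abbreviation (input) tprod :: "rex \<Rightarrow> rex \<Rightarrow> rex"  (infixr "\<^bold>\<times>" 65) where
  "A \<^bold>\<times> B \<equiv> sg A (\<lambda>_. B)"
abbreviation (input) "pair A B a b \<equiv> kon CPair $ A $ rLAM A B $ a $ b"
abbreviation (input) "indS A B C g p \<equiv> kon CIndSigma $ A $ rLAM A B $ C $ g $ p"
abbreviation (input) "indU C c p \<equiv> kon CIndUnit $ C $ c $ p"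
abbreviation (input) "indE C p \<equiv> kon CIndEmpty $ C $ p"
abbreviation (input) "indP A B C f g p \<equiv> kon CIndSum $ A $ B $ C $ f $ g $ p"
abbreviation (input) tsum :: "rex \<Rightarrow> rex \<Rightarrow> rex"  (infixr "\<^bold>+" 60) where
  "A \<^bold>+ B \<equiv> kon CSum $ A $ B"
abbreviation (input) "inl A B a \<equiv> kon CInl $ A $ B $ a"
abbreviation (input) "inr A B b \<equiv> kon CInr $ A $ B $ b"
abbreviation (input) "Nt \<equiv> kon CNat"
abbreviation (input) "Emp \<equiv> kon CEmpty"
abbreviation (input) "One \<equiv> kon CUnit"

definition proj1_d where
  "proj1_d = (\<Xi> A : TY. \<Xi> B : A \<Rrightarrow> TY. \<Xi> p : kon CSigma $ A $ B. A \<ni>: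
     kon CIndSigma $ A $ B $ (\<Lambda> q : kon CSigma $ A $ B. A) $ (\<Lambda> a : A. \<Lambda> b : B $ a. a) $ p)"
lemmas proj1_eval [ev] = proj1_d_def[THEN declared, unfolded defn]
text \<open>All declarations follow this pattern: the \<open>_eval\<close> rule exposes type and
  term, and the evaluation in the \<open>_ok\<close> rule is the entire proof of the declared
  type.\<close>

lemma proj1_ok [oks]: "ok_glob i 2 proj1_d"
  by (rule ok_GlI; simp only: ev oks cong: congs)
abbreviation (input) "p1 \<equiv> glob 2 proj1_d"

definition proj2_d where
  "proj2_d = (\<Xi> A : TY. \<Xi> B : A \<Rrightarrow> TY. \<Xi> p : kon CSigma $ A $ B. B $ (p1 $ A $ B $ p) \<ni>:
     kon CIndSigma $ A $ B $ (\<Lambda> q : kon CSigma $ A $ B. B $ (p1 $ A $ B $ q)) $ (\<Lambda> a : A. \<Lambda> b : B $ a. b) $ p)"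
lemmas proj2_eval [ev] = proj2_d_def[THEN declared, unfolded defn]
lemma proj2_ok [oks]: "ok_glob i 3 proj2_d"
  by (rule ok_GlI; simp only: ev oks cong: congs)
abbreviation (input) "p2 \<equiv> glob 3 proj2_d"

abbreviation (input) "fst' A B p \<equiv> p1 $ A $ rLAM A B $ p"
abbreviation (input) "snd' A B p \<equiv> p2 $ A $ rLAM A B $ p"

section \<open>Path algebra\<close>

definition inverse_d where
  "inverse_d = (\<Xi> A : TY. \<Xi> x : A. \<Xi> y : A. \<Xi> p : x \<sim>\<^bsub>A\<^esub> y. y \<sim>\<^bsub>A\<^esub> x \<ni>:
     J A (\<Lambda> x : A. \<Lambda> y : A. \<Lambda> p : x \<sim>\<^bsub>A\<^esub> y. y \<sim>\<^bsub>A\<^esub> x) (\<Lambda> x : A. rf A x) x y p)"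
lemmas inverse_eval [ev] = inverse_d_def[THEN declared, unfolded defn]
lemma inverse_ok [oks]: "ok_glob i 4 inverse_d"
  by (rule ok_GlI; simp only: ev oks cong: congs)
abbreviation (input) "opp A x y p \<equiv> glob 4 inverse_d $ A $ x $ y $ p"

definition concat_d where
  "concat_d = (\<Xi> A : TY. \<Xi> x : A. \<Xi> y : A. \<Xi> z : A. \<Xi> p : x \<sim>\<^bsub>A\<^esub> y. \<Xi> q : y \<sim>\<^bsub>A\<^esub> z. x \<sim>\<^bsub>A\<^esub> z \<ni>:
     J A (\<Lambda> x : A. \<Lambda> y : A. \<Lambda> p : x \<sim>\<^bsub>A\<^esub> y. \<^bold>\<Pi> z : A. y \<sim>\<^bsub>A\<^esub> z \<Rrightarrow> x \<sim>\<^bsub>A\<^esub> z)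
       (\<Lambda> x : A. \<Lambda> z : A. \<Lambda> q : x \<sim>\<^bsub>A\<^esub> z. q) x y p $ z $ q)"
lemmas concat_eval [ev] = concat_d_def[THEN declared, unfolded defn]
lemma concat_ok [oks]: "ok_glob i 5 concat_d"
  by (rule ok_GlI; simp only: ev oks cong: congs)
abbreviation (input) "cat A x y z p q \<equiv> glob 5 concat_d $ A $ x $ y $ z $ p $ q"

definition ap_d where
  "ap_d = (\<Xi> A : TY. \<Xi> B : TY. \<Xi> f : A \<Rrightarrow> B. \<Xi> x : A. \<Xi> y : A. \<Xi> p : x \<sim>\<^bsub>A\<^esub> y. (f $ x) \<sim>\<^bsub>B\<^esub> (f $ y) \<ni>:
     J A (\<Lambda> x : A. \<Lambda> y : A. \<Lambda> p : x \<sim>\<^bsub>A\<^esub> y. (f $ x) \<sim>\<^bsub>B\<^esub> (f $ y)) (\<Lambda> x : A. rf B (f $ x)) x y p)"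
lemmas ap_eval [ev] = ap_d_def[THEN declared, unfolded defn]
lemma ap_ok [oks]: "ok_glob i 6 ap_d"
  by (rule ok_GlI; simp only: ev oks cong: congs)
abbreviation (input) "ap A B f x y p \<equiv> glob 6 ap_d $ A $ B $ f $ x $ y $ p"

definition transport_d where
  "transport_d = (\<Xi> A : TY. \<Xi> P : A \<Rrightarrow> TY. \<Xi> x : A. \<Xi> y : A. \<Xi> p : x \<sim>\<^bsub>A\<^esub> y. P $ x \<Rrightarrow> P $ y \<ni>:
     J A (\<Lambda> x : A. \<Lambda> y : A. \<Lambda> p : x \<sim>\<^bsub>A\<^esub> y. P $ x \<Rrightarrow> P $ y) (\<Lambda> x : A. \<Lambda> u : P $ x. u) x y p)"
lemmas transport_eval [ev] = transport_d_def[THEN declared, unfolded defn]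
lemma transport_ok [oks]: "ok_glob i 7 transport_d"
  by (rule ok_GlI; simp only: ev oks cong: congs)
abbreviation (input) "tr A P x y p u \<equiv> glob 7 transport_d $ A $ P $ x $ y $ p $ u"

text \<open>Path induction with fixed right endpoint, from the rule with both endpoints free: the
  motive is generalized over \<open>C\<close> and thereby moves up one universe, whence
  \<open>J1\<close>.\<close>

definition path_ind_left_d where
  "path_ind_left_d = (\<Xi> A : TY. \<Xi> a : A. \<Xi> C : (\<^bold>\<Pi> x : A. x \<sim>\<^bsub>A\<^esub> a \<Rrightarrow> TY). \<Xi> c : C $ a $ rf A a. \<Xi> x : A. \<Xi> p : x \<sim>\<^bsub>A\<^esub> a. C $ x $ p \<ni>:
     J1 A (\<Lambda> x : A. \<Lambda> y : A. \<Lambda> p : x \<sim>\<^bsub>A\<^esub> y. \<^bold>\<Pi> C : (\<^bold>\<Pi> z : A. z \<sim>\<^bsub>A\<^esub> y \<Rrightarrow> TY). C $ y $ rf A y \<Rrightarrow> C $ x $ p)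
       (\<Lambda> x : A. \<Lambda> C : (\<^bold>\<Pi> z : A. z \<sim>\<^bsub>A\<^esub> x \<Rrightarrow> TY). \<Lambda> c : C $ x $ rf A x. c) x a p $ C $ c)"
lemmas path_ind_left_eval [ev] = path_ind_left_d_def[THEN declared, unfolded defn]
lemma path_ind_left_ok [oks]: "ok_glob i 8 path_ind_left_d"
  by (rule ok_GlI; simp only: ev oks cong: congs)
abbreviation (input) "path_ind_left A a C c x p \<equiv> glob 8 path_ind_left_d $ A $ a $ C $ c $ x $ p"

section \<open>Propositions, sets and 1-types\<close>

definition isprop_d where
  "isprop_d = (\<Xi> A : TY. TY \<ni>: \<^bold>\<Pi> x : A. \<^bold>\<Pi> y : A. x \<sim>\<^bsub>A\<^esub> y)"
lemmas isprop_eval [ev] = isprop_d_def[THEN declared, unfolded defn]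
lemma isprop_ok [oks]: "ok_glob i 9 isprop_d"
  by (rule ok_GlI; simp only: ev oks cong: congs)
abbreviation (input) "isprop A \<equiv> glob 9 isprop_d $ A"
definition isset_d where
  "isset_d = (\<Xi> A : TY. TY \<ni>: \<^bold>\<Pi> x : A. \<^bold>\<Pi> y : A. \<^bold>\<Pi> p : x \<sim>\<^bsub>A\<^esub> y. \<^bold>\<Pi> q : x \<sim>\<^bsub>A\<^esub> y. p \<sim>\<^bsub>(x \<sim>\<^bsub>A\<^esub> y)\<^esub> q)"
lemmas isset_eval [ev] = isset_d_def[THEN declared, unfolded defn]
lemma isset_ok [oks]: "ok_glob i 10 isset_d"
  by (rule ok_GlI; simp only: ev oks cong: congs)
abbreviation (input) "isset A \<equiv> glob 10 isset_d $ A"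
definition isonetype_d where
  "isonetype_d = (\<Xi> A : TY. TY \<ni>: \<^bold>\<Pi> x : A. \<^bold>\<Pi> y : A. isset (x \<sim>\<^bsub>A\<^esub> y))"
lemmas isonetype_eval [ev] = isonetype_d_def[THEN declared, unfolded defn]
lemma isonetype_ok [oks]: "ok_glob i 11 isonetype_d"
  by (rule ok_GlI; simp only: ev oks cong: congs)
abbreviation (input) "isone A \<equiv> glob 11 isonetype_d $ A"
definition iscontr_d where
  "iscontr_d = (\<Xi> A : TY. TY \<ni>: \<^bold>\<Sigma> x : A. \<^bold>\<Pi> y : A. x \<sim>\<^bsub>A\<^esub> y)"
lemmas iscontr_eval [ev] = iscontr_d_def[THEN declared, unfolded defn]
lemma iscontr_ok [oks]: "ok_glob i 12 iscontr_d"
  by (rule ok_GlI; simp only: ev oks cong: congs)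
abbreviation (input) "iscontr A \<equiv> glob 12 iscontr_d $ A"

definition concat_inverse_d where
  "concat_inverse_d = (\<Xi> A : TY. \<Xi> x : A. \<Xi> y : A. \<Xi> p : x \<sim>\<^bsub>A\<^esub> y. rf A y \<sim>\<^bsub>(y \<sim>\<^bsub>A\<^esub> y)\<^esub> cat A y x y (opp A x y p) p \<ni>:
     J A (\<Lambda> x : A. \<Lambda> y : A. \<Lambda> p : x \<sim>\<^bsub>A\<^esub> y. rf A y \<sim>\<^bsub>(y \<sim>\<^bsub>A\<^esub> y)\<^esub> cat A y x y (opp A x y p) p) (\<Lambda> x : A. rf (x \<sim>\<^bsub>A\<^esub> x) (rf A x)) x y p)"
lemmas concat_inverse_eval [ev] = concat_inverse_d_def[THEN declared, unfolded defn]
lemma concat_inverse_ok [oks]: "ok_glob i 13 concat_inverse_d"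
  by (rule ok_GlI; simp only: ev oks cong: congs)
abbreviation (input) "catinv A x y p \<equiv> glob 13 concat_inverse_d $ A $ x $ y $ p"

text \<open>A path is recovered from its image in \<open>R\<close>, so identity types are retracts of the propositions \<open>R x y\<close>.\<close>

definition relation_key_d where
  "relation_key_d = (\<Xi> A : TY. \<Xi> R : A \<Rrightarrow> A \<Rrightarrow> TY. \<Xi> r : (\<^bold>\<Pi> x : A. R $ x $ x).
     \<Xi> f : (\<^bold>\<Pi> x : A. \<^bold>\<Pi> y : A. R $ x $ y \<Rrightarrow> x \<sim>\<^bsub>A\<^esub> y). \<Xi> x : A. \<Xi> y : A. \<Xi> p : x \<sim>\<^bsub>A\<^esub> y.
     let G = \<lambda>x y p. cat A x x y (opp A x x (f $ x $ x $ (r $ x))) (f $ x $ y $ tr A (R $ x) x y p (r $ x)) in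
     (p \<sim>\<^bsub>(x \<sim>\<^bsub>A\<^esub> y)\<^esub> G x y p \<ni>:
       J A (\<Lambda> x : A. \<Lambda> y : A. \<Lambda> p : x \<sim>\<^bsub>A\<^esub> y. p \<sim>\<^bsub>(x \<sim>\<^bsub>A\<^esub> y)\<^esub> G x y p)
         (\<Lambda> x : A. catinv A x x (f $ x $ x $ (r $ x))) x y p))"
lemmas relation_key_eval [ev] = relation_key_d_def[THEN declared, unfolded defn]
lemma relation_key_ok [oks]: "ok_glob i 14 relation_key_d"
  by (rule ok_GlI; simp only: ev oks cong: congs)
abbreviation (input) "relation_key A R r f x y p \<equiv> glob 14 relation_key_d $ A $ R $ r $ f $ x $ y $ p"

text \<open>Both \<open>p\<close> and \<open>q\<close> are values of \<open>G\<close>, at elements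
  of the proposition \<open>R x y\<close>, and these elements are equal. The criterion replaces a
  separate encode-decode argument for each type former below.\<close>

definition relation_set_d where
  "relation_set_d = (\<Xi> A : TY. \<Xi> R : A \<Rrightarrow> A \<Rrightarrow> TY. \<Xi> h : (\<^bold>\<Pi> x : A. \<^bold>\<Pi> y : A. isprop (R $ x $ y)). \<Xi> r : (\<^bold>\<Pi> x : A. R $ x $ x).
     \<Xi> f : (\<^bold>\<Pi> x : A. \<^bold>\<Pi> y : A. R $ x $ y \<Rrightarrow> x \<sim>\<^bsub>A\<^esub> y).
     isset A \<ni>: \<Lambda> x : A. \<Lambda> y : A. \<Lambda> p : x \<sim>\<^bsub>A\<^esub> y. \<Lambda> q : x \<sim>\<^bsub>A\<^esub> y.
       let P = x \<sim>\<^bsub>A\<^esub> y; T = R $ x $ y; K = \<lambda>p. tr A (R $ x) x y p (r $ x);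
           G = \<lambda>u. cat A x x y (opp A x x (f $ x $ x $ (r $ x))) (f $ x $ y $ u) in
       cat P p (G (K p)) q (relation_key A R r f x y p)
        (cat P (G (K p)) (G (K q)) q (ap T P (\<Lambda> u : T. G u) (K p) (K q) (h $ x $ y $ K p $ K q))
          (opp P q (G (K q)) (relation_key A R r f x y q))))"
lemmas relation_set_eval [ev] = relation_set_d_def[THEN declared, unfolded defn]
lemma relation_set_ok [oks]: "ok_glob i 15 relation_set_d"
  by (rule ok_GlI; simp only: ev oks cong: congs)
abbreviation (input) "relation_set A R h r f \<equiv> glob 15 relation_set_d $ A $ R $ h $ r $ f"

section \<open>Function extensionality and its inverse laws\<close>

definition happly_d where
  "happly_d = (\<Xi> A : TY. \<Xi> B : A \<Rrightarrow> TY. \<Xi> f : (\<^bold>\<Pi> x : A. B $ x). \<Xi> g : (\<^bold>\<Pi> x : A. B $ x).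
     let P = (\<^bold>\<Pi> x : A. B $ x) in \<Xi> p : f \<sim>\<^bsub>P\<^esub> g. (\<^bold>\<Pi> x : A. (f $ x) \<sim>\<^bsub>(B $ x)\<^esub> (g $ x)) \<ni>:
       J P (\<Lambda> f : P. \<Lambda> g : P. \<Lambda> p : f \<sim>\<^bsub>P\<^esub> g. \<^bold>\<Pi> x : A. (f $ x) \<sim>\<^bsub>(B $ x)\<^esub> (g $ x))
         (\<Lambda> f : P. \<Lambda> x : A. rf (B $ x) (f $ x)) f g p)"
lemmas happly_eval [ev] = happly_d_def[THEN declared, unfolded defn]
lemma happly_ok [oks]: "ok_glob i 16 happly_d"
  by (rule ok_GlI; simp only: ev oks cong: congs)
abbreviation (input) "hap A B f g p \<equiv> glob 16 happly_d $ A $ B $ f $ g $ p"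

abbreviation (input) "finv A B f g \<equiv> \<lambda>h. (\<^bold>\<Pi> y : (\<^bold>\<Pi> x : A. (f $ x) \<sim>\<^bsub>(B $ x)\<^esub> (g $ x)).
     (hap A B f g (h $ y)) \<sim>\<^bsub>(\<^bold>\<Pi> x : A. (f $ x) \<sim>\<^bsub>(B $ x)\<^esub> (g $ x))\<^esub> y)"
abbreviation (input) "finv' A B f g \<equiv> \<lambda>h. (\<^bold>\<Pi> p : f \<sim>\<^bsub>(\<^bold>\<Pi> x : A. B $ x)\<^esub> g.
     (h $ (hap A B f g p)) \<sim>\<^bsub>(f \<sim>\<^bsub>(\<^bold>\<Pi> x : A. B $ x)\<^esub> g)\<^esub> p)"

definition funext_equiv_d where
  "funext_equiv_d = (\<Xi> A : TY. \<Xi> B : A \<Rrightarrow> TY. \<Xi> f : (\<^bold>\<Pi> x : A. B $ x). \<Xi> g : (\<^bold>\<Pi> x : A. B $ x).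
     let M = (\<^bold>\<Pi> x : A. (f $ x) \<sim>\<^bsub>(B $ x)\<^esub> (g $ x)) \<Rrightarrow> f \<sim>\<^bsub>(\<^bold>\<Pi> x : A. B $ x)\<^esub> g in
     (sg M (finv A B f g) \<^bold>\<times> sg M (finv' A B f g) \<ni>: kon CFunext $ A $ B $ f $ g))"
lemmas funext_equiv_eval [ev] = funext_equiv_d_def[THEN declared, unfolded defn]
lemma funext_equiv_ok [oks]: "ok_glob i 17 funext_equiv_d"
  by (rule ok_GlI; simp only: ev oks cong: congs)

definition funext_right_d where
  "funext_right_d = (\<Xi> A : TY. \<Xi> B : A \<Rrightarrow> TY. \<Xi> f : (\<^bold>\<Pi> x : A. B $ x). \<Xi> g : (\<^bold>\<Pi> x : A. B $ x).
     let M = (\<^bold>\<Pi> x : A. (f $ x) \<sim>\<^bsub>(B $ x)\<^esub> (g $ x)) \<Rrightarrow> f \<sim>\<^bsub>(\<^bold>\<Pi> x : A. B $ x)\<^esub> g in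
     (sg M (finv A B f g) \<ni>: fst' (sg M (finv A B f g)) (\<lambda>_. sg M (finv' A B f g)) (glob 17 funext_equiv_d $ A $ B $ f $ g)))"
lemmas funext_right_eval [ev] = funext_right_d_def[THEN declared, unfolded defn]
lemma funext_right_ok [oks]: "ok_glob i 18 funext_right_d"
  by (rule ok_GlI; simp only: ev oks cong: congs)
definition funext_left_d where
  "funext_left_d = (\<Xi> A : TY. \<Xi> B : A \<Rrightarrow> TY. \<Xi> f : (\<^bold>\<Pi> x : A. B $ x). \<Xi> g : (\<^bold>\<Pi> x : A. B $ x).
     let M = (\<^bold>\<Pi> x : A. (f $ x) \<sim>\<^bsub>(B $ x)\<^esub> (g $ x)) \<Rrightarrow> f \<sim>\<^bsub>(\<^bold>\<Pi> x : A. B $ x)\<^esub> g in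
     (sg M (finv' A B f g) \<ni>: snd' (sg M (finv A B f g)) (\<lambda>_. sg M (finv' A B f g)) (glob 17 funext_equiv_d $ A $ B $ f $ g)))"
lemmas funext_left_eval [ev] = funext_left_d_def[THEN declared, unfolded defn]
lemma funext_left_ok [oks]: "ok_glob i 19 funext_left_d"
  by (rule ok_GlI; simp only: ev oks cong: congs)

definition funext_d where
  "funext_d = (\<Xi> A : TY. \<Xi> B : A \<Rrightarrow> TY. \<Xi> f : (\<^bold>\<Pi> x : A. B $ x). \<Xi> g : (\<^bold>\<Pi> x : A. B $ x).
     let M = (\<^bold>\<Pi> x : A. (f $ x) \<sim>\<^bsub>(B $ x)\<^esub> (g $ x)) \<Rrightarrow> f \<sim>\<^bsub>(\<^bold>\<Pi> x : A. B $ x)\<^esub> g in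
     (M \<ni>: fst' M (finv A B f g) (glob 18 funext_right_d $ A $ B $ f $ g)))"
lemmas funext_eval [ev] = funext_d_def[THEN declared, unfolded defn]
lemma funext_ok [oks]: "ok_glob i 20 funext_d"
  by (rule ok_GlI; simp only: ev oks cong: congs)
abbreviation (input) "funext A B f g h \<equiv> glob 20 funext_d $ A $ B $ f $ g $ h"

definition funext_sec_d where
  "funext_sec_d = (\<Xi> A : TY. \<Xi> B : A \<Rrightarrow> TY. \<Xi> f : (\<^bold>\<Pi> x : A. B $ x). \<Xi> g : (\<^bold>\<Pi> x : A. B $ x).
     let M = (\<^bold>\<Pi> x : A. (f $ x) \<sim>\<^bsub>(B $ x)\<^esub> (g $ x)) \<Rrightarrow> f \<sim>\<^bsub>(\<^bold>\<Pi> x : A. B $ x)\<^esub> g in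
     \<Xi> h : (\<^bold>\<Pi> x : A. (f $ x) \<sim>\<^bsub>(B $ x)\<^esub> (g $ x)).
     hap A B f g (funext A B f g h) \<sim>\<^bsub>(\<^bold>\<Pi> x : A. (f $ x) \<sim>\<^bsub>(B $ x)\<^esub> (g $ x))\<^esub> h \<ni>:
       snd' M (finv A B f g) (glob 18 funext_right_d $ A $ B $ f $ g) $ h)"
lemmas funext_sec_eval [ev] = funext_sec_d_def[THEN declared, unfolded defn]
lemma funext_sec_ok [oks]: "ok_glob i 21 funext_sec_d"
  by (rule ok_GlI; simp only: ev oks cong: congs)
abbreviation (input) "funext_sec A B f g h \<equiv> glob 21 funext_sec_d $ A $ B $ f $ g $ h"

text \<open>The axiom gives a left and a right inverse of \<open>happly\<close>; \<open>funext\<close> is the right inverse.\<close>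

definition funext_ret_d where
  "funext_ret_d = (\<Xi> A : TY. \<Xi> B : A \<Rrightarrow> TY. \<Xi> f : (\<^bold>\<Pi> x : A. B $ x). \<Xi> g : (\<^bold>\<Pi> x : A. B $ x).
     let E = f \<sim>\<^bsub>(\<^bold>\<Pi> x : A. B $ x)\<^esub> g; F = (\<^bold>\<Pi> x : A. (f $ x) \<sim>\<^bsub>(B $ x)\<^esub> (g $ x)); M = F \<Rrightarrow> E;
       h = fst' M (finv' A B f g) (glob 19 funext_left_d $ A $ B $ f $ g);
       r = snd' M (finv' A B f g) (glob 19 funext_left_d $ A $ B $ f $ g) in
     \<Xi> p : E.
     let y = hap A B f g p; q = funext A B f g y; z = hap A B f g q in
     (q \<sim>\<^bsub>E\<^esub> p \<ni>:
       cat E q (h $ z) p (opp E (h $ z) q (r $ q))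
        (cat E (h $ z) (h $ y) p (ap F E h z y (funext_sec A B f g y)) (r $ p))))"
lemmas funext_ret_eval [ev] = funext_ret_d_def[THEN declared, unfolded defn]
lemma funext_ret_ok [oks]: "ok_glob i 22 funext_ret_d"
  by (rule ok_GlI; simp only: ev oks cong: congs)
abbreviation (input) "funext_ret A B f g p \<equiv> glob 22 funext_ret_d $ A $ B $ f $ g $ p"

section \<open>Sets and their closure under type formers\<close>

definition empty_set_d where
  "empty_set_d = (isset Emp \<ni>: \<Lambda> x : Emp. indE (\<Lambda> x : Emp. \<^bold>\<Pi> y : Emp. \<^bold>\<Pi> p : x \<sim>\<^bsub>Emp\<^esub> y. \<^bold>\<Pi> q : x \<sim>\<^bsub>Emp\<^esub> y. p \<sim>\<^bsub>(x \<sim>\<^bsub>Emp\<^esub> y)\<^esub> q) x)"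
lemmas empty_set_eval [ev] = empty_set_d_def[THEN declared, unfolded defn]
lemma empty_set_ok [oks]: "ok_glob i 23 empty_set_d"
  by (rule ok_GlI; simp only: ev oks cong: congs)

definition unit_prop_d where
  "unit_prop_d = (isprop One \<ni>: \<Lambda> x : One. indU (\<Lambda> x : One. \<^bold>\<Pi> y : One. x \<sim>\<^bsub>One\<^esub> y)
     (\<Lambda> y : One. indU (\<Lambda> y : One. kon CStar \<sim>\<^bsub>One\<^esub> y) (rf One (kon CStar)) y) x)"
lemmas unit_prop_eval [ev] = unit_prop_d_def[THEN declared, unfolded defn]
lemma unit_prop_ok [oks]: "ok_glob i 24 unit_prop_d"
  by (rule ok_GlI; simp only: ev oks cong: congs)

definition unit_set_d where
  "unit_set_d = (isset One \<ni>: relation_set One (\<Lambda> x : One. \<Lambda> y : One. One) (\<Lambda> x : One. \<Lambda> y : One. glob 24 unit_prop_d)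
     (\<Lambda> x : One. x) (\<Lambda> x : One. \<Lambda> y : One. \<Lambda> r : One. glob 24 unit_prop_d $ x $ y))"
lemmas unit_set_eval [ev] = unit_set_d_def[THEN declared, unfolded defn]
lemma unit_set_ok [oks]: "ok_glob i 25 unit_set_d"
  by (rule ok_GlI; simp only: ev oks cong: congs)

text \<open>The code of the identity types of a sum: identity within a summand and the empty type
  across. Since its values are types, the eliminations have motives of level
  \<open>Suc 0\<close>.\<close>

definition sum_relation_d where
  "sum_relation_d = (\<Xi> A : TY. \<Xi> B : TY. \<Xi> u : A \<^bold>+ B. \<Xi> v : A \<^bold>+ B. TY \<ni>:
     rCST 0 (Suc 0) CIndSum $ A $ B $ (\<Lambda> u : A \<^bold>+ B. TY)
       $ (\<Lambda> a : A. rCST 0 (Suc 0) CIndSum $ A $ B $ (\<Lambda> u : A \<^bold>+ B. TY) $ (\<Lambda> a' : A. a \<sim>\<^bsub>A\<^esub> a') $ (\<Lambda> b' : B. Emp) $ v)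
       $ (\<Lambda> b : B. rCST 0 (Suc 0) CIndSum $ A $ B $ (\<Lambda> u : A \<^bold>+ B. TY) $ (\<Lambda> a' : A. Emp) $ (\<Lambda> b' : B. b \<sim>\<^bsub>B\<^esub> b') $ v)
       $ u)"
lemmas sum_relation_eval [ev] = sum_relation_d_def[THEN declared, unfolded defn]
lemma sum_relation_ok [oks]: "ok_glob i 26 sum_relation_d"
  by (rule ok_GlI; simp only: ev oks cong: congs)
abbreviation (input) "sum_relation A B \<equiv> glob 26 sum_relation_d $ A $ B"

definition sum_set_d where
  "sum_set_d = (\<Xi> A : TY. \<Xi> B : TY. \<Xi> hA : isset A. \<Xi> hB : isset B.
     let S = A \<^bold>+ B; R = sum_relation A B; E = (\<Lambda> x : Emp. indE (\<Lambda> x : Emp. \<^bold>\<Pi> y : Emp. x \<sim>\<^bsub>Emp\<^esub> y) x) in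
     (isset S \<ni>: relation_set S R
      (\<Lambda> u : S. \<Lambda> v : S. indP A B (\<Lambda> u : S. isprop (R $ u $ v))
         (\<Lambda> a : A. indP A B (\<Lambda> v : S. isprop (R $ inl A B a $ v)) (\<Lambda> a' : A. hA $ a $ a') (\<Lambda> b' : B. E) v)
         (\<Lambda> b : B. indP A B (\<Lambda> v : S. isprop (R $ inr A B b $ v)) (\<Lambda> a' : A. E) (\<Lambda> b' : B. hB $ b $ b') v) u)
      (\<Lambda> u : S. indP A B (\<Lambda> u : S. R $ u $ u) (\<Lambda> a : A. rf A a) (\<Lambda> b : B. rf B b) u)
      (\<Lambda> u : S. \<Lambda> v : S. indP A B (\<Lambda> u : S. R $ u $ v \<Rrightarrow> u \<sim>\<^bsub>S\<^esub> v)
         (\<Lambda> a : A. indP A B (\<Lambda> v : S. R $ inl A B a $ v \<Rrightarrow> inl A B a \<sim>\<^bsub>S\<^esub> v)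
            (\<Lambda> a' : A. \<Lambda> p : a \<sim>\<^bsub>A\<^esub> a'. ap A S (kon CInl $ A $ B) a a' p)
            (\<Lambda> b' : B. \<Lambda> p : Emp. indE (\<Lambda> p : Emp. inl A B a \<sim>\<^bsub>S\<^esub> inr A B b') p) v)
         (\<Lambda> b : B. indP A B (\<Lambda> v : S. R $ inr A B b $ v \<Rrightarrow> inr A B b \<sim>\<^bsub>S\<^esub> v)
            (\<Lambda> a' : A. \<Lambda> p : Emp. indE (\<Lambda> p : Emp. inr A B b \<sim>\<^bsub>S\<^esub> inl A B a') p)
            (\<Lambda> b' : B. \<Lambda> p : b \<sim>\<^bsub>B\<^esub> b'. ap B S (kon CInr $ A $ B) b b' p) v) u)))"
lemmas sum_set_eval [ev] = sum_set_d_def[THEN declared, unfolded defn]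
lemma sum_set_ok [oks]: "ok_glob i 27 sum_set_d"
  by (rule ok_GlI; simp only: ev oks cong: congs)

definition fin_d where
  "fin_d = (\<Xi> n : Nt. TY \<ni>: rCST 0 (Suc 0) CIndNat $ (\<Lambda> n : Nt. TY) $ Emp $ (\<Lambda> n : Nt. \<Lambda> F : TY. F \<^bold>+ One) $ n)"
lemmas fin_eval [ev] = fin_d_def[THEN declared, unfolded defn]
lemma fin_ok [oks]: "ok_glob i 28 fin_d"
  by (rule ok_GlI; simp only: ev oks cong: congs)
abbreviation (input) "fin n \<equiv> glob 28 fin_d $ n"

definition fin_set_d where
  "fin_set_d = (\<Xi> n : Nt. isset (fin n) \<ni>: kon CIndNat $ (\<Lambda> n : Nt. isset (fin n)) $ glob 23 empty_set_d
     $ (\<Lambda> n : Nt. \<Lambda> h : isset (fin n). glob 27 sum_set_d $ fin n $ One $ h $ glob 25 unit_set_d) $ n)"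
lemmas fin_set_eval [ev] = fin_set_d_def[THEN declared, unfolded defn]
lemma fin_set_ok [oks]: "ok_glob i 29 fin_set_d"
  by (rule ok_GlI; simp only: ev oks cong: congs)

text \<open>Pointwise equality is the relation. That it is a proposition takes function
  extensionality a second time, for the family of identity types.\<close>

definition pi_set_d where
  "pi_set_d = (\<Xi> A : TY. \<Xi> B : A \<Rrightarrow> TY. \<Xi> h : (\<^bold>\<Pi> x : A. isset (B $ x)).
     let P = (\<^bold>\<Pi> x : A. B $ x); R = \<lambda>f g. (\<^bold>\<Pi> x : A. (f $ x) \<sim>\<^bsub>(B $ x)\<^esub> (g $ x)) in
     (isset P \<ni>: relation_set P (\<Lambda> f : P. \<Lambda> g : P. R f g)
       (\<Lambda> f : P. \<Lambda> g : P. \<Lambda> p : R f g. \<Lambda> q : R f g.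
          funext A (\<Lambda> x : A. (f $ x) \<sim>\<^bsub>(B $ x)\<^esub> (g $ x)) p q (\<Lambda> x : A. h $ x $ (f $ x) $ (g $ x) $ (p $ x) $ (q $ x)))
       (\<Lambda> f : P. \<Lambda> x : A. rf (B $ x) (f $ x))
       (\<Lambda> f : P. \<Lambda> g : P. \<Lambda> p : R f g. funext A B f g p)))"
lemmas pi_set_eval [ev] = pi_set_d_def[THEN declared, unfolded defn]
lemma pi_set_ok [oks]: "ok_glob i 30 pi_set_d"
  by (rule ok_GlI; simp only: ev oks cong: congs)

definition pair_path_d where
  "pair_path_d = (\<Xi> A : TY. \<Xi> B : A \<Rrightarrow> TY.
     let S = kon CSigma $ A $ B; pr = \<lambda>a b. kon CPair $ A $ B $ a $ b;
       C = \<lambda>a a' p. (\<^bold>\<Pi> b : B $ a. \<^bold>\<Pi> b' : B $ a'. tr A B a a' p b \<sim>\<^bsub>(B $ a')\<^esub> b' \<Rrightarrow> pr a b \<sim>\<^bsub>S\<^esub> pr a' b') in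
     \<Xi> a : A. \<Xi> a' : A. \<Xi> p : a \<sim>\<^bsub>A\<^esub> a'. C a a' p \<ni>:
       J A (\<Lambda> a : A. \<Lambda> a' : A. \<Lambda> p : a \<sim>\<^bsub>A\<^esub> a'. C a a' p)
         (\<Lambda> a : A. \<Lambda> b : B $ a. \<Lambda> b' : B $ a. \<Lambda> q : b \<sim>\<^bsub>(B $ a)\<^esub> b'. ap (B $ a) S (\<Lambda> b : B $ a. pr a b) b b' q) a a' p)"
lemmas pair_path_eval [ev] = pair_path_d_def[THEN declared, unfolded defn]
lemma pair_path_ok [oks]: "ok_glob i 31 pair_path_d"
  by (rule ok_GlI; simp only: ev oks cong: congs)
abbreviation (input) "pair_path A B a a' p b b' q \<equiv> glob 31 pair_path_d $ A $ B $ a $ a' $ p $ b $ b' $ q"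

definition sigma_path_d where
  "sigma_path_d = (\<Xi> A : TY. \<Xi> B : A \<Rrightarrow> TY. \<Xi> h : (\<^bold>\<Pi> x : A. isprop (B $ x)).
     let S = kon CSigma $ A $ B; pr = \<lambda>a b. kon CPair $ A $ B $ a $ b; q1 = \<lambda>u. p1 $ A $ B $ u in
     \<Xi> u : S. \<Xi> v : S. q1 u \<sim>\<^bsub>A\<^esub> q1 v \<Rrightarrow> u \<sim>\<^bsub>S\<^esub> v \<ni>:
       kon CIndSigma $ A $ B $ (\<Lambda> u : S. q1 u \<sim>\<^bsub>A\<^esub> q1 v \<Rrightarrow> u \<sim>\<^bsub>S\<^esub> v)
         $ (\<Lambda> a : A. \<Lambda> b : B $ a. kon CIndSigma $ A $ B $ (\<Lambda> v : S. a \<sim>\<^bsub>A\<^esub> q1 v \<Rrightarrow> pr a b \<sim>\<^bsub>S\<^esub> v)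
             $ (\<Lambda> a' : A. \<Lambda> b' : B $ a'. \<Lambda> p : a \<sim>\<^bsub>A\<^esub> a'. pair_path A B a a' p b b' (h $ a' $ tr A B a a' p b $ b')) $ v) $ u)"
lemmas sigma_path_eval [ev] = sigma_path_d_def[THEN declared, unfolded defn]
lemma sigma_path_ok [oks]: "ok_glob i 32 sigma_path_d"
  by (rule ok_GlI; simp only: ev oks cong: congs)
abbreviation (input) "sigma_path A B h u v p \<equiv> glob 32 sigma_path_d $ A $ B $ h $ u $ v $ p"

definition sigma_prop_d where
  "sigma_prop_d = (\<Xi> A : TY. \<Xi> B : A \<Rrightarrow> TY. \<Xi> hA : isprop A. \<Xi> hB : (\<^bold>\<Pi> x : A. isprop (B $ x)).
     let S = kon CSigma $ A $ B in
     (isprop S \<ni>: \<Lambda> u : S. \<Lambda> v : S. sigma_path A B hB u v (hA $ (p1 $ A $ B $ u) $ (p1 $ A $ B $ v))))"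
lemmas sigma_prop_eval [ev] = sigma_prop_d_def[THEN declared, unfolded defn]
lemma sigma_prop_ok [oks]: "ok_glob i 33 sigma_prop_d"
  by (rule ok_GlI; simp only: ev oks cong: congs)
abbreviation (input) "sigma_prop A B hA hB \<equiv> glob 33 sigma_prop_d $ A $ B $ hA $ hB"

text \<open>The relation consists of a path between first components and a path over it. Both parts
  are propositions when \<open>A\<close> and all \<open>B x\<close> are sets, so
  \<open>sigma_prop\<close> applies.\<close>

definition sigma_set_d where
  "sigma_set_d = (\<Xi> A : TY. \<Xi> B : A \<Rrightarrow> TY. \<Xi> hA : isset A. \<Xi> hB : (\<^bold>\<Pi> x : A. isset (B $ x)).
     let S = kon CSigma $ A $ B; q1 = \<lambda>u. p1 $ A $ B $ u; q2 = \<lambda>u. p2 $ A $ B $ u; pr = \<lambda>a b. kon CPair $ A $ B $ a $ b;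
       T = \<lambda>u v p. tr A B (q1 u) (q1 v) p (q2 u) \<sim>\<^bsub>(B $ q1 v)\<^esub> q2 v;
       R = \<lambda>u v. sg (q1 u \<sim>\<^bsub>A\<^esub> q1 v) (T u v) in
     (isset S \<ni>: relation_set S (\<Lambda> u : S. \<Lambda> v : S. R u v)
       (\<Lambda> u : S. \<Lambda> v : S. sigma_prop (q1 u \<sim>\<^bsub>A\<^esub> q1 v) (rLAM (q1 u \<sim>\<^bsub>A\<^esub> q1 v) (T u v)) (hA $ q1 u $ q1 v)
          (\<Lambda> p : q1 u \<sim>\<^bsub>A\<^esub> q1 v. hB $ q1 v $ tr A B (q1 u) (q1 v) p (q2 u) $ q2 v))
       (\<Lambda> u : S. pair (q1 u \<sim>\<^bsub>A\<^esub> q1 u) (T u u) (rf A (q1 u)) (rf (B $ q1 u) (q2 u)))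
       (\<Lambda> u : S. \<Lambda> v : S. kon CIndSigma $ A $ B $ (\<Lambda> u : S. R u v \<Rrightarrow> u \<sim>\<^bsub>S\<^esub> v)
          $ (\<Lambda> a : A. \<Lambda> b : B $ a. kon CIndSigma $ A $ B $ (\<Lambda> v : S. R (pr a b) v \<Rrightarrow> pr a b \<sim>\<^bsub>S\<^esub> v)
             $ (\<Lambda> a' : A. \<Lambda> b' : B $ a'. \<Lambda> r : R (pr a b) (pr a' b').
                  pair_path A B a a' (fst' (a \<sim>\<^bsub>A\<^esub> a') (T (pr a b) (pr a' b')) r) b b' (snd' (a \<sim>\<^bsub>A\<^esub> a') (T (pr a b) (pr a' b')) r))
             $ v) $ u)))"
lemmas sigma_set_eval [ev] = sigma_set_d_def[THEN declared, unfolded defn]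
lemma sigma_set_ok [oks]: "ok_glob i 34 sigma_set_d"
  by (rule ok_GlI; simp only: ev oks cong: congs)

definition sigma_eta_d where
  "sigma_eta_d = (\<Xi> A : TY. \<Xi> B : A \<Rrightarrow> TY.
     let S = kon CSigma $ A $ B; e = \<lambda>u. kon CPair $ A $ B $ (p1 $ A $ B $ u) $ (p2 $ A $ B $ u) in \<Xi> u : S.
       e u \<sim>\<^bsub>S\<^esub> u \<ni>: kon CIndSigma $ A $ B $ (\<Lambda> u : S. e u \<sim>\<^bsub>S\<^esub> u)
         $ (\<Lambda> a : A. \<Lambda> b : B $ a. rf S (kon CPair $ A $ B $ a $ b)) $ u)"
lemmas sigma_eta_eval [ev] = sigma_eta_d_def[THEN declared, unfolded defn]
lemma sigma_eta_ok [oks]: "ok_glob i 35 sigma_eta_d"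
  by (rule ok_GlI; simp only: ev oks cong: congs)

text \<open>Equality of images under the section \<open>s\<close> is a proposition, and applying
  \<open>r\<close> turns it into equality in \<open>A\<close>.\<close>

definition retract_set_d where
  "retract_set_d = (\<Xi> A : TY. \<Xi> B : TY. \<Xi> h : isset B. \<Xi> s : A \<Rrightarrow> B. \<Xi> r : B \<Rrightarrow> A. \<Xi> e : (\<^bold>\<Pi> x : A. (r $ (s $ x)) \<sim>\<^bsub>A\<^esub> x).
     isset A \<ni>: relation_set A (\<Lambda> x : A. \<Lambda> y : A. (s $ x) \<sim>\<^bsub>B\<^esub> (s $ y)) (\<Lambda> x : A. \<Lambda> y : A. h $ (s $ x) $ (s $ y))
       (\<Lambda> x : A. rf B (s $ x))
       (\<Lambda> x : A. \<Lambda> y : A. \<Lambda> q : (s $ x) \<sim>\<^bsub>B\<^esub> (s $ y).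
          cat A x (r $ (s $ x)) y (opp A (r $ (s $ x)) x (e $ x))
            (cat A (r $ (s $ x)) (r $ (s $ y)) y (ap B A r (s $ x) (s $ y) q) (e $ y))))"
lemmas retract_set_eval [ev] = retract_set_d_def[THEN declared, unfolded defn]
lemma retract_set_ok [oks]: "ok_glob i 36 retract_set_d"
  by (rule ok_GlI; simp only: ev oks cong: congs)

section \<open>Objects and morphisms\<close>

definition ob_d where
  "ob_d = (\<Xi> X : TY. TY \<ni>: \<^bold>\<Sigma> n : Nt. fin n \<Rrightarrow> X)"
lemmas ob_eval [ev] = ob_d_def[THEN declared, unfolded defn]
lemma ob_ok [oks]: "ok_glob i 37 ob_d"
  by (rule ok_GlI; simp only: ev oks cong: congs)
abbreviation (input) "ob X \<equiv> glob 37 ob_d $ X"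
abbreviation (input) "mk_ob X n x \<equiv> pair Nt (\<lambda>n. fin n \<Rrightarrow> X) n x"

definition num_d where
  "num_d = (\<Xi> X : TY. \<Xi> a : ob X. Nt \<ni>: fst' Nt (\<lambda>n. fin n \<Rrightarrow> X) a)"
lemmas num_eval [ev] = num_d_def[THEN declared, unfolded defn]
lemma num_ok [oks]: "ok_glob i 38 num_d"
  by (rule ok_GlI; simp only: ev oks cong: congs)
abbreviation (input) "fi X a \<equiv> fin (glob 38 num_d $ X $ a)"

definition fam_d where
  "fam_d = (\<Xi> X : TY. \<Xi> a : ob X. fi X a \<Rrightarrow> X \<ni>: snd' Nt (\<lambda>n. fin n \<Rrightarrow> X) a)"
lemmas fam_eval [ev] = fam_d_def[THEN declared, unfolded defn]
lemma fam_ok [oks]: "ok_glob i 39 fam_d"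
  by (rule ok_GlI; simp only: ev oks cong: congs)
abbreviation (input) "fam X a \<equiv> glob 39 fam_d $ X $ a"

abbreviation (input) "pth X a b f \<equiv> fam X a \<sim>\<^bsub>(fi X a \<Rrightarrow> X)\<^esub> (\<Lambda> k : fi X a. fam X b $ (f $ k))"

definition hom_d where
  "hom_d = (\<Xi> X : TY. \<Xi> a : ob X. \<Xi> b : ob X. TY \<ni>: \<^bold>\<Sigma> f : fi X a \<Rrightarrow> fi X b. pth X a b f)"
lemmas hom_eval [ev] = hom_d_def[THEN declared, unfolded defn]
lemma hom_ok [oks]: "ok_glob i 40 hom_d"
  by (rule ok_GlI; simp only: ev oks cong: congs)
abbreviation (input) "hm X a b \<equiv> glob 40 hom_d $ X $ a $ b"
abbreviation (input) "mk_hom X a b f p \<equiv> pair (fi X a \<Rrightarrow> fi X b) (pth X a b) f p"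

definition hom_fun_d where
  "hom_fun_d = (\<Xi> X : TY. \<Xi> a : ob X. \<Xi> b : ob X. \<Xi> h : hm X a b. fi X a \<Rrightarrow> fi X b \<ni>:
     fst' (fi X a \<Rrightarrow> fi X b) (pth X a b) h)"
lemmas hom_fun_eval [ev] = hom_fun_d_def[THEN declared, unfolded defn]
lemma hom_fun_ok [oks]: "ok_glob i 41 hom_fun_d"
  by (rule ok_GlI; simp only: ev oks cong: congs)
abbreviation (input) "hom_fun X a b h \<equiv> glob 41 hom_fun_d $ X $ a $ b $ h"
definition hom_path_d where
  "hom_path_d = (\<Xi> X : TY. \<Xi> a : ob X. \<Xi> b : ob X. \<Xi> h : hm X a b. pth X a b (hom_fun X a b h) \<ni>:
     snd' (fi X a \<Rrightarrow> fi X b) (pth X a b) h)"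
lemmas hom_path_eval [ev] = hom_path_d_def[THEN declared, unfolded defn]
lemma hom_path_ok [oks]: "ok_glob i 42 hom_path_d"
  by (rule ok_GlI; simp only: ev oks cong: congs)
abbreviation (input) "hom_path X a b h \<equiv> glob 42 hom_path_d $ X $ a $ b $ h"

definition ident_d where
  "ident_d = (\<Xi> X : TY. \<Xi> a : ob X. hm X a a \<ni>: mk_hom X a a (\<Lambda> k : fi X a. k) (rf (fi X a \<Rrightarrow> X) (fam X a)))"
lemmas ident_eval [ev] = ident_d_def[THEN declared, unfolded defn]
lemma ident_ok [oks]: "ok_glob i 43 ident_d"
  by (rule ok_GlI; simp only: ev oks cong: congs)
abbreviation (input) "idm X a \<equiv> glob 43 ident_d $ X $ a"

definition comp_d where
  "comp_d = (\<Xi> X : TY. \<Xi> a : ob X. \<Xi> b : ob X. \<Xi> c : ob X. \<Xi> g : hm X b c. \<Xi> f : hm X a b.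
     let f1 = hom_fun X a b f; g1 = hom_fun X b c g; P = \<lambda>a. fi X a \<Rrightarrow> X; pull = \<lambda>y. (\<Lambda> k : fi X a. y $ (f1 $ k));
       z = (\<Lambda> k : fi X b. fam X c $ (g1 $ k)) in
     hm X a c \<ni>: mk_hom X a c (\<Lambda> k : fi X a. g1 $ (f1 $ k))
       (cat (P a) (fam X a) (pull (fam X b)) (pull z) (hom_path X a b f)
         (ap (P b) (P a) (\<Lambda> y : P b. pull y) (fam X b) z (hom_path X b c g))))"
lemmas comp_eval [ev] = comp_d_def[THEN declared, unfolded defn]
lemma comp_ok [oks]: "ok_glob i 44 comp_d"
  by (rule ok_GlI; simp only: ev oks cong: congs)
abbreviation (input) "cmp X a b c g f \<equiv> glob 44 comp_d $ X $ a $ b $ c $ g $ f"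

section \<open>Morphisms as families over their index type\<close>

definition target_d where
  "target_d = (\<Xi> X : TY. \<Xi> a : ob X. \<Xi> d : ob X. \<Xi> u : fi X a. TY \<ni>: \<^bold>\<Sigma> j : fi X d. (fam X a $ u) \<sim>\<^bsub>X\<^esub> (fam X d $ j))"
lemmas target_eval [ev] = target_d_def[THEN declared, unfolded defn]
lemma target_ok [oks]: "ok_glob i 45 target_d"
  by (rule ok_GlI; simp only: ev oks cong: congs)
abbreviation (input) "target X a d u \<equiv> glob 45 target_d $ X $ a $ d $ u"
abbreviation (input) "mk_target X a d u j p \<equiv> pair (fi X d) (\<lambda>j. (fam X a $ u) \<sim>\<^bsub>X\<^esub> (fam X d $ j)) j p"
abbreviation (input) "target_index X a d u t \<equiv> fst' (fi X d) (\<lambda>j. (fam X a $ u) \<sim>\<^bsub>X\<^esub> (fam X d $ j)) t"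
abbreviation (input) "target_path X a d u t \<equiv> snd' (fi X d) (\<lambda>j. (fam X a $ u) \<sim>\<^bsub>X\<^esub> (fam X d $ j)) t"

definition theta_d where
  "theta_d = (\<Xi> X : TY. \<Xi> a : ob X. \<Xi> d : ob X. \<Xi> h : hm X a d. \<Xi> u : fi X a. target X a d u \<ni>:
     mk_target X a d u (hom_fun X a d h $ u)
       (hap (fi X a) (\<Lambda> k : fi X a. X) (fam X a) (\<Lambda> k : fi X a. fam X d $ (hom_fun X a d h $ k)) (hom_path X a d h) $ u))"
lemmas theta_eval [ev] = theta_d_def[THEN declared, unfolded defn]
lemma theta_ok [oks]: "ok_glob i 46 theta_d"
  by (rule ok_GlI; simp only: ev oks cong: congs)
abbreviation (input) "theta X a d h \<equiv> glob 46 theta_d $ X $ a $ d $ h"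

definition theta_inv_d where
  "theta_inv_d = (\<Xi> X : TY. \<Xi> a : ob X. \<Xi> d : ob X. \<Xi> t : (\<^bold>\<Pi> u : fi X a. target X a d u). hm X a d \<ni>:
     mk_hom X a d (\<Lambda> u : fi X a. target_index X a d u (t $ u))
       (funext (fi X a) (\<Lambda> k : fi X a. X) (fam X a) (\<Lambda> u : fi X a. fam X d $ target_index X a d u (t $ u))
         (\<Lambda> u : fi X a. target_path X a d u (t $ u))))"
lemmas theta_inv_eval [ev] = theta_inv_d_def[THEN declared, unfolded defn]
lemma theta_inv_ok [oks]: "ok_glob i 47 theta_inv_d"
  by (rule ok_GlI; simp only: ev oks cong: congs)
abbreviation (input) "theta_inv X a d t \<equiv> glob 47 theta_inv_d $ X $ a $ d $ t"

text \<open>Once \<open>h\<close> is split into a pair, the underlying functions agree by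
  computation and only the path changes, by \<open>funext_ret\<close>.\<close>

definition theta_ret_d where
  "theta_ret_d = (\<Xi> X : TY. \<Xi> a : ob X. \<Xi> d : ob X. \<Xi> h : hm X a d.
     theta_inv X a d (theta X a d h) \<sim>\<^bsub>(hm X a d)\<^esub> h \<ni>:
     indS (fi X a \<Rrightarrow> fi X d) (pth X a d) (\<Lambda> h : hm X a d. theta_inv X a d (theta X a d h) \<sim>\<^bsub>(hm X a d)\<^esub> h)
       (\<Lambda> f : fi X a \<Rrightarrow> fi X d. \<Lambda> p : pth X a d f.
         let g = (\<Lambda> k : fi X a. fam X d $ (f $ k)); B = (\<Lambda> k : fi X a. X) in
         ap (pth X a d f) (hm X a d) (\<Lambda> p : pth X a d f. mk_hom X a d f p)
           (funext (fi X a) B (fam X a) g (hap (fi X a) B (fam X a) g p)) p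
           (funext_ret (fi X a) B (fam X a) g p)) h)"
lemmas theta_ret_eval [ev] = theta_ret_d_def[THEN declared, unfolded defn]
lemma theta_ret_ok [oks]: "ok_glob i 48 theta_ret_d"
  by (rule ok_GlI; simp only: ev oks cong: congs)
abbreviation (input) "theta_ret X a d h \<equiv> glob 48 theta_ret_d $ X $ a $ d $ h"

text \<open>Here \<open>funext_sec\<close> repairs the path component at the index \<open>u\<close>.
  A further step through \<open>sigma_eta_d\<close> is needed since a pair is the pair of its
  projections only up to a path.\<close>

definition theta_sec_d where
  "theta_sec_d = (\<Xi> X : TY. \<Xi> a : ob X. \<Xi> d : ob X. \<Xi> t : (\<^bold>\<Pi> u : fi X a. target X a d u). \<Xi> u : fi X a.
     let B = (\<Lambda> k : fi X a. X); g = (\<Lambda> u : fi X a. fam X d $ target_index X a d u (t $ u)); k = (\<Lambda> u : fi X a. target_path X a d u (t $ u));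
       F = (\<^bold>\<Pi> u : fi X a. (fam X a $ u) \<sim>\<^bsub>X\<^esub> (g $ u)); k' = hap (fi X a) B (fam X a) g (funext (fi X a) B (fam X a) g k);
       e = mk_target X a d u (target_index X a d u (t $ u)) (target_path X a d u (t $ u)) in
     (theta X a d (theta_inv X a d t) $ u) \<sim>\<^bsub>(target X a d u)\<^esub> (t $ u) \<ni>:
       cat (target X a d u) (theta X a d (theta_inv X a d t) $ u) e (t $ u)
         (ap F (target X a d u) (\<Lambda> w : F. mk_target X a d u (target_index X a d u (t $ u)) (w $ u)) k' k (funext_sec (fi X a) B (fam X a) g k))
         (glob 35 sigma_eta_d $ fi X d $ (\<Lambda> j : fi X d. (fam X a $ u) \<sim>\<^bsub>X\<^esub> (fam X d $ j)) $ (t $ u)))"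
lemmas theta_sec_eval [ev] = theta_sec_d_def[THEN declared, unfolded defn]
lemma theta_sec_ok [oks]: "ok_glob i 49 theta_sec_d"
  by (rule ok_GlI; simp only: ev oks cong: congs)
abbreviation (input) "theta_sec X a d t u \<equiv> glob 49 theta_sec_d $ X $ a $ d $ t $ u"

text \<open>A map with a left inverse is injective. Function extensionality reduces the equality of
  the two families to the pointwise equalities \<open>e\<close>.\<close>

definition theta_inj_d where
  "theta_inj_d = (\<Xi> X : TY. \<Xi> a : ob X. \<Xi> d : ob X. \<Xi> f : hm X a d. \<Xi> g : hm X a d.
     \<Xi> e : (\<^bold>\<Pi> u : fi X a. (theta X a d f $ u) \<sim>\<^bsub>(target X a d u)\<^esub> (theta X a d g $ u)).
     let H = hm X a d; T = (\<^bold>\<Pi> u : fi X a. target X a d u); r = \<lambda>f. theta_inv X a d (theta X a d f) in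
     f \<sim>\<^bsub>H\<^esub> g \<ni>:
       cat H f (r f) g (opp H (r f) f (theta_ret X a d f))
         (cat H (r f) (r g) g (ap T H (\<Lambda> t : T. theta_inv X a d t) (theta X a d f) (theta X a d g)
            (funext (fi X a) (\<Lambda> u : fi X a. target X a d u) (theta X a d f) (theta X a d g) e)) (theta_ret X a d g)))"
lemmas theta_inj_eval [ev] = theta_inj_d_def[THEN declared, unfolded defn]
lemma theta_inj_ok [oks]: "ok_glob i 50 theta_inj_d"
  by (rule ok_GlI; simp only: ev oks cong: congs)
abbreviation (input) "theta_inj X a d f g e \<equiv> glob 50 theta_inj_d $ X $ a $ d $ f $ g $ e"

text \<open>By \<open>theta_ret\<close> a hom type is a retract of a product of sums, to which the
  closure properties of sets apply.\<close>

definition hom_set_d where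
  "hom_set_d = (\<Xi> X : TY. \<Xi> h : isone X. \<Xi> a : ob X. \<Xi> d : ob X.
     let T = (\<^bold>\<Pi> u : fi X a. target X a d u) in
     isset (hm X a d) \<ni>: glob 36 retract_set_d $ hm X a d $ T
       $ (glob 30 pi_set_d $ fi X a $ (\<Lambda> u : fi X a. target X a d u) $ (\<Lambda> u : fi X a.
            glob 34 sigma_set_d $ fi X d $ (\<Lambda> j : fi X d. (fam X a $ u) \<sim>\<^bsub>X\<^esub> (fam X d $ j))
              $ (glob 29 fin_set_d $ (glob 38 num_d $ X $ d)) $ (\<Lambda> j : fi X d. h $ (fam X a $ u) $ (fam X d $ j))))
       $ (\<Lambda> h : hm X a d. theta X a d h) $ (\<Lambda> t : T. theta_inv X a d t) $ (\<Lambda> h : hm X a d. theta_ret X a d h))"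
lemmas hom_set_eval [ev] = hom_set_d_def[THEN declared, unfolded defn]
lemma hom_set_ok [oks]: "ok_glob i 51 hom_set_d"
  by (rule ok_GlI; simp only: ev oks cong: congs)
abbreviation (input) "hom_set X h a d \<equiv> glob 51 hom_set_d $ X $ h $ a $ d"

section \<open>Unit and associativity laws\<close>

definition ap_id_d where
  "ap_id_d = (\<Xi> A : TY. let E = \<lambda>x y p. p \<sim>\<^bsub>(x \<sim>\<^bsub>A\<^esub> y)\<^esub> ap A A (\<Lambda> z : A. z) x y p in
     \<Xi> x : A. \<Xi> y : A. \<Xi> p : x \<sim>\<^bsub>A\<^esub> y. E x y p \<ni>:
       J A (\<Lambda> x : A. \<Lambda> y : A. \<Lambda> p : x \<sim>\<^bsub>A\<^esub> y. E x y p) (\<Lambda> x : A. rf (x \<sim>\<^bsub>A\<^esub> x) (rf A x)) x y p)"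
lemmas ap_id_eval [ev] = ap_id_d_def[THEN declared, unfolded defn]
lemma ap_id_ok [oks]: "ok_glob i 52 ap_id_d"
  by (rule ok_GlI; simp only: ev oks cong: congs)
definition concat_refl_d where
  "concat_refl_d = (\<Xi> A : TY. let E = \<lambda>x y p. p \<sim>\<^bsub>(x \<sim>\<^bsub>A\<^esub> y)\<^esub> cat A x y y p (rf A y) in
     \<Xi> x : A. \<Xi> y : A. \<Xi> p : x \<sim>\<^bsub>A\<^esub> y. E x y p \<ni>:
       J A (\<Lambda> x : A. \<Lambda> y : A. \<Lambda> p : x \<sim>\<^bsub>A\<^esub> y. E x y p) (\<Lambda> x : A. rf (x \<sim>\<^bsub>A\<^esub> x) (rf A x)) x y p)"
lemmas concat_refl_eval [ev] = concat_refl_d_def[THEN declared, unfolded defn]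
lemma concat_refl_ok [oks]: "ok_glob i 53 concat_refl_d"
  by (rule ok_GlI; simp only: ev oks cong: congs)

definition concat_assoc_refl_d where
  "concat_assoc_refl_d = (\<Xi> A : TY. let E = \<lambda>x y p. cat A x y y (cat A x y y p (rf A y)) (rf A y) \<sim>\<^bsub>(x \<sim>\<^bsub>A\<^esub> y)\<^esub> cat A x y y p (rf A y) in
     \<Xi> x : A. \<Xi> y : A. \<Xi> p : x \<sim>\<^bsub>A\<^esub> y. E x y p \<ni>:
       J A (\<Lambda> x : A. \<Lambda> y : A. \<Lambda> p : x \<sim>\<^bsub>A\<^esub> y. E x y p) (\<Lambda> x : A. rf (x \<sim>\<^bsub>A\<^esub> x) (rf A x)) x y p)"
lemmas concat_assoc_refl_eval [ev] = concat_assoc_refl_d_def[THEN declared, unfolded defn]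
lemma concat_assoc_refl_ok [oks]: "ok_glob i 54 concat_assoc_refl_d"
  by (rule ok_GlI; simp only: ev oks cong: congs)

text \<open>What remains of \<open>concat_ap_assoc_d\<close> when its last path is reflexivity:
  \<open>cat\<close> computes on its first path only, so a trailing reflexivity does not disappear
  by itself.\<close>

definition concat_ap_refl_d where
  "concat_ap_refl_d = (\<Xi> A : TY. \<Xi> B : TY. \<Xi> F : B \<Rrightarrow> A.
     let E = \<lambda>y z q. (\<^bold>\<Pi> x : A. \<^bold>\<Pi> p : x \<sim>\<^bsub>A\<^esub> (F $ y).
        cat A x (F $ z) (F $ z) (cat A x (F $ y) (F $ z) p (ap B A F y z q)) (rf A (F $ z)) \<sim>\<^bsub>(x \<sim>\<^bsub>A\<^esub> (F $ z))\<^esub>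
        cat A x (F $ y) (F $ z) p (ap B A F y z (cat B y z z q (rf B z)))) in
     \<Xi> y : B. \<Xi> z : B. \<Xi> q : y \<sim>\<^bsub>B\<^esub> z. E y z q \<ni>:
       J B (\<Lambda> y : B. \<Lambda> z : B. \<Lambda> q : y \<sim>\<^bsub>B\<^esub> z. E y z q)
         (\<Lambda> y : B. \<Lambda> x : A. \<Lambda> p : x \<sim>\<^bsub>A\<^esub> (F $ y). glob 54 concat_assoc_refl_d $ A $ x $ (F $ y) $ p) y z q)"
lemmas concat_ap_refl_eval [ev] = concat_ap_refl_d_def[THEN declared, unfolded defn]
lemma concat_ap_refl_ok [oks]: "ok_glob i 55 concat_ap_refl_d"
  by (rule ok_GlI; simp only: ev oks cong: congs)

text \<open>Associativity with the restriction maps abstracted to \<open>F\<close> and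
  \<open>G\<close>. In \<open>HX\<close> these are precomposition with the underlying functions; in
  the abstract form the endpoints are free, as path induction requires.\<close>

definition concat_ap_assoc_d where
  "concat_ap_assoc_d = (\<Xi> A : TY. \<Xi> B : TY. \<Xi> C : TY. \<Xi> F : B \<Rrightarrow> A. \<Xi> G : C \<Rrightarrow> B.
     let E = \<lambda>z w r. (\<^bold>\<Pi> y : B. \<^bold>\<Pi> q : y \<sim>\<^bsub>B\<^esub> (G $ z). \<^bold>\<Pi> x : A. \<^bold>\<Pi> p : x \<sim>\<^bsub>A\<^esub> (F $ y).
        cat A x (F $ (G $ z)) (F $ (G $ w)) (cat A x (F $ y) (F $ (G $ z)) p (ap B A F y (G $ z) q))
            (ap C A (\<Lambda> v : C. F $ (G $ v)) z w r) \<sim>\<^bsub>(x \<sim>\<^bsub>A\<^esub> (F $ (G $ w)))\<^esub>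
        cat A x (F $ y) (F $ (G $ w)) p (ap B A F y (G $ w) (cat B y (G $ z) (G $ w) q (ap C B G z w r)))) in
     \<Xi> z : C. \<Xi> w : C. \<Xi> r : z \<sim>\<^bsub>C\<^esub> w. E z w r \<ni>:
       J C (\<Lambda> z : C. \<Lambda> w : C. \<Lambda> r : z \<sim>\<^bsub>C\<^esub> w. E z w r)
         (\<Lambda> z : C. \<Lambda> y : B. \<Lambda> q : y \<sim>\<^bsub>B\<^esub> (G $ z). glob 55 concat_ap_refl_d $ A $ B $ F $ y $ (G $ z) $ q) z w r)"
lemmas concat_ap_assoc_eval [ev] = concat_ap_assoc_d_def[THEN declared, unfolded defn]
lemma concat_ap_assoc_ok [oks]: "ok_glob i 56 concat_ap_assoc_d"
  by (rule ok_GlI; simp only: ev oks cong: congs)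

text \<open>Here reflexivity comes first in the concatenation and computes away. Up to eta, the
  image of \<open>p\<close> under the identity is left.\<close>

definition right_unit_d where
  "right_unit_d = (\<Xi> X : TY. \<Xi> a : ob X. \<Xi> b : ob X. \<Xi> f : hm X a b.
     f \<sim>\<^bsub>(hm X a b)\<^esub> cmp X a a b f (idm X a) \<ni>:
     indS (fi X a \<Rrightarrow> fi X b) (pth X a b) (\<Lambda> f : hm X a b. f \<sim>\<^bsub>(hm X a b)\<^esub> cmp X a a b f (idm X a))
       (\<Lambda> f : fi X a \<Rrightarrow> fi X b. \<Lambda> p : pth X a b f.
         let g = (\<Lambda> k : fi X a. fam X b $ (f $ k)); P = fi X a \<Rrightarrow> X in
         ap (pth X a b f) (hm X a b) (\<Lambda> p : pth X a b f. mk_hom X a b f p) p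
           (ap P P (\<Lambda> z : P. z) (fam X a) g p) (glob 52 ap_id_d $ P $ fam X a $ g $ p)) f)"
lemmas right_unit_eval [ev] = right_unit_d_def[THEN declared, unfolded defn]
lemma right_unit_ok [oks]: "ok_glob i 57 right_unit_d"
  by (rule ok_GlI; simp only: ev oks cong: congs)

text \<open>In this order reflexivity comes second, hence the appeal to
  \<open>concat_refl_d\<close>.\<close>

definition left_unit_d where
  "left_unit_d = (\<Xi> X : TY. \<Xi> a : ob X. \<Xi> b : ob X. \<Xi> f : hm X a b.
     f \<sim>\<^bsub>(hm X a b)\<^esub> cmp X a b b (idm X b) f \<ni>:
     indS (fi X a \<Rrightarrow> fi X b) (pth X a b) (\<Lambda> f : hm X a b. f \<sim>\<^bsub>(hm X a b)\<^esub> cmp X a b b (idm X b) f)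
       (\<Lambda> f : fi X a \<Rrightarrow> fi X b. \<Lambda> p : pth X a b f.
         let g = (\<Lambda> k : fi X a. fam X b $ (f $ k)); P = fi X a \<Rrightarrow> X in
         ap (pth X a b f) (hm X a b) (\<Lambda> p : pth X a b f. mk_hom X a b f p) p
           (cat P (fam X a) g g p (rf P g)) (glob 53 concat_refl_d $ P $ fam X a $ g $ p)) f)"
lemmas left_unit_eval [ev] = left_unit_d_def[THEN declared, unfolded defn]
lemma left_unit_ok [oks]: "ok_glob i 58 left_unit_d"
  by (rule ok_GlI; simp only: ev oks cong: congs)

text \<open>The two underlying functions are convertible, so the equation concerns the path
  components alone.\<close>

definition assoc_d where
  "assoc_d = (\<Xi> X : TY. \<Xi> a : ob X. \<Xi> b : ob X. \<Xi> c : ob X. \<Xi> d : ob X. \<Xi> f : hm X a b. \<Xi> g : hm X b c. \<Xi> h : hm X c d.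
     let P = \<lambda>a. fi X a \<Rrightarrow> X; F = fi X a \<Rrightarrow> fi X d; f1 = hom_fun X a b f; g1 = hom_fun X b c g; h1 = hom_fun X c d h;
       k = (\<Lambda> k : fi X a. h1 $ (g1 $ (f1 $ k)));
       L = cmp X a c d h (cmp X a b c g f); R = cmp X a b d (cmp X b c d h g) f in
     L \<sim>\<^bsub>(hm X a d)\<^esub> R \<ni>:
       ap (pth X a d k) (hm X a d) (\<Lambda> p : pth X a d k. mk_hom X a d k p) (hom_path X a d L) (hom_path X a d R)
         (glob 56 concat_ap_assoc_d $ P a $ P b $ P c $ (\<Lambda> y : P b. \<Lambda> k : fi X a. y $ (f1 $ k)) $ (\<Lambda> z : P c. \<Lambda> k : fi X b. z $ (g1 $ k))
           $ fam X c $ (\<Lambda> k : fi X c. fam X d $ (h1 $ k)) $ hom_path X c d h $ fam X b $ hom_path X b c g $ fam X a $ hom_path X a b f))"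
lemmas assoc_eval [ev] = assoc_d_def[THEN declared, unfolded defn]
lemma assoc_ok [oks]: "ok_glob i 59 assoc_d"
  by (rule ok_GlI; simp only: ev oks cong: congs)

definition initial_d where
  "initial_d = (\<Xi> X : TY. (\<^bold>\<Sigma> z : ob X. \<^bold>\<Pi> a : ob X. iscontr (hm X z a)) \<ni>:
     let z = mk_ob X (kon CZero) (\<Lambda> k : Emp. indE (\<Lambda> k : Emp. X) k);
       c = \<lambda>a. theta_inv X z a (\<Lambda> u : Emp. indE (\<Lambda> u : Emp. target X z a u) u) in
     pair (ob X) (\<lambda>z. \<^bold>\<Pi> a : ob X. iscontr (hm X z a)) z
      (\<Lambda> a : ob X. pair (hm X z a) (\<lambda>x. \<^bold>\<Pi> y : hm X z a. x \<sim>\<^bsub>(hm X z a)\<^esub> y) (c a)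
        (\<Lambda> y : hm X z a. theta_inj X z a (c a) y (\<Lambda> u : Emp. indE (\<Lambda> u : Emp. (theta X z a (c a) $ u) \<sim>\<^bsub>(target X z a u)\<^esub> (theta X z a y $ u)) u))))"
lemmas initial_eval [ev] = initial_d_def[THEN declared, unfolded defn]
lemma initial_ok [oks]: "ok_glob i 60 initial_d"
  by (rule ok_GlI; simp only: ev oks cong: congs)

section \<open>Binary coproducts\<close>

abbreviation (input) "kon1 \<equiv> rCST (Suc 0) 0"
abbreviation (input) "pair1 A B a b \<equiv> kon1 CPair $ A $ rLAM A B $ a $ b"
abbreviation (input) "sg1 A B \<equiv> kon1 CSigma $ A $ rLAM A B"
abbreviation (input) "suc n \<equiv> kon CSucc $ n"

text \<open>The dependent eliminator of a binary sum, with computation rules up to paths. It is used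
  directly in place of an equivalence with the sum type. Quantifying over all families
  \<open>T\<close> puts it into the second universe.\<close>

definition cover_d where
  "cover_d = (\<Xi> n : Nt. \<Xi> m : Nt. \<Xi> N : Nt. \<Xi> il : fin n \<Rrightarrow> fin N. \<Xi> ir : fin m \<Rrightarrow> fin N. TY1 \<ni>:
     \<^bold>\<Pi> T : fin N \<Rrightarrow> TY. \<^bold>\<Pi> a : (\<^bold>\<Pi> k : fin n. T $ (il $ k)). \<^bold>\<Pi> b : (\<^bold>\<Pi> k : fin m. T $ (ir $ k)).
       \<^bold>\<Sigma> F : (\<^bold>\<Pi> u : fin N. T $ u). (\<^bold>\<Pi> k : fin n. (a $ k) \<sim>\<^bsub>(T $ (il $ k))\<^esub> (F $ (il $ k)))
         \<^bold>\<times> (\<^bold>\<Pi> k : fin m. (b $ k) \<sim>\<^bsub>(T $ (ir $ k))\<^esub> (F $ (ir $ k))))"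
lemmas cover_eval [ev] = cover_d_def[THEN declared, unfolded defn]
lemma cover_ok [oks]: "ok_glob i 61 cover_d"
  by (rule ok_GlI; simp only: ev oks cong: congs)
abbreviation (input) "cover n m N il ir \<equiv> glob 61 cover_d $ n $ m $ N $ il $ ir"

abbreviation (input) "dl n T il a F \<equiv> (\<^bold>\<Pi> k : fin n. (a $ k) \<sim>\<^bsub>(T $ (il $ k))\<^esub> (F $ (il $ k)))"
abbreviation (input) "dd1 n m N il ir T a b d \<equiv> fst' (\<^bold>\<Pi> u : fin N. T $ u) (\<lambda>F. dl n T il a F \<^bold>\<times> dl m T ir b F) d"
abbreviation (input) "dd2 n m N il ir T a b d \<equiv> snd' (\<^bold>\<Pi> u : fin N. T $ u) (\<lambda>F. dl n T il a F \<^bold>\<times> dl m T ir b F) d"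

definition cover_fun_d where
  "cover_fun_d = (\<Xi> n : Nt. \<Xi> m : Nt. \<Xi> N : Nt. \<Xi> il : fin n \<Rrightarrow> fin N. \<Xi> ir : fin m \<Rrightarrow> fin N. \<Xi> D : cover n m N il ir.
     \<Xi> T : fin N \<Rrightarrow> TY. \<Xi> a : (\<^bold>\<Pi> k : fin n. T $ (il $ k)). \<Xi> b : (\<^bold>\<Pi> k : fin m. T $ (ir $ k)).
     (\<^bold>\<Pi> u : fin N. T $ u) \<ni>: dd1 n m N il ir T a b (D $ T $ a $ b))"
lemmas cover_fun_eval [ev] = cover_fun_d_def[THEN declared, unfolded defn]
lemma cover_fun_ok [oks]: "ok_glob i 62 cover_fun_d"
  by (rule ok_GlI; simp only: ev oks cong: congs)
abbreviation (input) "cover_fun n m N il ir D T a b \<equiv> glob 62 cover_fun_d $ n $ m $ N $ il $ ir $ D $ T $ a $ b"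

definition cover_left_d where
  "cover_left_d = (\<Xi> n : Nt. \<Xi> m : Nt. \<Xi> N : Nt. \<Xi> il : fin n \<Rrightarrow> fin N. \<Xi> ir : fin m \<Rrightarrow> fin N. \<Xi> D : cover n m N il ir.
     \<Xi> T : fin N \<Rrightarrow> TY. \<Xi> a : (\<^bold>\<Pi> k : fin n. T $ (il $ k)). \<Xi> b : (\<^bold>\<Pi> k : fin m. T $ (ir $ k)).
     let F = cover_fun n m N il ir D T a b in
     dl n T il a F \<ni>: fst' (dl n T il a F) (\<lambda>_. dl m T ir b F) (dd2 n m N il ir T a b (D $ T $ a $ b)))"
lemmas cover_left_eval [ev] = cover_left_d_def[THEN declared, unfolded defn]
lemma cover_left_ok [oks]: "ok_glob i 63 cover_left_d"
  by (rule ok_GlI; simp only: ev oks cong: congs)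
abbreviation (input) "cover_left n m N il ir D T a b \<equiv> glob 63 cover_left_d $ n $ m $ N $ il $ ir $ D $ T $ a $ b"

definition cover_right_d where
  "cover_right_d = (\<Xi> n : Nt. \<Xi> m : Nt. \<Xi> N : Nt. \<Xi> il : fin n \<Rrightarrow> fin N. \<Xi> ir : fin m \<Rrightarrow> fin N. \<Xi> D : cover n m N il ir.
     \<Xi> T : fin N \<Rrightarrow> TY. \<Xi> a : (\<^bold>\<Pi> k : fin n. T $ (il $ k)). \<Xi> b : (\<^bold>\<Pi> k : fin m. T $ (ir $ k)).
     let F = cover_fun n m N il ir D T a b in
     dl m T ir b F \<ni>: snd' (dl n T il a F) (\<lambda>_. dl m T ir b F) (dd2 n m N il ir T a b (D $ T $ a $ b)))"
lemmas cover_right_eval [ev] = cover_right_d_def[THEN declared, unfolded defn]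
lemma cover_right_ok [oks]: "ok_glob i 64 cover_right_d"
  by (rule ok_GlI; simp only: ev oks cong: congs)
abbreviation (input) "cover_right n m N il ir D T a b \<equiv> glob 64 cover_right_d $ n $ m $ N $ il $ ir $ D $ T $ a $ b"

definition fin_sum_d where
  "fin_sum_d = (\<Xi> n : Nt. \<Xi> m : Nt. TY1 \<ni>:
     sg1 Nt (\<lambda>N. sg1 (fin n \<Rrightarrow> fin N) (\<lambda>il. sg1 (fin m \<Rrightarrow> fin N) (\<lambda>ir. cover n m N il ir))))"
lemmas fin_sum_eval [ev] = fin_sum_d_def[THEN declared, unfolded defn]
lemma fin_sum_ok [oks]: "ok_glob i 65 fin_sum_d"
  by (rule ok_GlI; simp only: ev oks cong: congs)
abbreviation (input) "fin_sum n m \<equiv> glob 65 fin_sum_d $ n $ m"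
abbreviation (input) "mk_fin_sum n m N il ir D \<equiv>
  pair1 Nt (\<lambda>N. sg1 (fin n \<Rrightarrow> fin N) (\<lambda>il. sg1 (fin m \<Rrightarrow> fin N) (\<lambda>ir. cover n m N il ir))) N
   (pair1 (fin n \<Rrightarrow> fin N) (\<lambda>il. sg1 (fin m \<Rrightarrow> fin N) (\<lambda>ir. cover n m N il ir)) il
    (pair1 (fin m \<Rrightarrow> fin N) (\<lambda>ir. cover n m N il ir) ir D))"
text \<open>Elimination into a constant type of level \<open>j\<close>: \<open>Suc 0\<close> for
  building another \<open>fin_sum\<close>, and 0 for producing a coproduct.\<close>

abbreviation (input) "ind_fin_sum j n m C g c \<equiv>
  rCST (Suc 0) j CIndSigma $ Nt $ (\<Lambda> N : Nt. sg1 (fin n \<Rrightarrow> fin N) (\<lambda>il. sg1 (fin m \<Rrightarrow> fin N) (\<lambda>ir. cover n m N il ir))) $ (\<Lambda> x : fin_sum n m. C)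
   $ (\<Lambda> N : Nt. \<Lambda> c : sg1 (fin n \<Rrightarrow> fin N) (\<lambda>il. sg1 (fin m \<Rrightarrow> fin N) (\<lambda>ir. cover n m N il ir)).
   rCST (Suc 0) j CIndSigma $ (fin n \<Rrightarrow> fin N) $ (\<Lambda> il : (fin n \<Rrightarrow> fin N). sg1 (fin m \<Rrightarrow> fin N) (\<lambda>ir. cover n m N il ir))
     $ (\<Lambda> x : sg1 (fin n \<Rrightarrow> fin N) (\<lambda>il. sg1 (fin m \<Rrightarrow> fin N) (\<lambda>ir. cover n m N il ir)). C)
     $ (\<Lambda> il : fin n \<Rrightarrow> fin N. \<Lambda> c : sg1 (fin m \<Rrightarrow> fin N) (\<lambda>ir. cover n m N il ir).
       rCST (Suc 0) j CIndSigma $ (fin m \<Rrightarrow> fin N) $ (\<Lambda> ir : (fin m \<Rrightarrow> fin N). cover n m N il ir)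
         $ (\<Lambda> x : sg1 (fin m \<Rrightarrow> fin N) (\<lambda>ir. cover n m N il ir). C)
         $ (\<Lambda> ir : fin m \<Rrightarrow> fin N. \<Lambda> D : cover n m N il ir. g N il ir D) $ c) $ c) $ c"

definition fin_sum_zero_d where
  "fin_sum_zero_d = (\<Xi> n : Nt. let il = (\<Lambda> k : fin n. k); ir = (\<Lambda> k : Emp. indE (\<Lambda> k : Emp. fin n) k) in
     fin_sum n (kon CZero) \<ni>: mk_fin_sum n (kon CZero) n il ir
       (\<Lambda> T : fin n \<Rrightarrow> TY. \<Lambda> a : (\<^bold>\<Pi> k : fin n. T $ k). \<Lambda> b : (\<^bold>\<Pi> k : Emp. T $ (ir $ k)).
         pair (\<^bold>\<Pi> u : fin n. T $ u) (\<lambda>F. dl n T il a F \<^bold>\<times> dl (kon CZero) T ir b F) a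
           (pair (dl n T il a a) (\<lambda>_. dl (kon CZero) T ir b a) (\<Lambda> k : fin n. rf (T $ k) (a $ k))
             (\<Lambda> k : Emp. indE (\<Lambda> k : Emp. (b $ k) \<sim>\<^bsub>(T $ (ir $ k))\<^esub> (a $ (ir $ k))) k))))"
lemmas fin_sum_zero_eval [ev] = fin_sum_zero_d_def[THEN declared, unfolded defn]
lemma fin_sum_zero_ok [oks]: "ok_glob i 66 fin_sum_zero_d"
  by (rule ok_GlI; simp only: ev oks cong: congs)

text \<open>\<open>fin (suc m)\<close> is convertible to \<open>fin m\<close> plus one point, which
  is sent to the new point of \<open>fin (suc N)\<close>. The given cover handles the old points for
  the restricted family, and at the new point the equation holds by computation.\<close>

definition fin_sum_suc_d where
  "fin_sum_suc_d = (\<Xi> n : Nt. \<Xi> m : Nt. \<Xi> N : Nt. \<Xi> il : fin n \<Rrightarrow> fin N. \<Xi> ir : fin m \<Rrightarrow> fin N. \<Xi> D : cover n m N il ir.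
     let S = \<lambda>N. fin N \<^bold>+ One; l = \<lambda>N k. inl (fin N) One k; r = \<lambda>N k. inr (fin N) One k;
       il' = (\<Lambda> k : fin n. l N (il $ k));
       ir' = (\<Lambda> k : S m. indP (fin m) One (\<Lambda> k : S m. S N) (\<Lambda> k : fin m. l N (ir $ k)) (\<Lambda> k : One. r N k) k) in
     fin_sum n (suc m) \<ni>: mk_fin_sum n (suc m) (suc N) il' ir'
       (\<Lambda> T : S N \<Rrightarrow> TY. \<Lambda> a : (\<^bold>\<Pi> k : fin n. T $ (il' $ k)). \<Lambda> b : (\<^bold>\<Pi> k : S m. T $ (ir' $ k)).
         let T' = (\<Lambda> u : fin N. T $ l N u); b' = (\<Lambda> k : fin m. b $ l m k);
           F = (\<Lambda> u : S N. indP (fin N) One T (cover_fun n m N il ir D T' a b') (\<Lambda> k : One. b $ r m k) u) in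
         pair (\<^bold>\<Pi> u : S N. T $ u) (\<lambda>F. dl n T il' a F \<^bold>\<times> dl (suc m) T ir' b F) F
           (pair (dl n T il' a F) (\<lambda>_. dl (suc m) T ir' b F) (cover_left n m N il ir D T' a b')
             (\<Lambda> k : S m. indP (fin m) One (\<Lambda> k : S m. (b $ k) \<sim>\<^bsub>(T $ (ir' $ k))\<^esub> (F $ (ir' $ k))) (cover_right n m N il ir D T' a b')
                (\<Lambda> k : One. rf (T $ r N k) (b $ r m k)) k))))"
lemmas fin_sum_suc_eval [ev] = fin_sum_suc_d_def[THEN declared, unfolded defn]
lemma fin_sum_suc_ok [oks]: "ok_glob i 67 fin_sum_suc_d"
  by (rule ok_GlI; simp only: ev oks cong: congs)

definition fin_sum_exists_d where
  "fin_sum_exists_d = (\<Xi> n : Nt. \<Xi> m : Nt. fin_sum n m \<ni>: rCST 0 (Suc 0) CIndNat $ (\<Lambda> m : Nt. fin_sum n m) $ (glob 66 fin_sum_zero_d $ n)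
     $ (\<Lambda> m : Nt. \<Lambda> c : fin_sum n m. ind_fin_sum (Suc 0) n m (fin_sum n (suc m)) (\<lambda>N il ir D. glob 67 fin_sum_suc_d $ n $ m $ N $ il $ ir $ D) c) $ m)"
lemmas fin_sum_exists_eval [ev] = fin_sum_exists_d_def[THEN declared, unfolded defn]
lemma fin_sum_exists_ok [oks]: "ok_glob i 68 fin_sum_exists_d"
  by (rule ok_GlI; simp only: ev oks cong: congs)

text \<open>Naturality of \<open>hap\<close> with respect to precomposition; at reflexivity both
  sides are reflexivity.\<close>

definition happly_ap_d where
  "happly_ap_d = (\<Xi> A : TY. \<Xi> B : TY. \<Xi> X : TY. \<Xi> i : A \<Rrightarrow> B.
     let P = B \<Rrightarrow> X; Q = A \<Rrightarrow> X; c = \<lambda>v. (\<Lambda> k : A. v $ (i $ k));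
      E = \<lambda>w v p. (\<^bold>\<Pi> u : A. (hap B (\<Lambda> k : B. X) w v p $ (i $ u)) \<sim>\<^bsub>((w $ (i $ u)) \<sim>\<^bsub>X\<^esub> (v $ (i $ u)))\<^esub>
        (hap A (\<Lambda> k : A. X) (c w) (c v) (ap P Q (\<Lambda> v : P. c v) w v p) $ u)) in
     \<Xi> w : P. \<Xi> v : P. \<Xi> p : w \<sim>\<^bsub>P\<^esub> v. E w v p \<ni>:
       J P (\<Lambda> w : P. \<Lambda> v : P. \<Lambda> p : w \<sim>\<^bsub>P\<^esub> v. E w v p)
         (\<Lambda> w : P. \<Lambda> u : A. rf ((w $ (i $ u)) \<sim>\<^bsub>X\<^esub> (w $ (i $ u))) (rf X (w $ (i $ u)))) w v p)"
lemmas happly_ap_eval [ev] = happly_ap_d_def[THEN declared, unfolded defn]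
lemma happly_ap_ok [oks]: "ok_glob i 69 happly_ap_d"
  by (rule ok_GlI; simp only: ev oks cong: congs)

abbreviation (input) "res n w i \<equiv> (\<Lambda> k : fin n. w $ (i $ k))"

text \<open>The path is a parameter because the family \<open>x\<close> of a summand is only
  identified with the restriction of \<open>w\<close>. The special case
  \<open>inclusion_refl\<close>, where it is that restriction, is the one in which composites can be
  computed.\<close>

definition inclusion_d where
  "inclusion_d = (\<Xi> X : TY. \<Xi> N : Nt. \<Xi> w : fin N \<Rrightarrow> X. \<Xi> n : Nt. \<Xi> i : fin n \<Rrightarrow> fin N. \<Xi> x : fin n \<Rrightarrow> X. \<Xi> p : x \<sim>\<^bsub>(fin n \<Rrightarrow> X)\<^esub> res n w i.
     hm X (mk_ob X n x) (mk_ob X N w) \<ni>: mk_hom X (mk_ob X n x) (mk_ob X N w) i p)"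
lemmas inclusion_eval [ev] = inclusion_d_def[THEN declared, unfolded defn]
lemma inclusion_ok [oks]: "ok_glob i 70 inclusion_d"
  by (rule ok_GlI; simp only: ev oks cong: congs)
abbreviation (input) "inclusion X N w n i x p \<equiv> glob 70 inclusion_d $ X $ N $ w $ n $ i $ x $ p"
abbreviation (input) "inclusion_refl X N w n i \<equiv> inclusion X N w n i (res n w i) (rf (fin n \<Rrightarrow> X) (res n w i))"
abbreviation (input) "restricted X n w i \<equiv> mk_ob X n (res n w i)"

text \<open>The path of the inclusion is reflexivity and disappears from the composite, so the
  indices agree by computation and the paths by \<open>happly_ap_d\<close>.\<close>

definition theta_comp_d where
  "theta_comp_d = (\<Xi> X : TY. \<Xi> N : Nt. \<Xi> w : fin N \<Rrightarrow> X. \<Xi> n : Nt. \<Xi> i : fin n \<Rrightarrow> fin N. \<Xi> d : ob X.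
     let s = mk_ob X N w; a = restricted X n w i in
     \<Xi> h : hm X s d. \<Xi> u : fin n.
     let h1 = hom_fun X s d h; j = h1 $ (i $ u); v = (\<Lambda> k : fin N. fam X d $ (h1 $ k)); E = (w $ (i $ u)) \<sim>\<^bsub>X\<^esub> (fam X d $ j);
       P = fin N \<Rrightarrow> X; Q = fin n \<Rrightarrow> X in
     (theta X s d h $ (i $ u)) \<sim>\<^bsub>(target X a d u)\<^esub> (theta X a d (cmp X a s d h (inclusion_refl X N w n i)) $ u) \<ni>:
       ap E (target X a d u) (\<Lambda> q : E. mk_target X a d u j q) (hap (fin N) (\<Lambda> k : fin N. X) w v (hom_path X s d h) $ (i $ u))
        (hap (fin n) (\<Lambda> k : fin n. X) (res n w i) (res n v i) (ap P Q (\<Lambda> y : P. res n y i) w v (hom_path X s d h)) $ u)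
        (glob 69 happly_ap_d $ fin n $ fin N $ X $ i $ w $ v $ hom_path X s d h $ u))"
lemmas theta_comp_eval [ev] = theta_comp_d_def[THEN declared, unfolded defn]
lemma theta_comp_ok [oks]: "ok_glob i 71 theta_comp_d"
  by (rule ok_GlI; simp only: ev oks cong: congs)
abbreviation (input) "theta_comp X N w n i d h u \<equiv> glob 71 theta_comp_d $ X $ N $ w $ n $ i $ d $ h $ u"

definition cancel_component_d where
  "cancel_component_d = (\<Xi> X : TY. \<Xi> N : Nt. \<Xi> w : fin N \<Rrightarrow> X. \<Xi> n : Nt. \<Xi> i : fin n \<Rrightarrow> fin N. \<Xi> d : ob X.
     let s = mk_ob X N w; a = restricted X n w i; c = \<lambda>h. cmp X a s d h (inclusion_refl X N w n i) in
     \<Xi> h : hm X s d. \<Xi> g : hm X s d. \<Xi> e : c h \<sim>\<^bsub>(hm X a d)\<^esub> c g. \<Xi> u : fin n.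
     let T = target X a d u; t = \<lambda>h. theta X s d h $ (i $ u); t' = \<lambda>h. theta X a d (c h) $ u in
     t h \<sim>\<^bsub>T\<^esub> t g \<ni>: cat T (t h) (t' h) (t g) (theta_comp X N w n i d h u)
       (cat T (t' h) (t' g) (t g) (ap (hm X a d) T (\<Lambda> z : hm X a d. theta X a d z $ u) (c h) (c g) e)
         (opp T (t g) (t' g) (theta_comp X N w n i d g u))))"
lemmas cancel_component_eval [ev] = cancel_component_d_def[THEN declared, unfolded defn]
lemma cancel_component_ok [oks]: "ok_glob i 72 cancel_component_d"
  by (rule ok_GlI; simp only: ev oks cong: congs)
abbreviation (input) "cancel_component X N w n i d h g e \<equiv> glob 72 cancel_component_d $ X $ N $ w $ n $ i $ d $ h $ g $ e"

text \<open>The inclusions are jointly epic: the cover is applied to the family of identity types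
  between components of \<open>h\<close> and \<open>g\<close>, whose restrictions come from
  \<open>cancel_component\<close>.\<close>

definition cancel_d where
  "cancel_d = (\<Xi> X : TY. \<Xi> n : Nt. \<Xi> m : Nt. \<Xi> N : Nt. \<Xi> il : fin n \<Rrightarrow> fin N. \<Xi> ir : fin m \<Rrightarrow> fin N. \<Xi> D : cover n m N il ir.
     \<Xi> w : fin N \<Rrightarrow> X. \<Xi> d : ob X.
     let s = mk_ob X N w; c = \<lambda>n i h. cmp X (restricted X n w i) s d h (inclusion_refl X N w n i) in
     \<Xi> h : hm X s d. \<Xi> g : hm X s d.
     \<Xi> e : c n il h \<sim>\<^bsub>(hm X (restricted X n w il) d)\<^esub> c n il g. \<Xi> e' : c m ir h \<sim>\<^bsub>(hm X (restricted X m w ir) d)\<^esub> c m ir g.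
     h \<sim>\<^bsub>(hm X s d)\<^esub> g \<ni>: theta_inj X s d h g
       (cover_fun n m N il ir D (\<Lambda> u : fin N. (theta X s d h $ u) \<sim>\<^bsub>(target X s d u)\<^esub> (theta X s d g $ u))
         (cancel_component X N w n il d h g e) (cancel_component X N w m ir d h g e')))"
lemmas cancel_eval [ev] = cancel_d_def[THEN declared, unfolded defn]
lemma cancel_ok [oks]: "ok_glob i 73 cancel_d"
  by (rule ok_GlI; simp only: ev oks cong: congs)
abbreviation (input) "cancel X n m N il ir D w d h g e e' \<equiv>
  glob 73 cancel_d $ X $ n $ m $ N $ il $ ir $ D $ w $ d $ h $ g $ e $ e'"

text \<open>At each index the component of the composite is that of \<open>h\<close>, then
  \<open>F\<close> by \<open>theta_sec\<close>, then that of \<open>f\<close> by the computation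
  rule \<open>e\<close> of the cover.\<close>

definition extension_d where
  "extension_d = (\<Xi> X : TY. \<Xi> N : Nt. \<Xi> w : fin N \<Rrightarrow> X. \<Xi> n : Nt. \<Xi> i : fin n \<Rrightarrow> fin N. \<Xi> d : ob X.
     let s = mk_ob X N w; a = restricted X n w i in
     \<Xi> F : (\<^bold>\<Pi> u : fin N. target X s d u). \<Xi> f : hm X a d. \<Xi> e : (\<^bold>\<Pi> k : fin n. (theta X a d f $ k) \<sim>\<^bsub>(target X a d k)\<^esub> (F $ (i $ k))).
     let h = theta_inv X s d F; g = cmp X a s d h (inclusion_refl X N w n i) in
     g \<sim>\<^bsub>(hm X a d)\<^esub> f \<ni>: theta_inj X a d g f (\<Lambda> u : fin n.
       let T = target X a d u; t = theta X a d g $ u; t' = theta X s d h $ (i $ u); t2 = F $ (i $ u); t3 = theta X a d f $ u in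
       cat T t t' t3 (opp T t' t (theta_comp X N w n i d h u))
         (cat T t' t2 t3 (theta_sec X s d F (i $ u)) (opp T t3 t2 (e $ u)))))"
lemmas extension_eval [ev] = extension_d_def[THEN declared, unfolded defn]
lemma extension_ok [oks]: "ok_glob i 74 extension_d"
  by (rule ok_GlI; simp only: ev oks cong: congs)
abbreviation (input) "extension X N w n i d F f e \<equiv> glob 74 extension_d $ X $ N $ w $ n $ i $ d $ F $ f $ e"

section \<open>The universal property of the coproduct\<close>

definition mediates_d where
  "mediates_d = (\<Xi> X : TY. \<Xi> s : ob X. \<Xi> a : ob X. \<Xi> b : ob X. \<Xi> k : hm X a s. \<Xi> l : hm X b s. \<Xi> d : ob X. \<Xi> f : hm X a d. \<Xi> g : hm X b d.
     \<Xi> h : hm X s d. TY \<ni>: (cmp X a s d h k \<sim>\<^bsub>(hm X a d)\<^esub> f) \<^bold>\<times> (cmp X b s d h l \<sim>\<^bsub>(hm X b d)\<^esub> g))"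
lemmas mediates_eval [ev] = mediates_d_def[THEN declared, unfolded defn]
lemma mediates_ok [oks]: "ok_glob i 75 mediates_d"
  by (rule ok_GlI; simp only: ev oks cong: congs)
abbreviation (input) "mediates X s a b k l d f g h \<equiv> glob 75 mediates_d $ X $ s $ a $ b $ k $ l $ d $ f $ g $ h"
abbreviation (input) "mediates1 X s a b k l d f g h m \<equiv> fst' (cmp X a s d h k \<sim>\<^bsub>(hm X a d)\<^esub> f) (\<lambda>_. cmp X b s d h l \<sim>\<^bsub>(hm X b d)\<^esub> g) m"
abbreviation (input) "mediates2 X s a b k l d f g h m \<equiv> snd' (cmp X a s d h k \<sim>\<^bsub>(hm X a d)\<^esub> f) (\<lambda>_. cmp X b s d h l \<sim>\<^bsub>(hm X b d)\<^esub> g) m"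

definition mediates_prop_d where
  "mediates_prop_d = (\<Xi> X : TY. \<Xi> H : isone X. \<Xi> s : ob X. \<Xi> a : ob X. \<Xi> b : ob X. \<Xi> k : hm X a s. \<Xi> l : hm X b s. \<Xi> d : ob X. \<Xi> f : hm X a d. \<Xi> g : hm X b d.
     \<Xi> h : hm X s d. isprop (mediates X s a b k l d f g h) \<ni>:
       let A = cmp X a s d h k \<sim>\<^bsub>(hm X a d)\<^esub> f; B = cmp X b s d h l \<sim>\<^bsub>(hm X b d)\<^esub> g in
       sigma_prop A (\<Lambda> x : A. B) (hom_set X H a d $ cmp X a s d h k $ f) (\<Lambda> x : A. hom_set X H b d $ cmp X b s d h l $ g))"
lemmas mediates_prop_eval [ev] = mediates_prop_d_def[THEN declared, unfolded defn]
lemma mediates_prop_ok [oks]: "ok_glob i 76 mediates_prop_d"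
  by (rule ok_GlI; simp only: ev oks cong: congs)

definition mediator_d where
  "mediator_d = (\<Xi> X : TY. \<Xi> n : Nt. \<Xi> m : Nt. \<Xi> N : Nt. \<Xi> il : fin n \<Rrightarrow> fin N. \<Xi> ir : fin m \<Rrightarrow> fin N. \<Xi> D : cover n m N il ir.
     \<Xi> w : fin N \<Rrightarrow> X. \<Xi> d : ob X.
     let s = mk_ob X N w; a = restricted X n w il; b = restricted X m w ir; k = inclusion_refl X N w n il; l = inclusion_refl X N w m ir in
     \<Xi> f : hm X a d. \<Xi> g : hm X b d.
     let T = (\<Lambda> u : fin N. target X s d u); F = cover_fun n m N il ir D T (theta X a d f) (theta X b d g); h = theta_inv X s d F in
     (\<^bold>\<Sigma> h : hm X s d. mediates X s a b k l d f g h) \<ni>: pair (hm X s d) (\<lambda>h. mediates X s a b k l d f g h) h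
       (pair (cmp X a s d h k \<sim>\<^bsub>(hm X a d)\<^esub> f) (\<lambda>_. cmp X b s d h l \<sim>\<^bsub>(hm X b d)\<^esub> g)
         (extension X N w n il d F f (cover_left n m N il ir D T (theta X a d f) (theta X b d g)))
         (extension X N w m ir d F g (cover_right n m N il ir D T (theta X a d f) (theta X b d g)))))"
lemmas mediator_eval [ev] = mediator_d_def[THEN declared, unfolded defn]
lemma mediator_ok [oks]: "ok_glob i 77 mediator_d"
  by (rule ok_GlI; simp only: ev oks cong: congs)
abbreviation (input) "mediator X n m N il ir D w d f g \<equiv>
  glob 77 mediator_d $ X $ n $ m $ N $ il $ ir $ D $ w $ d $ f $ g"

definition universal_d where
  "universal_d = (\<Xi> X : TY. \<Xi> s : ob X. \<Xi> a : ob X. \<Xi> b : ob X. \<Xi> k : hm X a s. \<Xi> l : hm X b s. TY \<ni>: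
     \<^bold>\<Pi> d : ob X. \<^bold>\<Pi> f : hm X a d. \<^bold>\<Pi> g : hm X b d. iscontr (\<^bold>\<Sigma> h : hm X s d. mediates X s a b k l d f g h))"
lemmas universal_eval [ev] = universal_d_def[THEN declared, unfolded defn]
lemma universal_ok [oks]: "ok_glob i 78 universal_d"
  by (rule ok_GlI; simp only: ev oks cong: congs)
abbreviation (input) "universal X s a b k l \<equiv> glob 78 universal_d $ X $ s $ a $ b $ k $ l"

definition mediator_unique_d where
  "mediator_unique_d = (\<Xi> X : TY. \<Xi> n : Nt. \<Xi> m : Nt. \<Xi> N : Nt. \<Xi> il : fin n \<Rrightarrow> fin N. \<Xi> ir : fin m \<Rrightarrow> fin N. \<Xi> D : cover n m N il ir.
     \<Xi> w : fin N \<Rrightarrow> X. \<Xi> d : ob X.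
     let s = mk_ob X N w; a = restricted X n w il; b = restricted X m w ir; k = inclusion_refl X N w n il; l = inclusion_refl X N w m ir in
     \<Xi> f : hm X a d. \<Xi> g : hm X b d. \<Xi> h : hm X s d. \<Xi> h' : hm X s d. \<Xi> e : mediates X s a b k l d f g h. \<Xi> e' : mediates X s a b k l d f g h'.
     let c = \<lambda>a k f p p'. cat (hm X a d) (cmp X a s d h k) f (cmp X a s d h' k) p (opp (hm X a d) (cmp X a s d h' k) f p') in
     h \<sim>\<^bsub>(hm X s d)\<^esub> h' \<ni>: cancel X n m N il ir D w d h h'
       (c a k f (mediates1 X s a b k l d f g h e) (mediates1 X s a b k l d f g h' e'))
       (c b l g (mediates2 X s a b k l d f g h e) (mediates2 X s a b k l d f g h' e')))"
lemmas mediator_unique_eval [ev] = mediator_unique_d_def[THEN declared, unfolded defn]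
lemma mediator_unique_ok [oks]: "ok_glob i 79 mediator_unique_d"
  by (rule ok_GlI; simp only: ev oks cong: congs)

text \<open>Mediators with their equations are equal as soon as the morphisms are, because hom types
  are sets. This is how the hypothesis on \<open>X\<close> enters the universal property.\<close>

definition universal_restrictions_d where
  "universal_restrictions_d = (\<Xi> X : TY. \<Xi> H : isone X. \<Xi> n : Nt. \<Xi> m : Nt. \<Xi> N : Nt. \<Xi> il : fin n \<Rrightarrow> fin N. \<Xi> ir : fin m \<Rrightarrow> fin N. \<Xi> D : cover n m N il ir.
     \<Xi> w : fin N \<Rrightarrow> X.
     let s = mk_ob X N w; a = restricted X n w il; b = restricted X m w ir; k = inclusion_refl X N w n il; l = inclusion_refl X N w m ir in
     universal X s a b k l \<ni>: \<Lambda> d : ob X. \<Lambda> f : hm X a d. \<Lambda> g : hm X b d.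
       let M = \<lambda>h. mediates X s a b k l d f g h; S = sg (hm X s d) M; z = mediator X n m N il ir D w d f g;
         q1 = \<lambda>y. fst' (hm X s d) M y; q2 = \<lambda>y. snd' (hm X s d) M y in
       pair S (\<lambda>x. \<^bold>\<Pi> y : S. x \<sim>\<^bsub>S\<^esub> y) z (\<Lambda> y : S. sigma_path (hm X s d) (rLAM (hm X s d) M)
         (glob 76 mediates_prop_d $ X $ H $ s $ a $ b $ k $ l $ d $ f $ g) z y
         (glob 79 mediator_unique_d $ X $ n $ m $ N $ il $ ir $ D $ w $ d $ f $ g $ q1 z $ q1 y $ q2 z $ q2 y)))"
lemmas universal_restrictions_eval [ev] = universal_restrictions_d_def[THEN declared, unfolded defn]
lemma universal_restrictions_ok [oks]: "ok_glob i 80 universal_restrictions_d"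
  by (rule ok_GlI; simp only: ev oks cong: congs)

text \<open>Two based path inductions, first on \<open>q\<close> and then on \<open>p\<close>,
  replace the given families by the restrictions of \<open>w\<close>, where
  \<open>universal_restrictions_d\<close> applies.\<close>

definition universal_inclusions_d where
  "universal_inclusions_d = (\<Xi> X : TY. \<Xi> H : isone X. \<Xi> n : Nt. \<Xi> m : Nt. \<Xi> N : Nt. \<Xi> il : fin n \<Rrightarrow> fin N. \<Xi> ir : fin m \<Rrightarrow> fin N. \<Xi> D : cover n m N il ir.
     \<Xi> w : fin N \<Rrightarrow> X. \<Xi> x : fin n \<Rrightarrow> X. \<Xi> p : x \<sim>\<^bsub>(fin n \<Rrightarrow> X)\<^esub> res n w il. \<Xi> y : fin m \<Rrightarrow> X. \<Xi> q : y \<sim>\<^bsub>(fin m \<Rrightarrow> X)\<^esub> res m w ir.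
     let U = \<lambda>x p y q. universal X (mk_ob X N w) (mk_ob X n x) (mk_ob X m y) (inclusion X N w n il x p) (inclusion X N w m ir y q);
       x0 = res n w il; y0 = res m w ir; P = fin n \<Rrightarrow> X; Q = fin m \<Rrightarrow> X in
     U x p y q \<ni>: path_ind_left Q y0 (\<Lambda> y : Q. \<Lambda> q : y \<sim>\<^bsub>Q\<^esub> y0. U x p y q)
       (path_ind_left P x0 (\<Lambda> x : P. \<Lambda> p : x \<sim>\<^bsub>P\<^esub> x0. U x p y0 (rf Q y0)) (glob 80 universal_restrictions_d $ X $ H $ n $ m $ N $ il $ ir $ D $ w) x p) y q)"
lemmas universal_inclusions_eval [ev] = universal_inclusions_d_def[THEN declared, unfolded defn]
lemma universal_inclusions_ok [oks]: "ok_glob i 81 universal_inclusions_d"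
  by (rule ok_GlI; simp only: ev oks cong: congs)

definition coproduct_d where
  "coproduct_d = (\<Xi> X : TY. \<Xi> a : ob X. \<Xi> b : ob X. TY \<ni>: \<^bold>\<Sigma> s : ob X. \<^bold>\<Sigma> k : hm X a s. \<^bold>\<Sigma> l : hm X b s. universal X s a b k l)"
lemmas coproduct_eval [ev] = coproduct_d_def[THEN declared, unfolded defn]
lemma coproduct_ok [oks]: "ok_glob i 82 coproduct_d"
  by (rule ok_GlI; simp only: ev oks cong: congs)
abbreviation (input) "coproduct X a b \<equiv> glob 82 coproduct_d $ X $ a $ b"

text \<open>The cover for the constant family \<open>X\<close> glues \<open>x\<close> and
  \<open>y\<close> to \<open>w\<close>. Its computation rules, made into paths of functions, are the
  paths carried by the two inclusions.\<close>

definition coproduct_fin_d where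
  "coproduct_fin_d = (\<Xi> X : TY. \<Xi> H : isone X. \<Xi> n : Nt. \<Xi> m : Nt. \<Xi> N : Nt. \<Xi> il : fin n \<Rrightarrow> fin N. \<Xi> ir : fin m \<Rrightarrow> fin N. \<Xi> D : cover n m N il ir.
     \<Xi> x : fin n \<Rrightarrow> X. \<Xi> y : fin m \<Rrightarrow> X.
     let T = (\<Lambda> u : fin N. X); w = cover_fun n m N il ir D T x y; a = mk_ob X n x; b = mk_ob X m y; s = mk_ob X N w;
       p = funext (fin n) (\<Lambda> k : fin n. X) x (res n w il) (cover_left n m N il ir D T x y);
       q = funext (fin m) (\<Lambda> k : fin m. X) y (res m w ir) (cover_right n m N il ir D T x y);
       k = inclusion X N w n il x p; l = inclusion X N w m ir y q in
     coproduct X a b \<ni>: pair (ob X) (\<lambda>s. \<^bold>\<Sigma> k : hm X a s. \<^bold>\<Sigma> l : hm X b s. universal X s a b k l) s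
       (pair (hm X a s) (\<lambda>k. \<^bold>\<Sigma> l : hm X b s. universal X s a b k l) k
         (pair (hm X b s) (\<lambda>l. universal X s a b k l) l
           (glob 81 universal_inclusions_d $ X $ H $ n $ m $ N $ il $ ir $ D $ w $ x $ p $ y $ q))))"
lemmas coproduct_fin_eval [ev] = coproduct_fin_d_def[THEN declared, unfolded defn]
lemma coproduct_fin_ok [oks]: "ok_glob i 83 coproduct_fin_d"
  by (rule ok_GlI; simp only: ev oks cong: congs)

text \<open>\<open>fin_sum_exists_d\<close> gives an untruncated witness, so the coproducts are
  produced by a function and no choice is made.\<close>

definition coproducts_d where
  "coproducts_d = (\<Xi> X : TY. \<Xi> H : isone X. \<Xi> a : ob X. \<Xi> b : ob X. coproduct X a b \<ni>:
     indS Nt (\<lambda>n. fin n \<Rrightarrow> X) (\<Lambda> a : ob X. coproduct X a b) (\<Lambda> n : Nt. \<Lambda> x : fin n \<Rrightarrow> X.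
     indS Nt (\<lambda>n. fin n \<Rrightarrow> X) (\<Lambda> b : ob X. coproduct X (mk_ob X n x) b) (\<Lambda> m : Nt. \<Lambda> y : fin m \<Rrightarrow> X.
       ind_fin_sum 0 n m (coproduct X (mk_ob X n x) (mk_ob X m y))
         (\<lambda>N il ir D. glob 83 coproduct_fin_d $ X $ H $ n $ m $ N $ il $ ir $ D $ x $ y) (glob 68 fin_sum_exists_d $ n $ m)) b) a)"
lemmas coproducts_eval [ev] = coproducts_d_def[THEN declared, unfolded defn]
lemma coproducts_ok [oks]: "ok_glob i 84 coproducts_d"
  by (rule ok_GlI; simp only: ev oks cong: congs)

section \<open>Siftedness\<close>

abbreviation (input) "trn A \<equiv> kon CTrunc $ A"
abbreviation (input) "tru A a \<equiv> kon CTr $ A $ a"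
abbreviation (input) "fs A B z \<equiv> fst' A (\<lambda>_. B) z"
abbreviation (input) "sn A B z \<equiv> snd' A (\<lambda>_. B) z"
abbreviation (input) "mkp A B a b \<equiv> pair A (\<lambda>_. B) a b"
abbreviation (input) "indN1 C c s n \<equiv> rCST 0 (Suc 0) CIndNat $ C $ c $ s $ n"

section \<open>Zig-zags and connectedness\<close>

definition zigzag_pos_d where
  "zigzag_pos_d = (\<Xi> Q : TY. \<Xi> H : Q \<Rrightarrow> Q \<Rrightarrow> TY. \<Xi> n : Nt. Q \<Rrightarrow> Q \<Rrightarrow> TY \<ni>: indN1 (\<Lambda> n : Nt. Q \<Rrightarrow> Q \<Rrightarrow> TY)
     (\<Lambda> c : Q. \<Lambda> c' : Q. \<^bold>\<Sigma> d : Q. H $ c $ d \<^bold>\<times> H $ c' $ d)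
     (\<Lambda> n : Nt. \<Lambda> Z : Q \<Rrightarrow> Q \<Rrightarrow> TY. \<Lambda> c : Q. \<Lambda> c' : Q. \<^bold>\<Sigma> d : Q. \<^bold>\<Sigma> e : Q. H $ c $ d \<^bold>\<times> H $ e $ d \<^bold>\<times> Z $ e $ c') n)"
lemmas zigzag_pos_eval [ev] = zigzag_pos_d_def[THEN declared, unfolded defn]
lemma zigzag_pos_ok [oks]: "ok_glob i 85 zigzag_pos_d"
  by (rule ok_GlI; simp only: ev oks cong: congs)
abbreviation (input) "zzp Q H n \<equiv> glob 85 zigzag_pos_d $ Q $ H $ n"

definition zigzag_d where
  "zigzag_d = (\<Xi> Q : TY. \<Xi> H : Q \<Rrightarrow> Q \<Rrightarrow> TY. \<Xi> n : Nt. Q \<Rrightarrow> Q \<Rrightarrow> TY \<ni>: indN1 (\<Lambda> n : Nt. Q \<Rrightarrow> Q \<Rrightarrow> TY)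
     (\<Lambda> c : Q. \<Lambda> c' : Q. c \<sim>\<^bsub>Q\<^esub> c') (\<Lambda> n : Nt. \<Lambda> Z : Q \<Rrightarrow> Q \<Rrightarrow> TY. zzp Q H n) n)"
lemmas zigzag_eval [ev] = zigzag_d_def[THEN declared, unfolded defn]
lemma zigzag_ok [oks]: "ok_glob i 86 zigzag_d"
  by (rule ok_GlI; simp only: ev oks cong: congs)
abbreviation (input) "zz Q H n \<equiv> glob 86 zigzag_d $ Q $ H $ n"

text \<open>The notions once more without names: the erasure of \<open>connected_d\<close> has to be
  literally the function inside \<open>is_connected\<close>, where zig-zags are written out.\<close>

abbreviation (input) "rzzp Q H n \<equiv> indN1 (\<Lambda> n : Nt. Q \<Rrightarrow> Q \<Rrightarrow> TY)
     (\<Lambda> c : Q. \<Lambda> c' : Q. \<^bold>\<Sigma> d : Q. H $ c $ d \<^bold>\<times> H $ c' $ d)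
     (\<Lambda> n : Nt. \<Lambda> Z : Q \<Rrightarrow> Q \<Rrightarrow> TY. \<Lambda> c : Q. \<Lambda> c' : Q. \<^bold>\<Sigma> d : Q. \<^bold>\<Sigma> e : Q. H $ c $ d \<^bold>\<times> H $ e $ d \<^bold>\<times> Z $ e $ c') n"
abbreviation (input) "rzz Q H n \<equiv> indN1 (\<Lambda> n : Nt. Q \<Rrightarrow> Q \<Rrightarrow> TY)
     (\<Lambda> c : Q. \<Lambda> c' : Q. c \<sim>\<^bsub>Q\<^esub> c') (\<Lambda> n : Nt. \<Lambda> Z : Q \<Rrightarrow> Q \<Rrightarrow> TY. rzzp Q H n) n"
definition connected_d where
  "connected_d = (\<Xi> Q : TY. \<Xi> H : Q \<Rrightarrow> Q \<Rrightarrow> TY. TY \<ni>: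
     trn Q \<^bold>\<times> (\<^bold>\<Pi> c : Q. \<^bold>\<Pi> c' : Q. trn (\<^bold>\<Sigma> n : Nt. rzz Q H n $ c $ c')))"
lemmas connected_eval [ev] = connected_d_def[THEN declared, unfolded defn]
lemma connected_ok [oks]: "ok_glob i 87 connected_d"
  by (rule ok_GlI; simp only: ev oks cong: congs)
abbreviation (input) "conn Q H \<equiv> glob 87 connected_d $ Q $ H"

section \<open>The square of a precategory and the slices of its diagonal\<close>

abbreviation (input) "sq Q \<equiv> Q \<^bold>\<times> Q"
abbreviation (input) "dg Q a \<equiv> mkp Q Q a a"

definition square_hom_d where
  "square_hom_d = (\<Xi> Q : TY. \<Xi> H : Q \<Rrightarrow> Q \<Rrightarrow> TY. \<Xi> x : sq Q. \<Xi> y : sq Q. TY \<ni>: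
     H $ fs Q Q x $ fs Q Q y \<^bold>\<times> H $ sn Q Q x $ sn Q Q y)"
lemmas square_hom_eval [ev] = square_hom_d_def[THEN declared, unfolded defn]
lemma square_hom_ok [oks]: "ok_glob i 88 square_hom_d"
  by (rule ok_GlI; simp only: ev oks cong: congs)
abbreviation (input) "ph Q H x y \<equiv> glob 88 square_hom_d $ Q $ H $ x $ y"

abbreviation (input) "comty Q H \<equiv> (\<^bold>\<Pi> a : Q. \<^bold>\<Pi> b : Q. \<^bold>\<Pi> c : Q. H $ b $ c \<Rrightarrow> H $ a $ b \<Rrightarrow> H $ a $ c)"

definition square_comp_d where
  "square_comp_d = (\<Xi> Q : TY. \<Xi> H : Q \<Rrightarrow> Q \<Rrightarrow> TY. \<Xi> M : comty Q H. \<Xi> x : sq Q. \<Xi> y : sq Q. \<Xi> z : sq Q. \<Xi> g : ph Q H y z. \<Xi> f : ph Q H x y.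
     let p = fs Q Q; q = sn Q Q; h = \<lambda>x y. H $ p x $ p y; k = \<lambda>x y. H $ q x $ q y in
     ph Q H x z \<ni>: mkp (h x z) (k x z) (M $ p x $ p y $ p z $ fs (h y z) (k y z) g $ fs (h x y) (k x y) f)
       (M $ q x $ q y $ q z $ sn (h y z) (k y z) g $ sn (h x y) (k x y) f))"
lemmas square_comp_eval [ev] = square_comp_d_def[THEN declared, unfolded defn]
lemma square_comp_ok [oks]: "ok_glob i 89 square_comp_d"
  by (rule ok_GlI; simp only: ev oks cong: congs)
abbreviation (input) "pc Q H M x y z g f \<equiv> glob 89 square_comp_d $ Q $ H $ M $ x $ y $ z $ g $ f"

definition slice_ob_d where
  "slice_ob_d = (\<Xi> Q : TY. \<Xi> H : Q \<Rrightarrow> Q \<Rrightarrow> TY. \<Xi> c : sq Q. TY \<ni>: \<^bold>\<Sigma> a : Q. ph Q H c (dg Q a))"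
lemmas slice_ob_eval [ev] = slice_ob_d_def[THEN declared, unfolded defn]
lemma slice_ob_ok [oks]: "ok_glob i 90 slice_ob_d"
  by (rule ok_GlI; simp only: ev oks cong: congs)
abbreviation (input) "sob Q H c \<equiv> glob 90 slice_ob_d $ Q $ H $ c"
abbreviation (input) "so1 Q H c x \<equiv> fst' Q (\<lambda>a. ph Q H c (dg Q a)) x"
abbreviation (input) "so2 Q H c x \<equiv> snd' Q (\<lambda>a. ph Q H c (dg Q a)) x"

definition slice_eq_d where
  "slice_eq_d = (\<Xi> Q : TY. \<Xi> H : Q \<Rrightarrow> Q \<Rrightarrow> TY. \<Xi> M : comty Q H. \<Xi> c : sq Q. \<Xi> x : sob Q H c. \<Xi> y : sob Q H c.
     let a = so1 Q H c x; b = so1 Q H c y in \<Xi> f : H $ a $ b. TY \<ni>: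
       pc Q H M c (dg Q a) (dg Q b) (mkp (H $ a $ b) (H $ a $ b) f f) (so2 Q H c x) \<sim>\<^bsub>(ph Q H c (dg Q b))\<^esub> so2 Q H c y)"
lemmas slice_eq_eval [ev] = slice_eq_d_def[THEN declared, unfolded defn]
lemma slice_eq_ok [oks]: "ok_glob i 91 slice_eq_d"
  by (rule ok_GlI; simp only: ev oks cong: congs)
abbreviation (input) "sheq Q H M c x y \<equiv> \<lambda>f. glob 91 slice_eq_d $ Q $ H $ M $ c $ x $ y $ f"

definition slice_hom_d where
  "slice_hom_d = (\<Xi> Q : TY. \<Xi> H : Q \<Rrightarrow> Q \<Rrightarrow> TY. \<Xi> M : comty Q H. \<Xi> c : sq Q. \<Xi> x : sob Q H c. \<Xi> y : sob Q H c. TY \<ni>: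
     sg (H $ so1 Q H c x $ so1 Q H c y) (sheq Q H M c x y))"
lemmas slice_hom_eval [ev] = slice_hom_d_def[THEN declared, unfolded defn]
lemma slice_hom_ok [oks]: "ok_glob i 92 slice_hom_d"
  by (rule ok_GlI; simp only: ev oks cong: congs)
abbreviation (input) "shom Q H M c \<equiv> glob 92 slice_hom_d $ Q $ H $ M $ c"

text \<open>The hypotheses on the projections of \<open>z\<close> are part of the motive, so that
  they become hypotheses on \<open>a\<close> and \<open>b\<close> when \<open>z\<close> is
  split.\<close>

definition pair_eq_d where
  "pair_eq_d = (\<Xi> A : TY. \<Xi> B : TY. \<Xi> u : A. \<Xi> v : B. \<Xi> z : A \<^bold>\<times> B.
     let E = \<lambda>z. u \<sim>\<^bsub>A\<^esub> fs A B z \<Rrightarrow> v \<sim>\<^bsub>B\<^esub> sn A B z \<Rrightarrow> mkp A B u v \<sim>\<^bsub>(A \<^bold>\<times> B)\<^esub> z in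
     E z \<ni>: indS A (\<lambda>_. B) (\<Lambda> z : A \<^bold>\<times> B. E z) (\<Lambda> a : A. \<Lambda> b : B. \<Lambda> e : u \<sim>\<^bsub>A\<^esub> a. \<Lambda> e' : v \<sim>\<^bsub>B\<^esub> b.
       cat (A \<^bold>\<times> B) (mkp A B u v) (mkp A B a v) (mkp A B a b) (ap A (A \<^bold>\<times> B) (\<Lambda> x : A. mkp A B x v) u a e)
         (ap B (A \<^bold>\<times> B) (\<Lambda> y : B. mkp A B a y) v b e')) z)"
lemmas pair_eq_eval [ev] = pair_eq_d_def[THEN declared, unfolded defn]
lemma pair_eq_ok [oks]: "ok_glob i 93 pair_eq_d"
  by (rule ok_GlI; simp only: ev oks cong: congs)
abbreviation (input) "pair_eq A B u v z e e' \<equiv> glob 93 pair_eq_d $ A $ B $ u $ v $ z $ e $ e'"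

section \<open>Coproduct cocones and connected slices\<close>

definition cat_mediates_d where
  "cat_mediates_d = (\<Xi> Q : TY. \<Xi> H : Q \<Rrightarrow> Q \<Rrightarrow> TY. \<Xi> M : comty Q H. \<Xi> s : Q. \<Xi> a : Q. \<Xi> b : Q. \<Xi> k : H $ a $ s. \<Xi> l : H $ b $ s.
     \<Xi> d : Q. \<Xi> f : H $ a $ d. \<Xi> g : H $ b $ d. \<Xi> h : H $ s $ d. TY \<ni>:
     ((M $ a $ s $ d $ h $ k) \<sim>\<^bsub>(H $ a $ d)\<^esub> f) \<^bold>\<times> ((M $ b $ s $ d $ h $ l) \<sim>\<^bsub>(H $ b $ d)\<^esub> g))"
lemmas cat_mediates_eval [ev] = cat_mediates_d_def[THEN declared, unfolded defn]
lemma cat_mediates_ok [oks]: "ok_glob i 94 cat_mediates_d"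
  by (rule ok_GlI; simp only: ev oks cong: congs)
abbreviation (input) "cat_mediates Q H M s a b k l d f g h \<equiv> glob 94 cat_mediates_d $ Q $ H $ M $ s $ a $ b $ k $ l $ d $ f $ g $ h"

definition cat_universal_d where
  "cat_universal_d = (\<Xi> Q : TY. \<Xi> H : Q \<Rrightarrow> Q \<Rrightarrow> TY. \<Xi> M : comty Q H. \<Xi> s : Q. \<Xi> a : Q. \<Xi> b : Q. \<Xi> k : H $ a $ s. \<Xi> l : H $ b $ s. TY \<ni>:
     \<^bold>\<Pi> d : Q. \<^bold>\<Pi> f : H $ a $ d. \<^bold>\<Pi> g : H $ b $ d. iscontr (\<^bold>\<Sigma> h : H $ s $ d. cat_mediates Q H M s a b k l d f g h))"
lemmas cat_universal_eval [ev] = cat_universal_d_def[THEN declared, unfolded defn]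
lemma cat_universal_ok [oks]: "ok_glob i 95 cat_universal_d"
  by (rule ok_GlI; simp only: ev oks cong: congs)
abbreviation (input) "cat_universal Q H M s a b k l \<equiv> glob 95 cat_universal_d $ Q $ H $ M $ s $ a $ b $ k $ l"

definition copair_d where
  "copair_d = (\<Xi> Q : TY. \<Xi> H : Q \<Rrightarrow> Q \<Rrightarrow> TY. \<Xi> M : comty Q H. \<Xi> s : Q. \<Xi> a : Q. \<Xi> b : Q. \<Xi> k : H $ a $ s. \<Xi> l : H $ b $ s.
     \<Xi> P : cat_universal Q H M s a b k l. \<Xi> d : Q. \<Xi> f : H $ a $ d. \<Xi> g : H $ b $ d.
     let S = sg (H $ s $ d) (cat_mediates Q H M s a b k l d f g) in
     S \<ni>: fst' S (\<lambda>x. \<^bold>\<Pi> y : S. x \<sim>\<^bsub>S\<^esub> y) (P $ d $ f $ g))"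
lemmas copair_eval [ev] = copair_d_def[THEN declared, unfolded defn]
lemma copair_ok [oks]: "ok_glob i 96 copair_d"
  by (rule ok_GlI; simp only: ev oks cong: congs)
abbreviation (input) "copair Q H M s a b k l P d f g \<equiv> glob 96 copair_d $ Q $ H $ M $ s $ a $ b $ k $ l $ P $ d $ f $ g"

definition copair_hom_d where
  "copair_hom_d = (\<Xi> Q : TY. \<Xi> H : Q \<Rrightarrow> Q \<Rrightarrow> TY. \<Xi> M : comty Q H. \<Xi> s : Q. \<Xi> a : Q. \<Xi> b : Q. \<Xi> k : H $ a $ s. \<Xi> l : H $ b $ s.
     \<Xi> P : cat_universal Q H M s a b k l. \<Xi> d : Q. \<Xi> f : H $ a $ d. \<Xi> g : H $ b $ d. H $ s $ d \<ni>:
       fst' (H $ s $ d) (cat_mediates Q H M s a b k l d f g) (copair Q H M s a b k l P d f g))"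
lemmas copair_hom_eval [ev] = copair_hom_d_def[THEN declared, unfolded defn]
lemma copair_hom_ok [oks]: "ok_glob i 97 copair_hom_d"
  by (rule ok_GlI; simp only: ev oks cong: congs)
abbreviation (input) "copair_hom Q H M s a b k l P d f g \<equiv> glob 97 copair_hom_d $ Q $ H $ M $ s $ a $ b $ k $ l $ P $ d $ f $ g"

definition copair_mediates_d where
  "copair_mediates_d = (\<Xi> Q : TY. \<Xi> H : Q \<Rrightarrow> Q \<Rrightarrow> TY. \<Xi> M : comty Q H. \<Xi> s : Q. \<Xi> a : Q. \<Xi> b : Q. \<Xi> k : H $ a $ s. \<Xi> l : H $ b $ s.
     \<Xi> P : cat_universal Q H M s a b k l. \<Xi> d : Q. \<Xi> f : H $ a $ d. \<Xi> g : H $ b $ d.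
     cat_mediates Q H M s a b k l d f g (copair_hom Q H M s a b k l P d f g) \<ni>:
       snd' (H $ s $ d) (cat_mediates Q H M s a b k l d f g) (copair Q H M s a b k l P d f g))"
lemmas copair_mediates_eval [ev] = copair_mediates_d_def[THEN declared, unfolded defn]
lemma copair_mediates_ok [oks]: "ok_glob i 98 copair_mediates_d"
  by (rule ok_GlI; simp only: ev oks cong: congs)
abbreviation (input) "copair_mediates Q H M s a b k l P d f g \<equiv> glob 98 copair_mediates_d $ Q $ H $ M $ s $ a $ b $ k $ l $ P $ d $ f $ g"

definition copair_eq_d where
  "copair_eq_d = (\<Xi> Q : TY. \<Xi> H : Q \<Rrightarrow> Q \<Rrightarrow> TY. \<Xi> M : comty Q H. \<Xi> s : Q. \<Xi> a : Q. \<Xi> b : Q. \<Xi> k : H $ a $ s. \<Xi> l : H $ b $ s.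
     \<Xi> P : cat_universal Q H M s a b k l. \<Xi> d : Q.
     let A = H $ a $ d; B = H $ b $ d in \<Xi> z : A \<^bold>\<times> B.
     let f = fs A B z; g = sn A B z; h = copair_hom Q H M s a b k l P d f g; m = M $ a $ s $ d $ h $ k; n = M $ b $ s $ d $ h $ l;
       w = copair_mediates Q H M s a b k l P d f g in
     mkp A B m n \<sim>\<^bsub>(A \<^bold>\<times> B)\<^esub> z \<ni>: pair_eq A B m n z (fs (m \<sim>\<^bsub>A\<^esub> f) (n \<sim>\<^bsub>B\<^esub> g) w) (sn (m \<sim>\<^bsub>A\<^esub> f) (n \<sim>\<^bsub>B\<^esub> g) w))"
lemmas copair_eq_eval [ev] = copair_eq_d_def[THEN declared, unfolded defn]
lemma copair_eq_ok [oks]: "ok_glob i 99 copair_eq_d"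
  by (rule ok_GlI; simp only: ev oks cong: congs)

text \<open>\<open>oo\<close> is the cocone regarded as an object of the slice. The triangle
  required of a slice morphism is the pair of the two mediating equations.\<close>

definition slice_copair_d where
  "slice_copair_d = (\<Xi> Q : TY. \<Xi> H : Q \<Rrightarrow> Q \<Rrightarrow> TY. \<Xi> M : comty Q H. \<Xi> c : sq Q.
     let u = fs Q Q c; v = sn Q Q c in \<Xi> s : Q. \<Xi> k : H $ u $ s. \<Xi> l : H $ v $ s. \<Xi> P : cat_universal Q H M s u v k l. \<Xi> x : sob Q H c.
     let oo = pair Q (\<lambda>a. ph Q H c (dg Q a)) s (mkp (H $ u $ s) (H $ v $ s) k l);
       a = so1 Q H c x; A = H $ u $ a; B = H $ v $ a; z = so2 Q H c x in
     shom Q H M c $ oo $ x \<ni>: pair (H $ s $ a) (sheq Q H M c oo x) (copair_hom Q H M s u v k l P a (fs A B z) (sn A B z))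
       (glob 99 copair_eq_d $ Q $ H $ M $ s $ u $ v $ k $ l $ P $ a $ z))"
lemmas slice_copair_eval [ev] = slice_copair_d_def[THEN declared, unfolded defn]
lemma slice_copair_ok [oks]: "ok_glob i 100 slice_copair_d"
  by (rule ok_GlI; simp only: ev oks cong: congs)

definition unit_pair_d where
  "unit_pair_d = (\<Xi> Q : TY. \<Xi> H : Q \<Rrightarrow> Q \<Rrightarrow> TY. \<Xi> M : comty Q H. \<Xi> I : (\<^bold>\<Pi> a : Q. H $ a $ a).
     \<Xi> L : (\<^bold>\<Pi> a : Q. \<^bold>\<Pi> b : Q. \<^bold>\<Pi> f : H $ a $ b. f \<sim>\<^bsub>(H $ a $ b)\<^esub> (M $ a $ b $ b $ (I $ b) $ f)).
     \<Xi> u : Q. \<Xi> v : Q. \<Xi> a : Q. let A = H $ u $ a; B = H $ v $ a in \<Xi> z : A \<^bold>\<times> B.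
     let m = \<lambda>u f. M $ u $ a $ a $ (I $ a) $ f; f = fs A B z; g = sn A B z in
     mkp A B (m u f) (m v g) \<sim>\<^bsub>(A \<^bold>\<times> B)\<^esub> z \<ni>:
       pair_eq A B (m u f) (m v g) z (opp A f (m u f) (L $ u $ a $ f)) (opp B g (m v g) (L $ v $ a $ g)))"
lemmas unit_pair_eval [ev] = unit_pair_d_def[THEN declared, unfolded defn]
lemma unit_pair_ok [oks]: "ok_glob i 101 unit_pair_d"
  by (rule ok_GlI; simp only: ev oks cong: congs)

text \<open>The outer arrows of a zig-zag point away from its ends, while the morphisms out of the
  cocone point towards them. Identities fill these places, and the left unit law gives their
  triangles.\<close>

definition slice_ident_d where
  "slice_ident_d = (\<Xi> Q : TY. \<Xi> H : Q \<Rrightarrow> Q \<Rrightarrow> TY. \<Xi> M : comty Q H. \<Xi> I : (\<^bold>\<Pi> a : Q. H $ a $ a).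
     \<Xi> L : (\<^bold>\<Pi> a : Q. \<^bold>\<Pi> b : Q. \<^bold>\<Pi> f : H $ a $ b. f \<sim>\<^bsub>(H $ a $ b)\<^esub> (M $ a $ b $ b $ (I $ b) $ f)).
     \<Xi> c : sq Q. \<Xi> x : sob Q H c. let a = so1 Q H c x in
     shom Q H M c $ x $ x \<ni>: pair (H $ a $ a) (sheq Q H M c x x) (I $ a)
       (glob 101 unit_pair_d $ Q $ H $ M $ I $ L $ fs Q Q c $ sn Q Q c $ a $ so2 Q H c x))"
lemmas slice_ident_eval [ev] = slice_ident_d_def[THEN declared, unfolded defn]
lemma slice_ident_ok [oks]: "ok_glob i 102 slice_ident_d"
  by (rule ok_GlI; simp only: ev oks cong: congs)

text \<open>The numeral is two because the zig-zag has length 2. One successor is consumed by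
  \<open>zz\<close>, which treats length 0 separately; \<open>zzp\<close> at one is a step
  \<open>x\<close> to \<open>x\<close> from \<open>oo\<close>, followed by the cospan
  \<open>oo\<close> to \<open>y\<close> from \<open>y\<close>.\<close>

definition slice_connected_d where
  "slice_connected_d = (\<Xi> Q : TY. \<Xi> H : Q \<Rrightarrow> Q \<Rrightarrow> TY. \<Xi> M : comty Q H. \<Xi> I : (\<^bold>\<Pi> a : Q. H $ a $ a).
     \<Xi> L : (\<^bold>\<Pi> a : Q. \<^bold>\<Pi> b : Q. \<^bold>\<Pi> f : H $ a $ b. f \<sim>\<^bsub>(H $ a $ b)\<^esub> (M $ a $ b $ b $ (I $ b) $ f)).
     \<Xi> c : sq Q.
     let u = fs Q Q c; v = sn Q Q c in \<Xi> s : Q. \<Xi> k : H $ u $ s. \<Xi> l : H $ v $ s. \<Xi> P : cat_universal Q H M s u v k l.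
     let S = sob Q H c; R = shom Q H M c; r = \<lambda>x y. R $ x $ y; oo = pair Q (\<lambda>a. ph Q H c (dg Q a)) s (mkp (H $ u $ s) (H $ v $ s) k l);
       i = \<lambda>x. glob 102 slice_ident_d $ Q $ H $ M $ I $ L $ c $ x; j = \<lambda>x. glob 100 slice_copair_d $ Q $ H $ M $ c $ s $ k $ l $ P $ x;
       Z = \<lambda>e y. (\<^bold>\<Sigma> d : S. r e d \<^bold>\<times> r y d) in
     conn S R \<ni>: mkp (trn S) (\<^bold>\<Pi> x : S. \<^bold>\<Pi> y : S. trn (\<^bold>\<Sigma> n : Nt. zz S R n $ x $ y)) (tru S oo)
       (\<Lambda> x : S. \<Lambda> y : S. tru (\<^bold>\<Sigma> n : Nt. zz S R n $ x $ y) (pair Nt (\<lambda>n. zz S R n $ x $ y) (suc (suc (kon CZero)))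
         (pair S (\<lambda>d. \<^bold>\<Sigma> e : S. r x d \<^bold>\<times> r e d \<^bold>\<times> Z e y) x
           (pair S (\<lambda>e. r x x \<^bold>\<times> r e x \<^bold>\<times> Z e y) oo
             (mkp (r x x) (r oo x \<^bold>\<times> Z oo y) (i x)
               (mkp (r oo x) (Z oo y) (j x)
                 (pair S (\<lambda>d. r oo d \<^bold>\<times> r y d) y (mkp (r oo y) (r y y) (j y) (i y))))))))))"
lemmas slice_connected_eval [ev] = slice_connected_d_def[THEN declared, unfolded defn]
lemma slice_connected_ok [oks]: "ok_glob i 103 slice_connected_d"
  by (rule ok_GlI; simp only: ev oks cong: congs)

definition slices_connected_d where
  "slices_connected_d = (\<Xi> Q : TY. \<Xi> H : Q \<Rrightarrow> Q \<Rrightarrow> TY. \<Xi> M : comty Q H. \<Xi> I : (\<^bold>\<Pi> a : Q. H $ a $ a).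
     \<Xi> L : (\<^bold>\<Pi> a : Q. \<^bold>\<Pi> b : Q. \<^bold>\<Pi> f : H $ a $ b. f \<sim>\<^bsub>(H $ a $ b)\<^esub> (M $ a $ b $ b $ (I $ b) $ f)).
     \<Xi> K : (\<^bold>\<Pi> a : Q. \<^bold>\<Pi> b : Q. \<^bold>\<Sigma> s : Q. \<^bold>\<Sigma> k : H $ a $ s. \<^bold>\<Sigma> l : H $ b $ s. cat_universal Q H M s a b k l). \<Xi> c : sq Q.
     let u = fs Q Q c; v = sn Q Q c; T = conn (sob Q H c) (shom Q H M c); A3 = \<lambda>s k l. cat_universal Q H M s u v k l;
       A2 = \<lambda>s k. sg (H $ v $ s) (A3 s k); A1 = \<lambda>s. sg (H $ u $ s) (A2 s) in
     T \<ni>: indS Q A1 (\<Lambda> x : sg Q A1. T) (\<Lambda> s : Q. \<Lambda> x : A1 s. indS (H $ u $ s) (A2 s) (\<Lambda> x : A1 s. T) (\<Lambda> k : H $ u $ s. \<Lambda> x : A2 s k.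
       indS (H $ v $ s) (A3 s k) (\<Lambda> x : A2 s k. T) (\<Lambda> l : H $ v $ s. \<Lambda> P : A3 s k l.
         glob 103 slice_connected_d $ Q $ H $ M $ I $ L $ c $ s $ k $ l $ P) x) x) (K $ u $ v))"
lemmas slices_connected_eval [ev] = slices_connected_d_def[THEN declared, unfolded defn]
lemma slices_connected_ok [oks]: "ok_glob i 104 slices_connected_d"
  by (rule ok_GlI; simp only: ev oks cong: congs)

section \<open>The precategory \<open>HX\<close>\<close>

text \<open>Predicates that the statement expands in place are written out here as well, since
  \<open>er_goalX\<close> is an equality of terms. The named versions are convertible to
  them.\<close>

abbreviation (input) "rset A \<equiv> (\<^bold>\<Pi> x : A. \<^bold>\<Pi> y : A. \<^bold>\<Pi> p : x \<sim>\<^bsub>A\<^esub> y. \<^bold>\<Pi> q : x \<sim>\<^bsub>A\<^esub> y. p \<sim>\<^bsub>(x \<sim>\<^bsub>A\<^esub> y)\<^esub> q)"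
abbreviation (input) "rone A \<equiv> (\<^bold>\<Pi> x : A. \<^bold>\<Pi> y : A. \<^bold>\<Pi> p : x \<sim>\<^bsub>A\<^esub> y. \<^bold>\<Pi> q : x \<sim>\<^bsub>A\<^esub> y.
  \<^bold>\<Pi> r : p \<sim>\<^bsub>(x \<sim>\<^bsub>A\<^esub> y)\<^esub> q. \<^bold>\<Pi> s : p \<sim>\<^bsub>(x \<sim>\<^bsub>A\<^esub> y)\<^esub> q. r \<sim>\<^bsub>(p \<sim>\<^bsub>(x \<sim>\<^bsub>A\<^esub> y)\<^esub> q)\<^esub> s)"
abbreviation (input) "rcontr A \<equiv> (\<^bold>\<Sigma> x : A. \<^bold>\<Pi> y : A. x \<sim>\<^bsub>A\<^esub> y)"

definition precategory_d where
  "precategory_d = (\<Xi> Q : TY. \<Xi> H : Q \<Rrightarrow> Q \<Rrightarrow> TY. \<Xi> I : (\<^bold>\<Pi> a : Q. H $ a $ a). \<Xi> M : comty Q H. TY \<ni>: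
     (\<^bold>\<Pi> a : Q. \<^bold>\<Pi> b : Q. rset (H $ a $ b))
     \<^bold>\<times> (\<^bold>\<Pi> a : Q. \<^bold>\<Pi> b : Q. \<^bold>\<Pi> f : H $ a $ b. f \<sim>\<^bsub>(H $ a $ b)\<^esub> (M $ a $ a $ b $ f $ (I $ a)))
     \<^bold>\<times> (\<^bold>\<Pi> a : Q. \<^bold>\<Pi> b : Q. \<^bold>\<Pi> f : H $ a $ b. f \<sim>\<^bsub>(H $ a $ b)\<^esub> (M $ a $ b $ b $ (I $ b) $ f))
     \<^bold>\<times> (\<^bold>\<Pi> a : Q. \<^bold>\<Pi> b : Q. \<^bold>\<Pi> c : Q. \<^bold>\<Pi> d : Q. \<^bold>\<Pi> f : H $ a $ b. \<^bold>\<Pi> g : H $ b $ c. \<^bold>\<Pi> h : H $ c $ d.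
          (M $ a $ c $ d $ h $ (M $ a $ b $ c $ g $ f)) \<sim>\<^bsub>(H $ a $ d)\<^esub> (M $ a $ b $ d $ (M $ b $ c $ d $ h $ g) $ f)))"
lemmas precategory_eval [ev] = precategory_d_def[THEN declared, unfolded defn]
lemma precategory_ok [oks]: "ok_glob i 105 precategory_d"
  by (rule ok_GlI; simp only: ev oks cong: congs)

definition finite_coproducts_d where
  "finite_coproducts_d = (\<Xi> Q : TY. \<Xi> H : Q \<Rrightarrow> Q \<Rrightarrow> TY. \<Xi> I : (\<^bold>\<Pi> a : Q. H $ a $ a). \<Xi> M : comty Q H. TY \<ni>:
     (\<^bold>\<Sigma> z : Q. \<^bold>\<Pi> a : Q. rcontr (H $ z $ a))
     \<^bold>\<times> (\<^bold>\<Pi> a : Q. \<^bold>\<Pi> b : Q. \<^bold>\<Sigma> s : Q. \<^bold>\<Sigma> k : H $ a $ s. \<^bold>\<Sigma> l : H $ b $ s.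
       \<^bold>\<Pi> d : Q. \<^bold>\<Pi> f : H $ a $ d. \<^bold>\<Pi> g : H $ b $ d.
         rcontr (\<^bold>\<Sigma> h : H $ s $ d.
           ((M $ a $ s $ d $ h $ k) \<sim>\<^bsub>(H $ a $ d)\<^esub> f) \<^bold>\<times> ((M $ b $ s $ d $ h $ l) \<sim>\<^bsub>(H $ b $ d)\<^esub> g))))"
lemmas finite_coproducts_eval [ev] = finite_coproducts_d_def[THEN declared, unfolded defn]
lemma finite_coproducts_ok [oks]: "ok_glob i 106 finite_coproducts_d"
  by (rule ok_GlI; simp only: ev oks cong: congs)

text \<open>The redexes are intended: product, diagonal and slices stand here unreduced as in
  \<open>is_sifted\<close>. Conversion identifies them with the tidier \<open>sob\<close> and
  \<open>shom\<close> in \<open>coproducts_sifted_d\<close>.\<close>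

definition sifted_d where
  "sifted_d = (\<Xi> Q : TY. \<Xi> H : Q \<Rrightarrow> Q \<Rrightarrow> TY. \<Xi> I : (\<^bold>\<Pi> a : Q. H $ a $ a). \<Xi> M : comty Q H. TY \<ni>:
    (let S = Q \<^bold>\<times> Q; p = fs Q Q; q = sn Q Q; h = \<lambda>x y. H $ p x $ p y; k = \<lambda>x y. H $ q x $ q y;
       hom = (\<Lambda> x : S. \<Lambda> y : S. h x y \<^bold>\<times> k x y);
       cmp = (\<Lambda> x : S. \<Lambda> y : S. \<Lambda> z : S. \<Lambda> g : h y z \<^bold>\<times> k y z. \<Lambda> f : h x y \<^bold>\<times> k x y.
         mkp (h x z) (k x z) (M $ p x $ p y $ p z $ fs (h y z) (k y z) g $ fs (h x y) (k x y) f)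
           (M $ q x $ q y $ q z $ sn (h y z) (k y z) g $ sn (h x y) (k x y) f));
       dob = (\<Lambda> a : Q. mkp Q Q a a);
       dmor = (\<Lambda> a : Q. \<Lambda> b : Q. \<Lambda> f : H $ a $ b. mkp (H $ a $ b) (H $ a $ b) f f);
       B = \<lambda>c a. hom $ c $ (dob $ a);
       sob = \<lambda>c. (\<^bold>\<Sigma> a : Q. B c a);
       shom = \<lambda>c. (\<Lambda> x : sob c. \<Lambda> y : sob c. \<^bold>\<Sigma> f : H $ fst' Q (B c) x $ fst' Q (B c) y.
         (cmp $ c $ (dob $ fst' Q (B c) x) $ (dob $ fst' Q (B c) y) $ (dmor $ fst' Q (B c) x $ fst' Q (B c) y $ f) $ snd' Q (B c) x)
         \<sim>\<^bsub>(hom $ c $ (dob $ fst' Q (B c) y))\<^esub> snd' Q (B c) y)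
     in trn Q \<^bold>\<times> (\<^bold>\<Pi> c : S. conn (sob c) (shom c))))"
lemmas sifted_eval [ev] = sifted_d_def[THEN declared, unfolded defn]
lemma sifted_ok [oks]: "ok_glob i 107 sifted_d"
  by (rule ok_GlI; simp only: ev oks cong: congs)

abbreviation (input) "rprecategory Q H I M \<equiv> glob 105 precategory_d $ Q $ H $ I $ M"
abbreviation (input) "rcoproducts Q H I M \<equiv> glob 106 finite_coproducts_d $ Q $ H $ I $ M"
abbreviation (input) "rsifted Q H I M \<equiv> glob 107 sifted_d $ Q $ H $ I $ M"

text \<open>This and the definitions up to \<open>rComp\<close> spell out \<open>HX\<close>. A name
  would erase to a closed function applied to \<open>X\<close>, which is convertible to the
  component in the statement but not equal to it.\<close>

definition rfin :: "rex \<Rightarrow> rex" where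
  "rfin n = indN1 (\<Lambda> n : Nt. TY) Emp (\<Lambda> n : Nt. \<Lambda> F : TY. F \<^bold>+ One) n"

definition rOb :: "rex \<Rightarrow> rex" where
  "rOb X = sg Nt (\<lambda>n. rfin n \<Rrightarrow> X)"
definition rnum :: "rex \<Rightarrow> rex \<Rightarrow> rex" where
  "rnum X a = fst' Nt (\<lambda>n. rfin n \<Rrightarrow> X) a"
definition rfam :: "rex \<Rightarrow> rex \<Rightarrow> rex" where
  "rfam X a = snd' Nt (\<lambda>n. rfin n \<Rrightarrow> X) a"
definition rfn :: "rex \<Rightarrow> rex \<Rightarrow> rex \<Rightarrow> rex" where
  "rfn X a b = rfin (rnum X a) \<Rrightarrow> rfin (rnum X b)"
definition rpull :: "rex \<Rightarrow> rex \<Rightarrow> rex \<Rightarrow> rex \<Rightarrow> rex" where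
  "rpull X a y f = (\<Lambda> k : rfin (rnum X a). y $ (f $ k))"
definition rpth :: "rex \<Rightarrow> rex \<Rightarrow> rex \<Rightarrow> rex \<Rightarrow> rex" where
  "rpth X a b f = rfam X a \<sim>\<^bsub>(rfin (rnum X a) \<Rrightarrow> X)\<^esub> rpull X a (rfam X b) f"
definition rHom :: "rex \<Rightarrow> rex" where
  "rHom X = (\<Lambda> a : rOb X. \<Lambda> b : rOb X. sg (rfn X a b) (rpth X a b))"
definition rIdm :: "rex \<Rightarrow> rex" where
  "rIdm X = (\<Lambda> a : rOb X. pair (rfn X a a) (rpth X a a) (\<Lambda> k : rfin (rnum X a). k) (rf (rfin (rnum X a) \<Rrightarrow> X) (rfam X a)))"
definition rComp :: "rex \<Rightarrow> rex" where
  "rComp X = (\<Lambda> a : rOb X. \<Lambda> b : rOb X. \<Lambda> c : rOb X. \<Lambda> g : sg (rfn X b c) (rpth X b c). \<Lambda> f : sg (rfn X a b) (rpth X a b).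
             let f1 = fst' (rfn X a b) (rpth X a b) f; f2 = snd' (rfn X a b) (rpth X a b) f;
                 g1 = fst' (rfn X b c) (rpth X b c) g; g2 = snd' (rfn X b c) (rpth X b c) g; P = \<lambda>a. rfin (rnum X a) \<Rrightarrow> X
             in pair (rfn X a c) (rpth X a c) (\<Lambda> k : rfin (rnum X a). g1 $ (f1 $ k))
                  (cat (P a) (rfam X a) (rpull X a (rfam X b) f1) (rpull X a (rpull X b (rfam X c) g1) f1) f2
                    (ap (P b) (P a) (\<Lambda> y : P b. rpull X a y f1) (rfam X b) (rpull X b (rfam X c) g1) g2)))"
abbreviation (input) "HX_hom X \<equiv> glob 40 hom_d $ X"
abbreviation (input) "HX_comp X \<equiv> glob 44 comp_d $ X"
abbreviation (input) "HX_ident X \<equiv> glob 43 ident_d $ X"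

definition HX_precategory_d where
  "HX_precategory_d = (\<Xi> X : TY. \<Xi> h : isone X.
     let Q = ob X; H = HX_hom X; M = HX_comp X; I = HX_ident X;
      A1 = (\<^bold>\<Pi> a : Q. \<^bold>\<Pi> b : Q. rset (H $ a $ b));
      A2 = (\<^bold>\<Pi> a : Q. \<^bold>\<Pi> b : Q. \<^bold>\<Pi> f : H $ a $ b. f \<sim>\<^bsub>(H $ a $ b)\<^esub> (M $ a $ a $ b $ f $ (I $ a)));
      A3 = (\<^bold>\<Pi> a : Q. \<^bold>\<Pi> b : Q. \<^bold>\<Pi> f : H $ a $ b. f \<sim>\<^bsub>(H $ a $ b)\<^esub> (M $ a $ b $ b $ (I $ b) $ f));
      A4 = (\<^bold>\<Pi> a : Q. \<^bold>\<Pi> b : Q. \<^bold>\<Pi> c : Q. \<^bold>\<Pi> d : Q. \<^bold>\<Pi> f : H $ a $ b. \<^bold>\<Pi> g : H $ b $ c. \<^bold>\<Pi> h : H $ c $ d.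
          (M $ a $ c $ d $ h $ (M $ a $ b $ c $ g $ f)) \<sim>\<^bsub>(H $ a $ d)\<^esub> (M $ a $ b $ d $ (M $ b $ c $ d $ h $ g) $ f)) in
     rprecategory Q H I M \<ni>: mkp A1 (A2 \<^bold>\<times> A3 \<^bold>\<times> A4) (\<Lambda> a : Q. \<Lambda> b : Q. hom_set X h a b) (mkp A2 (A3 \<^bold>\<times> A4) (glob 57 right_unit_d $ X)
       (mkp A3 A4 (glob 58 left_unit_d $ X) (glob 59 assoc_d $ X))))"
lemmas HX_precategory_eval [ev] = HX_precategory_d_def[THEN declared, unfolded defn]
lemma HX_precategory_ok [oks]: "ok_glob i 108 HX_precategory_d"
  by (rule ok_GlI; simp only: ev oks cong: congs)

definition HX_coproducts_d where
  "HX_coproducts_d = (\<Xi> X : TY. \<Xi> h : isone X.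
     let A = (\<^bold>\<Sigma> z : ob X. \<^bold>\<Pi> a : ob X. iscontr (hm X z a)); B = (\<^bold>\<Pi> a : ob X. \<^bold>\<Pi> b : ob X. coproduct X a b) in
     rcoproducts (ob X) (HX_hom X) (HX_ident X) (HX_comp X) \<ni>: mkp A B (glob 60 initial_d $ X) (glob 84 coproducts_d $ X $ h))"
lemmas HX_coproducts_eval [ev] = HX_coproducts_d_def[THEN declared, unfolded defn]
lemma HX_coproducts_ok [oks]: "ok_glob i 109 HX_coproducts_d"
  by (rule ok_GlI; simp only: ev oks cong: congs)

text \<open>Stated for arbitrary data with left units, binary coproducts and an object, so the
  slices are checked with variables in place of the components of \<open>HX\<close>.\<close>

definition coproducts_sifted_d where
  "coproducts_sifted_d = (\<Xi> Q : TY. \<Xi> H : Q \<Rrightarrow> Q \<Rrightarrow> TY. \<Xi> I : (\<^bold>\<Pi> a : Q. H $ a $ a). \<Xi> M : comty Q H.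
     \<Xi> L : (\<^bold>\<Pi> a : Q. \<^bold>\<Pi> b : Q. \<^bold>\<Pi> f : H $ a $ b. f \<sim>\<^bsub>(H $ a $ b)\<^esub> (M $ a $ b $ b $ (I $ b) $ f)).
     \<Xi> K : (\<^bold>\<Pi> a : Q. \<^bold>\<Pi> b : Q. \<^bold>\<Sigma> s : Q. \<^bold>\<Sigma> k : H $ a $ s. \<^bold>\<Sigma> l : H $ b $ s. cat_universal Q H M s a b k l). \<Xi> z : Q.
     rsifted Q H I M \<ni>: mkp (trn Q) (\<^bold>\<Pi> c : sq Q. conn (sob Q H c) (shom Q H M c)) (tru Q z)
       (glob 104 slices_connected_d $ Q $ H $ M $ I $ L $ K))"
lemmas coproducts_sifted_eval [ev] = coproducts_sifted_d_def[THEN declared, unfolded defn]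
lemma coproducts_sifted_ok [oks]: "ok_glob i 110 coproducts_sifted_d"
  by (rule ok_GlI; simp only: ev oks cong: congs)

definition HX_sifted_d where
  "HX_sifted_d = (\<Xi> X : TY. \<Xi> h : isone X.
     let Q = ob X; H = HX_hom X; M = HX_comp X; I = HX_ident X in
     rsifted Q H I M \<ni>: glob 110 coproducts_sifted_d $ Q $ H $ I $ M $ (glob 58 left_unit_d $ X) $ (glob 84 coproducts_d $ X $ h)
       $ (mk_ob X (kon CZero) (\<Lambda> k : Emp. indE (\<Lambda> k : Emp. X) k)))"
lemmas HX_sifted_eval [ev] = HX_sifted_d_def[THEN declared, unfolded defn]
lemma HX_sifted_ok [oks]: "ok_glob i 111 HX_sifted_d"
  by (rule ok_GlI; simp only: ev oks cong: congs)

abbreviation (input) "claims X Q H I M \<equiv> rprecategory Q H I M \<^bold>\<times> rcoproducts Q H I M \<^bold>\<times> rsifted Q H I M"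

definition main_d where
  "main_d = (\<Xi> X : TY. \<Xi> h : rone X. let Q = ob X; H = HX_hom X; M = HX_comp X; I = HX_ident X;
      A = rprecategory Q H I M; B = rcoproducts Q H I M; C = rsifted Q H I M in
     claims X Q H I M \<ni>: mkp A (B \<^bold>\<times> C) (glob 108 HX_precategory_d $ X $ h) (mkp B C (glob 109 HX_coproducts_d $ X $ h) (glob 111 HX_sifted_d $ X $ h)))"
lemmas main_eval [ev] = main_d_def[THEN declared, unfolded defn]
lemma main_ok [oks]: "ok_glob i 112 main_d"
  by (rule ok_GlI; simp only: ev oks cong: congs)

text \<open>
  In \<open>HX\<close> the components of the precategory are written out (suffix \<open>X\<close>), while the proofs use
  their names (suffix \<open>G\<close>). The claim is a type in the context of the components
  of a precategory, so the two instances are convertible because the components are.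
\<close>

definition obX where "obX = rOb (rvar 0) (Suc (Suc 0))"
definition homX where "homX = rHom (rvar 0) (Suc (Suc 0))"
definition idmX where "idmX = rIdm (rvar 0) (Suc (Suc 0))"
definition compX where "compX = rComp (rvar 0) (Suc (Suc 0))"

lemmas X_raw = obX_def homX_def idmX_def compX_def
lemmas X_defs = rOb_def rHom_def rIdm_def rComp_def rfn_def[abs_def] rpth_def[abs_def] rnum_def rfam_def rpull_def rfin_def
lemmas X_eval = X_raw[unfolded X_defs hoas]

definition obG where "obG = ob (rvar 0) (Suc (Suc 0))"
definition homG where "homG = HX_hom (rvar 0) (Suc (Suc 0))"
definition idmG where "idmG = HX_ident (rvar 0) (Suc (Suc 0))"
definition compG where "compG = HX_comp (rvar 0) (Suc (Suc 0))"

lemmas G_eval = obG_def[unfolded hoas] homG_def[unfolded hoas] idmG_def[unfolded hoas] compG_def[unfolded hoas]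

definition claim where
  "claim = claims (rvar 0) (rvar 0) (rvar (Suc 0)) (rvar (Suc (Suc 0))) (rvar (Suc (Suc (Suc 0)))) (Suc (Suc (Suc (Suc 0))))"
definition homT where "homT = (rvar 0 \<Rrightarrow> rvar 0 \<Rrightarrow> TY) (Suc 0)"
definition idmT where "idmT = (\<^bold>\<Pi> a : rvar 0. rvar (Suc 0) $ a $ a) (Suc (Suc 0))"
definition compT where "compT = comty (rvar 0) (rvar (Suc 0)) (Suc (Suc (Suc 0)))"
definition oneX where "oneX = rone (rvar 0) (Suc 0)"

lemmas claim_eval = claim_def[unfolded hoas] homT_def[unfolded hoas] idmT_def[unfolded hoas] compT_def[unfolded hoas] oneX_def[unfolded hoas]

text \<open>The innermost variable of \<open>claim\<close> is the composition, hence it heads the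
  list.\<close>

definition goalX where "goalX = Pr (Ty 0) (Pr oneX (inst [compX, idmX, homX, obX] 0 claim))"
definition goalG where "goalG = Pr (Ty 0) (Pr oneX (inst [compG, idmG, homG, obG] 0 claim))"

lemma tyof_main: "tyof main_d = goalG"
proof -
  \<comment> \<open>The builder copies are inserted because the congruence rules would keep the
    unevaluated \<open>inst\<close> below genuine constructors from being computed.\<close>
  have "goalG = mPr (Ty 0) (mPr oneX (inst (mCons compG (mCons idmG (mCons homG (mCons obG [])))) 0 claim))"
    by (simp only: goalG_def builders)
  then show ?thesis by (simp only: ev claim_eval G_eval cong: congs)
qed

lemma claim_checks:
  "tc (Infer [compT, idmT, homT, Ty 0] claim []) = Some (Ty 0)"
  "tc (Infer [Ty 0] oneX []) = Some (Ty 0)"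
  "tc (Infer [Ty 0] homT []) = Some (Ty (Suc 0))"
  "tc (Infer [homT, Ty 0] idmT []) = Some (Ty 0)"
  "tc (Infer [idmT, homT, Ty 0] compT []) = Some (Ty 0)"
  by (simp only: ev claim_eval cong: congs)+

lemma X_checks:
  "check [oneX, Ty 0] obX (Ty 0) = Some True"
  "check [oneX, Ty 0] homX (inst [obX] 0 homT) = Some True"
  "check [oneX, Ty 0] idmX (inst [homX, obX] 0 idmT) = Some True"
  "check [oneX, Ty 0] compX (inst [idmX, homX, obX] 0 compT) = Some True"
  by (simp only: ev claim_eval X_eval cong: congs)+

lemma G_eq_X:
  "cv [(obG, obX)] = Some True"
  "cv [(homG, homX)] = Some True"
  "cv [(idmG, idmX)] = Some True"
  "cv [(compG, compX)] = Some True"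
  unfolding G_eval X_eval by (simp only: ev cong: congs)+

lemma ok_parts:
  "ok i obX" "ok i homX" "ok i idmX" "ok i compX" "ok i obG" "ok i homG" "ok i idmG" "ok i compG"
  "ok i claim" "ok i homT" "ok i idmT" "ok i compT" "ok i oneX"
  by (simp only: ev oks claim_eval G_eval X_eval cong: congs)+

lemma tm_ev:
  "PI A B n = Pi (A n) (B (bvar n) (Suc n))" "LAM A b n = Lam (A n) (b (bvar n) (Suc n))" "(f \<cdot> a) n = App (f n) (a n)"
  "CST c n = Cst c" "UU k n = U k" "bvar k n = Var (n - Suc k)"
  by (simp_all add: PI_def LAM_def APP_def CST_def UU_def bvar_def)

lemma tm_congs: "PI A B n = PI A B n" "LAM A b n = LAM A b n" "(f \<cdot> a) n = (f \<cdot> a) n"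
  by (rule refl)+

lemmas macros = Arrow_def SIG_def PAIR_def Prod_def Sum_def EQ_def rfl_def Trunc_def pr1_def pr2_def proj1_def proj2_def
      is_set_def is_1type_def is_contr_def with_precat_def is_precategory_def has_initial_def has_binary_coproducts_def
      has_finite_coproducts_def prod_precat_def diagonal_def zigzag_pos_def zigzag_def is_connected_def slice_ob_def
      slice_hom_def is_final_def is_sifted_def Fin_def concat_path_def ap_path_def HX_def Let_def precat.select_convs functr.select_convs
text \<open>The bridge to the statement: after evaluation on one side and unfolding of the notations
  on the other, both are the same de Bruijn term.\<close>

lemma er_goalX: "er i goalX = closed_tm (\<Pi> X : UU i. is_1type X \<rightarrow>
    is_precategory i (HX i X) \<otimes> has_finite_coproducts i (HX i X) \<otimes> is_sifted i (HX i X))"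
proof -
  have goalX: "er i goalX = er i (mPr (Ty 0) (mPr oneX (inst (mCons compX (mCons idmX (mCons homX (mCons obX [])))) 0 claim)))"
    by (simp only: goalX_def builders)
  show ?thesis
    unfolding goalX
    by (simp only: ev claim_eval X_eval cong: congs,
        simp only: er.simps add_0_right proj1_eval proj2_eval concat_eval ap_eval connected_eval precategory_eval
          finite_coproducts_eval sifted_eval,
        unfold macros,
        simp only: closed_tm_def tm_ev diff_Suc_Suc minus_nat.diff_0 prod.case cong: tm_congs)
qed

theorem lemma3p11:
  fixes i :: nat
  shows "inhabited (\<Pi> X : UU i. is_1type X \<rightarrow>
    is_precategory i (HX i X) \<otimes> has_finite_coproducts i (HX i X) \<otimes> is_sifted i (HX i X))"
proof -
  let ?\<Gamma> = "ers i [oneX, Ty 0]" and ?\<Delta> = "[compT, idmT, homT, Ty 0]"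
  let ?new = "[compX, idmX, homX, obX]" and ?old = "[compG, idmG, homG, obG]"
  have U: "[] \<turnstile> er i (Ty 0) : U (Suc i)" using ctxt_Nil by (auto intro: ty_U)
  then have X: "ctxt (ers i [Ty 0])" by (auto intro: ctxt_Cons ctxt_Nil)
  have one: "ers i [Ty 0] \<turnstile> er i oneX : U i"
    using tc_sound[OF claim_checks(2), of i] X ok_parts by (simp add: sound_def)
  with X have ctxt: "ctxt ?\<Gamma>" by (auto intro: ctxt_Cons)
  note checks = check_sound(1)[OF X_checks(1) ctxt] check_sound(1)[OF X_checks(2) ctxt] check_sound(1)[OF X_checks(3) ctxt] check_sound(1)[OF X_checks(4) ctxt]
  \<comment> \<open>The claim is typed once, with the components as variables. The substitution
    lemma then types its instance at the components of \<open>HX\<close> without checking the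
    expanded claim.\<close>
  have subst: "substitution (env (ers i ?new)) (ers i ?\<Delta>) ?\<Gamma>"
    using checks ok_parts ctxt er_inst[of i _ _ 0]
    by (auto intro!: substitution_Cons substitution_Nil)
  have homT: "ctxt (ers i [homT, Ty 0])"
    using tc_sound[OF claim_checks(3), of i] X ok_parts by (auto simp: sound_def intro: ctxt_Cons)
  then have idmT: "ctxt (ers i [idmT, homT, Ty 0])"
    using tc_sound[OF claim_checks(4), of i] ok_parts by (auto simp: sound_def intro: ctxt_Cons)
  then have "ctxt (ers i ?\<Delta>)"
    using tc_sound[OF claim_checks(5), of i] ok_parts by (auto simp: sound_def intro: ctxt_Cons)
  then have "ers i ?\<Delta> \<turnstile> er i claim : U i"
    using tc_sound[OF claim_checks(1), of i] ok_parts by (simp add: sound_def)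
  from typing_sub[OF this subst] have "?\<Gamma> \<turnstile> er i (inst ?new 0 claim) : U i"
    using ok_parts by (simp add: er_inst)
  with one have body: "ers i [Ty 0] \<turnstile> Pi (er i oneX) (er i (inst ?new 0 claim)) : U i"
    by (auto intro: ty_Pi)
  have type: "[] \<turnstile> er i goalX : U (Suc i)"
    unfolding goalX_def er.simps using U body by (auto intro: ty_Pi ty_cumulative)
  \<comment> \<open>Only the four components are compared; convertible components give convertible
    instances of the claim.\<close>
  have "list_all2 (\<down>) (ers i ?old) (ers i ?new)"
    using cv_sound[OF G_eq_X(1), of i] cv_sound[OF G_eq_X(2), of i] cv_sound[OF G_eq_X(3), of i] cv_sound[OF G_eq_X(4), of i] ok_parts by simp
  then have "er i (inst ?old 0 claim) \<down> er i (inst ?new 0 claim)"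
    using ok_parts by (auto simp: er_inst intro: conv_sub_pointwise env_conv)
  then have "er i goalG \<down> er i goalX"
    unfolding goalG_def goalX_def by (auto intro: conv_Pi conv_refl)
  \<comment> \<open>The validity of the name \<open>main_d\<close> contains a typing derivation for
    its erased term, and its type is \<open>goalG\<close>.\<close>
  moreover have "[] \<turnstile> er i (tmof main_d) : er i goalG"
    using main_ok by (auto elim: ok_GlE simp: tyof_main)
  ultimately have "[] \<turnstile> er i (tmof main_d) : er i goalX"
    using type by (auto intro: ty_conv)
  with type show ?thesis
    unfolding inhabited_def er_goalX by blast
qed

end
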